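(* Let $(M,g)$ be a pseudo-Riemannian manifold of dimension at least two with Levi-Civita connection $\nabla$ and curvature tensor $R$, and let $\hat M$ be its cone. The assignments $\kappa\mapsto(\kappa,C^\kappa)$, $\kappa\mapsto S^\kappa$ and $S\mapsto\kappa_S$ (all defined in the context) yield a one-to-one correspondence between: (a) symmetric Killing 2-tensors $\kappa$ on $M$ which satisfy the nullity conditions $$R_{x,y}\cdot\kappa=-(x\wedge y)\cdot\kappa,\qquad R_{x,y}\cdot\nabla\kappa=-(x\wedge y)\cdot\nabla\kappa$$ for all $p\in M$ and $x,y\in T_pM$; (b) pairs $(\kappa,C)$ of symmetric 2-tensors $\kappa$ and symmetrized algebraic curvature tensors $C$ on $M$ satisfying $$C(x,\cdot,\cdot,\cdot)=\nabla_x\nabla\kappa+2\,\kappa\odot x^\sharp,\qquad \nabla_xC=-\nabla\kappa\odot x^\sharp$$ for all $p\in M$ and $x\in T_pM$; (c) symmetrized algebraic curvature tensors on the cone $\hat M$ which are parallel for the Levi-Civita connection of $\hat M$.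
   Context: Write $\langle x,y\rangle=g(x,y)$ and $x^\sharp=\langle x,\cdot\rangle$. $R_{x,y}=\nabla_x\nabla_y-\nabla_y\nabla_x-\nabla_{[x,y]}$. An endomorphism $A$ of $T_pM$ acts on a covariant $k$-tensor by $(A\cdot\gamma)(x_1,\dots,x_k)=-\sum_i\gamma(x_1,\dots,Ax_i,\dots,x_k)$. $x\wedge y$ denotes the endomorphism $z\mapsto\langle x,z\rangle y-\langle y,z\rangle x$. $\nabla\kappa$ is the 3-tensor $\nabla\kappa(x_1,x_2,x_3)=(\nabla_{x_1}\kappa)(x_2,x_3)$ (endomorphisms act on all three slots), and $\nabla^2_{x,y}\kappa=(\nabla_x\nabla\kappa)(y,\cdot,\cdot)$. A symmetric 2-tensor $\kappa$ is Killing if $(\nabla_x\kappa)(x,x)=0$ for all $x$. A symmetrized algebraic curvature tensor is a covariant 4-tensor $\gamma$ symmetric in its first two and in its last two arguments with $\gamma(u,u,u,v)=0$ for all $u,v$. Symmetrizers. For a trilinear form $f$: $(\mathrm S_{2,1}f)(v_1,v_2,v_3)=f(v_1,v_2,v_3)-f(v_2,v_1,v_3)+f(v_1,v_3,v_2)-f(v_3,v_1,v_2)$ and $\mathrm P_{2,1}=\frac13\mathrm S_{2,1}$. For a 4-linear form $f$, put $\tilde f(v_1,v_2,v_3,v_4)=f(v_1,v_2,v_3,v_4)-f(v_3,v_2,v_1,v_4)-f(v_1,v_4,v_3,v_2)+f(v_3,v_4,v_1,v_2)$; $(\mathrm S_{2,2}f)(v_1,v_2,v_3,v_4)=\tilde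 f(v_1,v_2,v_3,v_4)+\tilde f(v_2,v_1,v_3,v_4)+\tilde f(v_1,v_2,v_4,v_3)+\tilde f(v_2,v_1,v_4,v_3)$ and $\mathrm P_{2,2}=\frac1{12}\mathrm S_{2,2}$. Products. For a symmetric 2-tensor $\alpha$ and a 1-form $\lambda$: $(\alpha\odot\lambda)(v_1,v_2,v_3)=\lambda(v_1)\alpha(v_2,v_3)-\frac12\lambda(v_2)\alpha(v_1,v_3)-\frac12\lambda(v_3)\alpha(v_1,v_2)$. For a 3-tensor $\beta$ symmetric in its last two arguments and a 1-form $\lambda$: $\beta\odot\lambda=\frac13\mathrm S_{2,2}f$ with $f(v_1,\dots,v_4)=\lambda(v_1)\beta(v_2,v_3,v_4)$. For symmetric 2-tensors $\alpha_1,\alpha_2$: $\alpha_1\odot\alpha_2=\frac14\mathrm S_{2,2}f$ with $f(v_1,\dots,v_4)=\alpha_1(v_1,v_2)\alpha_2(v_3,v_4)$. For 1-forms, $(\lambda_1\bullet\lambda_2)(v_1,v_2)=\lambda_1(v_1)\lambda_2(v_2)+\lambda_1(v_2)\lambda_2(v_1)$. Prolongation variables. $\kappa^1=\mathrm P_{2,1}(\nabla\kappa)$, and $\kappa^2=\mathrm P_{2,2}f$ with $f(x_1,\dots,x_4)=(\nabla^2_{x_1,x_2}\kappa)(x_3,x_4)$. Cone. $\hat M=M\times\mathbb R_+$ with metric $\hat g=r^2g+dr^2$, projection $\tau:\hat M\to M$ and inclusion $\iota:M\to\hat M$, $p\mapsto(p,1)$; tensors on $M$ are regarded as tensors on $\hat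 M$ by pullback along $\tau$. For a symmetric 2-tensor $\kappa$ on $M$ set $C^\kappa=\kappa^2+\kappa\odot g$ (on $M$) and $S^\kappa=r^2\,\kappa\odot(dr\bullet dr)+r^3\,\kappa^1\odot dr+r^4\,C^\kappa$ (on $\hat M$). For a symmetrized algebraic curvature tensor $S$ on $\hat M$ set $\kappa_S(x,y)=\frac12S(\partial_r,\partial_r,d\iota\,x,d\iota\,y)$, evaluated at $(p,1)$, for $x,y\in T_pM$. *)

theory Defs
  imports "HOL-Analysis.Analysis"
begin

primrec times_differentiable_on ::
    "nat \<Rightarrow> 'b::real_normed_vector set \<Rightarrow> ('b \<Rightarrow> 'c::real_normed_vector) \<Rightarrow> bool" where
  "times_differentiable_on 0 U f \<longleftrightarrow> continuous_on U f"
| "times_differentiable_on (Suc k) U f \<longleftrightarrow>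
     (\<forall>u\<in>U. f differentiable (at u)) \<and>
     (\<forall>v. times_differentiable_on k U (\<lambda>u. frechet_derivative f (at u) v))"

text \<open>Full derivatives are taken, so this is meaningful for open \<open>U\<close> only.\<close>

definition smooth_on :: "'b::real_normed_vector set \<Rightarrow> ('b \<Rightarrow> 'c::real_normed_vector) \<Rightarrow> bool" where
  "smooth_on U f \<longleftrightarrow> (\<forall>k. times_differentiable_on k U f)"

text \<open>A chart is a domain together with a coordinate map; the values of the map outside
  the domain are irrelevant.\<close>

type_synonym ('a, 'e) chart = "'a set \<times> ('a \<Rightarrow> 'e)"

definition chart_inv :: "('a, 'e) chart \<Rightarrow> 'e \<Rightarrow> 'a" where
  "chart_inv c = inv_into (fst c) (snd c)"

definition chart_image :: "('a, 'e) chart \<Rightarrow> 'e set" where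
  "chart_image c = snd c ` fst c"

text \<open>A smooth manifold is given by a topology, a (not necessarily maximal) smooth atlas, and
  a preferred chart \<open>chart_at p\<close> of the atlas around every point \<open>p\<close>. The only role of the
  preferred chart is to provide a concrete model of the tangent space: its differential at
  \<open>p\<close> identifies \<open>T\<^sub>pM\<close> with the vector space \<open>'e\<close>, so that \<open>x :: 'e\<close> stands for the tangent
  vector at \<open>p\<close> with coordinates \<open>x\<close> in \<open>chart_at p\<close>. The dimension is \<open>DIM('e)\<close>.\<close>

record ('a, 'e) manifold =
  man_topology :: "'a topology"
  atlas :: "('a, 'e) chart set"
  chart_at :: "'a \<Rightarrow> ('a, 'e) chart"

abbreviation points :: "('a, 'e) manifold \<Rightarrow> 'a set" where
  "points M \<equiv> topspace (man_topology M)"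

definition smooth_manifold :: "('a, 'e::euclidean_space) manifold \<Rightarrow> bool" where
  "smooth_manifold M \<longleftrightarrow>
     Hausdorff_space (man_topology M) \<and> second_countable (man_topology M) \<and>
     (\<forall>c\<in>atlas M. openin (man_topology M) (fst c) \<and> open (chart_image c) \<and>
        homeomorphic_map (subtopology (man_topology M) (fst c))
          (top_of_set (chart_image c)) (snd c)) \<and>
     (\<forall>p\<in>points M. chart_at M p \<in> atlas M \<and> p \<in> fst (chart_at M p)) \<and>
     (\<forall>c\<in>atlas M. \<forall>c'\<in>atlas M. smooth_on (snd c ` (fst c \<inter> fst c')) (snd c' \<circ> chart_inv c))"

text \<open>A covariant \<open>k\<close>-tensor on a vector space is a function on lists of vectors that is
  multilinear on lists of length \<open>k\<close>. So that equality of tensors is equality of functions, it is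
  set to \<open>0\<close> on lists of any other length.\<close>

type_synonym 'v tensor = "'v list \<Rightarrow> real"

definition multilinear :: "nat \<Rightarrow> 'v::real_vector tensor \<Rightarrow> bool" where
  "multilinear k \<gamma> \<longleftrightarrow>
     (\<forall>xs i. length xs = k \<longrightarrow> i < k \<longrightarrow> linear (\<lambda>x. \<gamma> (xs[i := x]))) \<and>
     (\<forall>xs. length xs \<noteq> k \<longrightarrow> \<gamma> xs = 0)"

definition act :: "('v \<Rightarrow> 'v) \<Rightarrow> 'v tensor \<Rightarrow> 'v tensor" where
  "act A \<gamma> xs = - (\<Sum>i<length xs. \<gamma> (xs[i := A (xs ! i)]))"

definition symmetric2 :: "'v tensor \<Rightarrow> bool" where
  "symmetric2 \<gamma> \<longleftrightarrow> (\<forall>x y. \<gamma> [x, y] = \<gamma> [y, x])"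

definition sym_curvature_like :: "'v tensor \<Rightarrow> bool" where
  "sym_curvature_like \<gamma> \<longleftrightarrow>
     (\<forall>x y z w. \<gamma> [x, y, z, w] = \<gamma> [y, x, z, w]) \<and>
     (\<forall>x y z w. \<gamma> [x, y, z, w] = \<gamma> [x, y, w, z]) \<and>
     (\<forall>u v. \<gamma> [u, u, u, v] = 0)"

definition S21 :: "('v \<Rightarrow> 'v \<Rightarrow> 'v \<Rightarrow> real) \<Rightarrow> 'v tensor" where
  "S21 f xs = (case xs of
     [v1, v2, v3] \<Rightarrow> f v1 v2 v3 - f v2 v1 v3 + f v1 v3 v2 - f v3 v1 v2
   | _ \<Rightarrow> 0)"

definition P21 :: "('v \<Rightarrow> 'v \<Rightarrow> 'v \<Rightarrow> real) \<Rightarrow> 'v tensor" where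
  "P21 f xs = 1/3 * S21 f xs"

definition alternate_odd_even ::
    "('v \<Rightarrow> 'v \<Rightarrow> 'v \<Rightarrow> 'v \<Rightarrow> real) \<Rightarrow> 'v \<Rightarrow> 'v \<Rightarrow> 'v \<Rightarrow> 'v \<Rightarrow> real" where
  "alternate_odd_even f v1 v2 v3 v4 =
     f v1 v2 v3 v4 - f v3 v2 v1 v4 - f v1 v4 v3 v2 + f v3 v4 v1 v2"

definition S22 :: "('v \<Rightarrow> 'v \<Rightarrow> 'v \<Rightarrow> 'v \<Rightarrow> real) \<Rightarrow> 'v tensor" where
  "S22 f xs = (case xs of
     [v1, v2, v3, v4] \<Rightarrow>
       alternate_odd_even f v1 v2 v3 v4 + alternate_odd_even f v2 v1 v3 v4 +
       alternate_odd_even f v1 v2 v4 v3 + alternate_odd_even f v2 v1 v4 v3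
   | _ \<Rightarrow> 0)"

definition P22 :: "('v \<Rightarrow> 'v \<Rightarrow> 'v \<Rightarrow> 'v \<Rightarrow> real) \<Rightarrow> 'v tensor" where
  "P22 f xs = 1/12 * S22 f xs"

definition odot21 :: "'v tensor \<Rightarrow> ('v \<Rightarrow> real) \<Rightarrow> 'v tensor" where
  "odot21 \<alpha> l xs = (case xs of
     [v1, v2, v3] \<Rightarrow> l v1 * \<alpha> [v2, v3] - 1/2 * l v2 * \<alpha> [v1, v3] - 1/2 * l v3 * \<alpha> [v1, v2]
   | _ \<Rightarrow> 0)"

definition odot31 :: "'v tensor \<Rightarrow> ('v \<Rightarrow> real) \<Rightarrow> 'v tensor" where
  "odot31 \<beta> l xs = 1/3 * S22 (\<lambda>v1 v2 v3 v4. l v1 * \<beta> [v2, v3, v4]) xs"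

definition odot22 :: "'v tensor \<Rightarrow> 'v tensor \<Rightarrow> 'v tensor" where
  "odot22 \<alpha>1 \<alpha>2 xs = 1/4 * S22 (\<lambda>v1 v2 v3 v4. \<alpha>1 [v1, v2] * \<alpha>2 [v3, v4]) xs"

definition bullet :: "('v \<Rightarrow> real) \<Rightarrow> ('v \<Rightarrow> real) \<Rightarrow> 'v tensor" where
  "bullet l1 l2 xs = (case xs of
     [v1, v2] \<Rightarrow> l1 v1 * l2 v2 + l1 v2 * l2 v1
   | _ \<Rightarrow> 0)"

text \<open>\<open>frame M c u\<close> maps the coordinates, in the chart \<open>c\<close>, of a tangent vector at the point \<open>p\<close>
  with \<open>c\<close>-coordinates \<open>u\<close> to the element of \<open>T\<^sub>pM = 'e\<close> (coordinates in \<open>chart_at M p\<close>)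
  representing the same tangent vector.\<close>

definition frame :: "('a, 'e::euclidean_space) manifold \<Rightarrow> ('a, 'e) chart \<Rightarrow> 'e \<Rightarrow> 'e \<Rightarrow> 'e" where
  "frame M c u = frechet_derivative (snd (chart_at M (chart_inv c u)) \<circ> chart_inv c) (at u)"

definition in_chart ::
    "('a, 'e::euclidean_space) manifold \<Rightarrow> ('a, 'e) chart \<Rightarrow> ('a \<Rightarrow> 'e tensor) \<Rightarrow> 'e \<Rightarrow> 'e tensor" where
  "in_chart M c T u xs = T (chart_inv c u) (map (frame M c u) xs)"

text \<open>Smooth tensor fields, set to \<open>0\<close> outside the manifold so that equality of tensor fields is
  equality of functions.\<close>

definition tensor_field ::
    "('a, 'e::euclidean_space) manifold \<Rightarrow> nat \<Rightarrow> ('a \<Rightarrow> 'e tensor) \<Rightarrow> bool" where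
  "tensor_field M k T \<longleftrightarrow>
     (\<forall>p\<in>points M. multilinear k (T p)) \<and>
     (\<forall>p xs. p \<notin> points M \<longrightarrow> T p xs = 0) \<and>
     (\<forall>c\<in>atlas M. \<forall>xs. length xs = k \<longrightarrow> smooth_on (chart_image c) (\<lambda>u. in_chart M c T u xs))"

definition symmetric2_field :: "('a, 'e::euclidean_space) manifold \<Rightarrow> ('a \<Rightarrow> 'e tensor) \<Rightarrow> bool" where
  "symmetric2_field M \<kappa> \<longleftrightarrow> tensor_field M 2 \<kappa> \<and> (\<forall>p\<in>points M. symmetric2 (\<kappa> p))"

definition sym_curvature_field :: "('a, 'e::euclidean_space) manifold \<Rightarrow> ('a \<Rightarrow> 'e tensor) \<Rightarrow> bool" where
  "sym_curvature_field M C \<longleftrightarrow> tensor_field M 4 C \<and> (\<forall>p\<in>points M. sym_curvature_like (C p))"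

definition pseudo_riemannian :: "('a, 'e::euclidean_space) manifold \<Rightarrow> ('a \<Rightarrow> 'e tensor) \<Rightarrow> bool" where
  "pseudo_riemannian M g \<longleftrightarrow>
     smooth_manifold M \<and> symmetric2_field M g \<and>
     (\<forall>p\<in>points M. \<forall>x. (\<forall>y. g p [x, y] = 0) \<longrightarrow> x = 0)"

text \<open>In a chart, a connection is \<open>\<nabla>\<^sub>X Y = D\<^sub>X Y + \<Gamma>(X, Y)\<close> with \<open>\<Gamma>\<close> bilinear at each point. It is
  torsion-free iff \<open>\<Gamma>\<close> is symmetric, and metric iff
  \<open>D\<^sub>x g (y, z) = g (\<Gamma>(x, y), z) + g (y, \<Gamma>(x, z))\<close>. The Levi-Civita connection is the unique one
  with both properties.\<close>

definition levi_civita ::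
    "('a, 'e::euclidean_space) manifold \<Rightarrow> ('a \<Rightarrow> 'e tensor) \<Rightarrow> ('a, 'e) chart \<Rightarrow> 'e \<Rightarrow> 'e \<Rightarrow> 'e \<Rightarrow> 'e" where
  "levi_civita M g c u = (THE \<Gamma>. bilinear \<Gamma> \<and> (\<forall>x y. \<Gamma> x y = \<Gamma> y x) \<and>
     (\<forall>x y z. frechet_derivative (\<lambda>w. in_chart M c g w [y, z]) (at u) x =
        in_chart M c g u [\<Gamma> x y, z] + in_chart M c g u [y, \<Gamma> x z]))"

definition nabla_vec ::
    "('a, 'e::euclidean_space) manifold \<Rightarrow> ('a \<Rightarrow> 'e tensor) \<Rightarrow> ('a, 'e) chart \<Rightarrow>
     ('e \<Rightarrow> 'e) \<Rightarrow> ('e \<Rightarrow> 'e) \<Rightarrow> 'e \<Rightarrow> 'e" where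
  "nabla_vec M g c X Y u = frechet_derivative Y (at u) (X u) + levi_civita M g c u (X u) (Y u)"

definition lie_bracket :: "('e::euclidean_space \<Rightarrow> 'e) \<Rightarrow> ('e \<Rightarrow> 'e) \<Rightarrow> 'e \<Rightarrow> 'e" where
  "lie_bracket X Y u = frechet_derivative Y (at u) (X u) - frechet_derivative X (at u) (Y u)"

text \<open>\<open>R(x, y) z\<close> does not depend on the local vector fields extending \<open>x\<close>, \<open>y\<close>, \<open>z\<close>; here they are
  extended with constant coordinates in \<open>chart_at M p\<close>.\<close>

definition curvature ::
    "('a, 'e::euclidean_space) manifold \<Rightarrow> ('a \<Rightarrow> 'e tensor) \<Rightarrow> 'a \<Rightarrow> 'e \<Rightarrow> 'e \<Rightarrow> 'e \<Rightarrow> 'e" where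
  "curvature M g p x y z =
     (let c = chart_at M p; u = snd c p; X = (\<lambda>_. x); Y = (\<lambda>_. y); Z = (\<lambda>_. z) in
        nabla_vec M g c X (nabla_vec M g c Y Z) u - nabla_vec M g c Y (nabla_vec M g c X Z) u
        - nabla_vec M g c (lie_bracket X Y) Z u)"

text \<open>Covariant derivative of a covariant tensor field: the derivative direction is the first
  argument, so \<open>\<nabla>T (x, y\<^sub>1, \<dots>, y\<^sub>k) = (\<nabla>\<^sub>x T) (y\<^sub>1, \<dots>, y\<^sub>k)\<close>.\<close>

definition nabla ::
    "('a, 'e::euclidean_space) manifold \<Rightarrow> ('a \<Rightarrow> 'e tensor) \<Rightarrow> ('a \<Rightarrow> 'e tensor) \<Rightarrow> 'a \<Rightarrow> 'e tensor" where
  "nabla M g T p xs =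
     (if p \<in> points M then
        (case xs of
           [] \<Rightarrow> 0
         | x # ys \<Rightarrow>
             (let c = chart_at M p; u = snd c p in
                frechet_derivative (\<lambda>w. in_chart M c T w ys) (at u) x
                - (\<Sum>i<length ys. in_chart M c T u (ys[i := levi_civita M g c u x (ys ! i)]))))
      else 0)"

definition flat :: "('a \<Rightarrow> 'e tensor) \<Rightarrow> 'a \<Rightarrow> 'e \<Rightarrow> 'e \<Rightarrow> real" where
  "flat g p x y = g p [x, y]"

definition wedge :: "('a \<Rightarrow> 'e::real_vector tensor) \<Rightarrow> 'a \<Rightarrow> 'e \<Rightarrow> 'e \<Rightarrow> 'e \<Rightarrow> 'e" where
  "wedge g p x y z = g p [x, z] *\<^sub>R y - g p [y, z] *\<^sub>R x"

definition killing2 :: "('a, 'e::euclidean_space) manifold \<Rightarrow> ('a \<Rightarrow> 'e tensor) \<Rightarrow> ('a \<Rightarrow> 'e tensor) \<Rightarrow> bool" where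
  "killing2 M g \<kappa> \<longleftrightarrow> symmetric2_field M \<kappa> \<and> (\<forall>p\<in>points M. \<forall>x. nabla M g \<kappa> p [x, x, x] = 0)"

definition prolong1 ::
    "('a, 'e::euclidean_space) manifold \<Rightarrow> ('a \<Rightarrow> 'e tensor) \<Rightarrow> ('a \<Rightarrow> 'e tensor) \<Rightarrow> 'a \<Rightarrow> 'e tensor" where
  "prolong1 M g \<kappa> p = P21 (\<lambda>x1 x2 x3. nabla M g \<kappa> p [x1, x2, x3])"

definition prolong2 ::
    "('a, 'e::euclidean_space) manifold \<Rightarrow> ('a \<Rightarrow> 'e tensor) \<Rightarrow> ('a \<Rightarrow> 'e tensor) \<Rightarrow> 'a \<Rightarrow> 'e tensor" where
  "prolong2 M g \<kappa> p = P22 (\<lambda>x1 x2 x3 x4. nabla M g (nabla M g \<kappa>) p [x1, x2, x3, x4])"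

definition C_of ::
    "('a, 'e::euclidean_space) manifold \<Rightarrow> ('a \<Rightarrow> 'e tensor) \<Rightarrow> ('a \<Rightarrow> 'e tensor) \<Rightarrow> 'a \<Rightarrow> 'e tensor" where
  "C_of M g \<kappa> p xs = prolong2 M g \<kappa> p xs + odot22 (\<kappa> p) (g p) xs"

text \<open>The cone \<open>M \<times> \<real>\<^sub>+\<close> carries the product atlas and product preferred charts, so that
  the tangent space \<open>T\<^sub>pM \<times> \<real>\<close> at \<open>(p, r)\<close> becomes \<open>'e \<times> real\<close>: the differential of the projection
  \<open>(p, r) \<mapsto> p\<close> is \<open>fst\<close>, \<open>dr\<close> is \<open>snd\<close>, \<open>\<partial>\<^sub>r\<close> is \<open>(0, 1)\<close>, and the differential
  of \<open>p \<mapsto> (p, 1)\<close> is \<open>x \<mapsto> (x, 0)\<close>.\<close>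

definition cone_chart :: "('a, 'e) chart \<Rightarrow> ('a \<times> real, 'e \<times> real) chart" where
  "cone_chart c = (fst c \<times> {0<..}, map_prod (snd c) id)"

definition cone_manifold :: "('a, 'e) manifold \<Rightarrow> ('a \<times> real, 'e \<times> real) manifold" where
  "cone_manifold M = \<lparr>
     man_topology = prod_topology (man_topology M) (top_of_set {0<..}),
     atlas = cone_chart ` atlas M,
     chart_at = (\<lambda>(p, r). cone_chart (chart_at M p)) \<rparr>"

definition pullback :: "('a \<Rightarrow> 'e tensor) \<Rightarrow> 'a \<times> real \<Rightarrow> ('e \<times> real) tensor" where
  "pullback T q xs = T (fst q) (map fst xs)"

definition dr :: "'e \<times> real \<Rightarrow> real" where
  "dr = snd"

text \<open>The cone metric \<open>r\<^sup>2 g + dr\<^sup>2\<close>; recall that \<open>dr \<bullet> dr = 2 dr\<^sup>2\<close>.\<close>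

definition cone_metric :: "('a, 'e) manifold \<Rightarrow> ('a \<Rightarrow> 'e tensor) \<Rightarrow> 'a \<times> real \<Rightarrow> ('e \<times> real) tensor" where
  "cone_metric M g q xs =
     (if q \<in> points M \<times> {0<..} then (snd q)\<^sup>2 * pullback g q xs + 1/2 * bullet dr dr xs else 0)"

definition S_of ::
    "('a, 'e::euclidean_space) manifold \<Rightarrow> ('a \<Rightarrow> 'e tensor) \<Rightarrow> ('a \<Rightarrow> 'e tensor) \<Rightarrow>
     'a \<times> real \<Rightarrow> ('e \<times> real) tensor" where
  "S_of M g \<kappa> q xs =
     (if q \<in> points M \<times> {0<..} then
        (snd q)\<^sup>2 * odot22 (pullback \<kappa> q) (bullet dr dr) xs
        + (snd q)^3 * odot31 (pullback (prolong1 M g \<kappa>) q) dr xs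
        + (snd q)^4 * pullback (C_of M g \<kappa>) q xs
      else 0)"

definition kappa_of :: "('a \<times> real \<Rightarrow> ('e::euclidean_space \<times> real) tensor) \<Rightarrow> 'a \<Rightarrow> 'e tensor" where
  "kappa_of S p xs = (case xs of
     [x, y] \<Rightarrow> 1/2 * S (p, 1) [(0, 1), (0, 1), (x, 0), (y, 0)]
   | _ \<Rightarrow> 0)"

definition nullity_killing_tensors ::
    "('a, 'e::euclidean_space) manifold \<Rightarrow> ('a \<Rightarrow> 'e tensor) \<Rightarrow> ('a \<Rightarrow> 'e tensor) set" where
  "nullity_killing_tensors M g = {\<kappa>. killing2 M g \<kappa> \<and>
     (\<forall>p\<in>points M. \<forall>x y xs. length xs = 2 \<longrightarrow>
        act (curvature M g p x y) (\<kappa> p) xs = - act (wedge g p x y) (\<kappa> p) xs) \<and>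
     (\<forall>p\<in>points M. \<forall>x y xs. length xs = 3 \<longrightarrow>
        act (curvature M g p x y) (nabla M g \<kappa> p) xs = - act (wedge g p x y) (nabla M g \<kappa> p) xs)}"

definition prolongation_pairs ::
    "('a, 'e::euclidean_space) manifold \<Rightarrow> ('a \<Rightarrow> 'e tensor) \<Rightarrow>
     (('a \<Rightarrow> 'e tensor) \<times> ('a \<Rightarrow> 'e tensor)) set" where
  "prolongation_pairs M g = {(\<kappa>, C). symmetric2_field M \<kappa> \<and> sym_curvature_field M C \<and>
     (\<forall>p\<in>points M. \<forall>x ys. length ys = 3 \<longrightarrow>
        C p (x # ys) = nabla M g (nabla M g \<kappa>) p (x # ys) + 2 * odot21 (\<kappa> p) (flat g p x) ys) \<and>
     (\<forall>p\<in>points M. \<forall>x ys. length ys = 4 \<longrightarrow>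
        nabla M g C p (x # ys) = - odot31 (nabla M g \<kappa> p) (flat g p x) ys)}"

definition parallel_sym_curvature_tensors ::
    "('a, 'e::euclidean_space) manifold \<Rightarrow> ('a \<Rightarrow> 'e tensor) \<Rightarrow> ('a \<Rightarrow> 'e tensor) set" where
  "parallel_sym_curvature_tensors M g = {S. sym_curvature_field M S \<and>
     (\<forall>p\<in>points M. \<forall>x ys. length ys = 4 \<longrightarrow> nabla M g S p (x # ys) = 0)}"

end

theory Submission
  imports Defs
begin

text \<open>
  The bridge between the three descriptions is the prolongation of the Killing equation. If
  \<open>\<kappa>\<close> is a Killing tensor, then \<open>\<beta> = \<nabla>\<kappa>\<close> has the symmetries of a hook (symmetric in the last two
  slots, cyclic sum zero), and \<open>C = \<nabla>\<^sup>2\<kappa> + 2 \<kappa> \<odot> x\<^sup>\<sharp>\<close> satisfies the cyclic identity in its last three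
  slots. By the Ricci identity, its antisymmetrization in the first two slots is
  \<open>R \<cdot> \<kappa> + (x \<and> y) \<cdot> \<kappa>\<close>, so the first nullity condition says that \<open>C\<close> is a symmetrized
  curvature tensor; it then agrees with \<open>C\<^sup>\<kappa>\<close> because \<open>P\<^sub>2\<^sub>,\<^sub>2\<close> is a projector onto such tensors.
  The Ricci identity for \<open>\<nabla>\<kappa>\<close> turns the second nullity condition into the symmetry of
  \<open>\<nabla>\<^sub>yC(x, \<dots>) + (\<nabla>\<kappa> \<odot> y\<^sup>\<sharp>)(x, \<dots>)\<close> in \<open>x\<close> and \<open>y\<close>. A tensor which is a symmetrized curvature
  tensor in its last four slots and symmetric in its first two is totally symmetric, hence zero;
  this is \<open>\<nabla>C = - \<nabla>\<kappa> \<odot> x\<^sup>\<sharp>\<close>.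

  For the way back the Ricci identity gives both nullity conditions as soon as \<open>\<kappa>\<close> is known to be
  Killing, that is, as soon as the totally symmetric part \<open>T\<close> of \<open>\<nabla>\<kappa>\<close> vanishes. Here dimension at
  least two is needed. Put \<open>E\<^sub>x\<^sub>,\<^sub>y = R\<^sub>x\<^sub>,\<^sub>y + x \<and> y\<close> and let \<open>K\<close> be the endomorphism belonging to \<open>\<kappa>\<close>.
  Since \<open>E\<^sub>x\<^sub>,\<^sub>y\<close> commutes with \<open>K\<close> and \<open>E\<close> is symmetric under exchange of pairs, \<open>E\<close> vanishes on all
  pairs \<open>(K x, x)\<close>. The Ricci identity for \<open>\<nabla>\<kappa>\<close> then yields
  \<open>\<langle>x, a\<rangle> T(K x, b, c) = \<langle>K x, a\<rangle> T(x, b, c)\<close>, and \<open>K\<close> is a multiple of the identity at every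
  point where \<open>T \<noteq> 0\<close>. Such a point has a neighbourhood where \<open>\<kappa> = f g\<close>, so that \<open>\<nabla>\<kappa> = df \<otimes> g\<close>
  there; inserting this in the same identity forces \<open>df = 0\<close> and contradicts \<open>T \<noteq> 0\<close>.

  On the cone, \<open>cone_form r \<kappa> \<beta> C\<close> is the symmetrized curvature tensor with the components
  \<open>2 r\<^sup>2 \<kappa>\<close>, \<open>r\<^sup>3 \<beta>\<close> and \<open>r\<^sup>4 C\<close> for two, one and no radial arguments. The radial equation
  of parallelism fixes these powers of \<open>r\<close>. The horizontal derivative of such a tensor is again of
  this form, with the components \<open>\<nabla>\<^sub>x\<kappa> - \<beta>(x, \<dots>)\<close>, \<open>\<nabla>\<^sub>x\<beta> - C(x, \<dots>) + 2 \<kappa> \<odot> x\<^sup>\<sharp>\<close> and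
  \<open>\<nabla>\<^sub>xC + \<beta> \<odot> x\<^sup>\<sharp>\<close> (\<open>nabla_cone_form_horizontal\<close>). Hence parallel tensors on the cone are the
  same thing as solutions of the prolonged system, and \<open>S\<^sup>\<kappa>\<close> is \<open>cone_form\<close> of
  \<open>\<kappa>\<close>, \<open>\<nabla>\<kappa>\<close> and \<open>C\<^sup>\<kappa>\<close>.

  Before this, the tensor calculus has to be set up: closure properties of smooth functions,
  smoothness of the Christoffel symbols as solutions of a linear system, the independence of the
  covariant derivative of the chart, and the Ricci identity.
\<close>

section \<open>Smooth functions\<close>

lemma frechet_derivative_cong_open:
  assumes "open U" "u \<in> U" "\<And>w. w \<in> U \<Longrightarrow> f w = g w"
  shows "frechet_derivative f (at u) = frechet_derivative g (at u)"
proof -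
  have "(f has_derivative D) (at u) \<longleftrightarrow> (g has_derivative D) (at u)" for D
    using has_derivative_transform_within_open[of f D u UNIV U g]
      has_derivative_transform_within_open[of g D u UNIV U f] assms by auto
  then show ?thesis unfolding frechet_derivative_def by simp
qed

lemma differentiable_cong_open:
  assumes "open U" "u \<in> U" "\<And>w. w \<in> U \<Longrightarrow> f w = g w" "f differentiable (at u)"
  shows "g differentiable (at u)"
  using has_derivative_transform_within_open[of f _ u UNIV U g] assms
  unfolding differentiable_def by blast

lemma times_differentiable_on_cong:
  assumes "open U" "\<And>u. u \<in> U \<Longrightarrow> f u = g u" "times_differentiable_on k U f"
  shows "times_differentiable_on k U g"
  using assms(2,3)
proof (induction k arbitrary: f g)
  case 0
  then show ?case using continuous_on_cong by (metis times_differentiable_on.simps(1))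
next
  case (Suc k)
  have "times_differentiable_on k U (\<lambda>u. frechet_derivative g (at u) v)" for v
    by (rule Suc.IH[of "\<lambda>u. frechet_derivative f (at u) v"])
      (use Suc.prems frechet_derivative_cong_open[OF assms(1), of _ f g] in auto)
  then show ?case
    using Suc.prems differentiable_cong_open[OF assms(1), of _ f g] by simp
qed

lemma times_differentiable_on_Suc_imp:
  "times_differentiable_on (Suc k) U f \<Longrightarrow> times_differentiable_on k U f"
proof (induction k arbitrary: f)
  case 0
  then show ?case
    by (auto intro: continuous_at_imp_continuous_on differentiable_imp_continuous_within)
next
  case (Suc k)
  then show ?case by (metis times_differentiable_on.simps(2))
qed

lemma times_differentiable_on_mono:
  "j \<le> k \<Longrightarrow> times_differentiable_on k U f \<Longrightarrow> times_differentiable_on j U f"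
  by (induction k rule: dec_induct)
    (blast intro: times_differentiable_on_Suc_imp[where f = f and U = U])+

lemma times_differentiable_on_const: "times_differentiable_on k U (\<lambda>u. c)"
  by (induction k arbitrary: c) auto

lemma times_differentiable_on_SucI:
  assumes "open U" "\<And>u. u \<in> U \<Longrightarrow> (f has_derivative f' u) (at u)"
    "\<And>v. times_differentiable_on k U (\<lambda>u. f' u v)"
  shows "times_differentiable_on (Suc k) U f"
proof -
  have "times_differentiable_on k U (\<lambda>u. frechet_derivative f (at u) v)" for v
    by (rule times_differentiable_on_cong[OF assms(1) _ assms(3)[of v]])
      (use assms(2) frechet_derivative_at in metis)
  then show ?thesis using assms(2) by (auto simp: differentiable_def)
qed

lemma times_differentiable_on_SucD:
  assumes "times_differentiable_on (Suc k) U f"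
  shows "\<And>u. u \<in> U \<Longrightarrow> (f has_derivative frechet_derivative f (at u)) (at u)"
    "\<And>v. times_differentiable_on k U (\<lambda>u. frechet_derivative f (at u) v)"
    "times_differentiable_on k U f"
  using assms times_differentiable_on_Suc_imp[OF assms] by (auto simp: frechet_derivative_works)

lemma times_differentiable_on_add:
  assumes "open U" "times_differentiable_on k U f" "times_differentiable_on k U g"
  shows "times_differentiable_on k U (\<lambda>u. f u + g u)"
  using assms(2,3)
proof (induction k arbitrary: f g)
  case 0 then show ?case by (auto intro: continuous_intros)
next
  case (Suc k)
  note D = times_differentiable_on_SucD[OF Suc.prems(1)] times_differentiable_on_SucD[OF Suc.prems(2)]
  show ?case
    by (rule times_differentiable_on_SucI[OF assms(1) has_derivative_add[OF D(1) D(4)]])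
      (auto intro: Suc.IH D)
qed

lemma times_differentiable_on_linear:
  assumes "open U" "bounded_linear L" "times_differentiable_on k U f"
  shows "times_differentiable_on k U (\<lambda>u. L (f u))"
  using assms(3)
proof (induction k arbitrary: f)
  case 0 then show ?case
    using bounded_linear.continuous_on[OF assms(2), of U f] by simp
next
  case (Suc k)
  note D = times_differentiable_on_SucD[OF Suc.prems(1)]
  have "((\<lambda>u. L (f u)) has_derivative (\<lambda>v. L (frechet_derivative f (at u) v))) (at u)" if "u \<in> U" for u
    using bounded_linear.has_derivative[OF assms(2) D(1)[OF that]] .
  then show ?case
    by (rule times_differentiable_on_SucI[OF assms(1) _ Suc.IH[OF D(2)]])
qed

lemma times_differentiable_on_scaleR:
  assumes "open U" "times_differentiable_on k U f" "times_differentiable_on k U g"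
  shows "times_differentiable_on k U (\<lambda>u. f u *\<^sub>R g u)"
  using assms(2,3)
proof (induction k arbitrary: f g)
  case 0 then show ?case by (auto intro: continuous_intros)
next
  case (Suc k)
  note D = times_differentiable_on_SucD[OF Suc.prems(1)] times_differentiable_on_SucD[OF Suc.prems(2)]
  have "times_differentiable_on k U
      (\<lambda>u. f u *\<^sub>R frechet_derivative g (at u) v + frechet_derivative f (at u) v *\<^sub>R g u)" for v
    by (rule times_differentiable_on_add[OF assms(1) Suc.IH[OF D(3) D(5)] Suc.IH[OF D(2) D(6)]])
  then show ?case
    using has_derivative_scaleR[OF D(1) D(4)]
    by (intro times_differentiable_on_SucI[OF assms(1),
          where f' = "\<lambda>u v. f u *\<^sub>R frechet_derivative g (at u) v + frechet_derivative f (at u) v *\<^sub>R g u"])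
qed

lemma times_differentiable_on_sum:
  assumes "open U" "\<And>i. i \<in> I \<Longrightarrow> times_differentiable_on k U (f i)"
  shows "times_differentiable_on k U (\<lambda>u. \<Sum>i\<in>I. f i u)"
  using assms(2)
  by (induction I rule: infinite_finite_induct)
    (auto intro: times_differentiable_on_const times_differentiable_on_add assms(1))


lemma linear_basis_expand:
  fixes x :: "'b::euclidean_space"
  assumes "linear L"
  shows "L x = (\<Sum>e\<in>Basis. (x \<bullet> e) *\<^sub>R L e)"
proof -
  have "L x = L (\<Sum>e\<in>Basis. (x \<bullet> e) *\<^sub>R e)" by (simp add: euclidean_representation)
  also have "\<dots> = (\<Sum>e\<in>Basis. (x \<bullet> e) *\<^sub>R L e)"
    using assms by (simp add: linear_sum linear_scale)
  finally show ?thesis .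
qed

text \<open>By the chain rule, the derivative of a composition is a sum of products of a function that
  is once less differentiable with a composition of the same kind; this is why the statement is
  proved for all outer functions at once.\<close>

lemma times_differentiable_on_compose:
  fixes f :: "'b::real_normed_vector \<Rightarrow> 'c::euclidean_space"
  assumes "open U" "open V" "f ` U \<subseteq> V"
    "times_differentiable_on k U f" "times_differentiable_on k V h"
  shows "times_differentiable_on k U (\<lambda>u. h (f u))"
  using assms(4,5)
proof (induction k arbitrary: h)
  case 0 then show ?case using assms(3) continuous_on_compose2[of V h U f] by simp
next
  case (Suc k)
  note D = times_differentiable_on_SucD[OF Suc.prems(1)] times_differentiable_on_SucD[OF Suc.prems(2)]
  have der: "((\<lambda>u. h (f u)) has_derivative
      (\<lambda>v. \<Sum>e\<in>Basis. (frechet_derivative f (at u) v \<bullet> e) *\<^sub>R frechet_derivative h (at (f u)) e)) (at u)"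
    if "u \<in> U" for u
  proof -
    have fu: "f u \<in> V" using that assms(3) by auto
    have "(h \<circ> f has_derivative frechet_derivative h (at (f u)) \<circ> frechet_derivative f (at u)) (at u)"
      using diff_chain_at[OF D(1)[OF that] D(4)[OF fu]] .
    moreover have "frechet_derivative h (at (f u)) \<circ> frechet_derivative f (at u) = (\<lambda>v. \<Sum>e\<in>Basis.
        (frechet_derivative f (at u) v \<bullet> e) *\<^sub>R frechet_derivative h (at (f u)) e)"
      unfolding o_def by (rule ext) (rule linear_basis_expand[OF has_derivative_linear[OF D(4)[OF fu]]])
    ultimately show ?thesis by (simp only: o_def)
  qed
  have "times_differentiable_on k U
      (\<lambda>u. \<Sum>e\<in>Basis. (frechet_derivative f (at u) v \<bullet> e) *\<^sub>R frechet_derivative h (at (f u)) e)" for v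
    by (rule times_differentiable_on_sum[OF assms(1)], rule times_differentiable_on_scaleR[OF assms(1)],
        rule times_differentiable_on_linear[OF assms(1) bounded_linear_inner_left], rule D(2),
        rule Suc.IH[OF D(3) D(5)])
  then show ?case
    using der by (intro times_differentiable_on_SucI[OF assms(1), where f' = "\<lambda>u v.
          \<Sum>e\<in>Basis. (frechet_derivative f (at u) v \<bullet> e) *\<^sub>R frechet_derivative h (at (f u)) e"])
qed

lemma smooth_on_cong:
  "open U \<Longrightarrow> (\<And>u. u \<in> U \<Longrightarrow> f u = g u) \<Longrightarrow> smooth_on U f \<Longrightarrow> smooth_on U g"
  unfolding smooth_on_def using times_differentiable_on_cong by blast

lemma smooth_on_const [intro]: "smooth_on U (\<lambda>u. c)"
  by (simp add: smooth_on_def times_differentiable_on_const)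

lemma smooth_on_add [intro]:
  "open U \<Longrightarrow> smooth_on U f \<Longrightarrow> smooth_on U g \<Longrightarrow> smooth_on U (\<lambda>u. f u + g u)"
  by (simp add: smooth_on_def times_differentiable_on_add)

lemma smooth_on_scaleR [intro]:
  "open U \<Longrightarrow> smooth_on U f \<Longrightarrow> smooth_on U g \<Longrightarrow> smooth_on U (\<lambda>u. f u *\<^sub>R g u)"
  by (simp add: smooth_on_def times_differentiable_on_scaleR)

lemma smooth_on_mult [intro]:
  fixes f :: "_ \<Rightarrow> real"
  shows "open U \<Longrightarrow> smooth_on U f \<Longrightarrow> smooth_on U g \<Longrightarrow> smooth_on U (\<lambda>u. f u * g u)"
  using smooth_on_scaleR[of U f g] by simp

lemma smooth_on_uminus [intro]: "open U \<Longrightarrow> smooth_on U f \<Longrightarrow> smooth_on U (\<lambda>u. - f u)"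
  using smooth_on_scaleR[of U "\<lambda>_. -1" f] by (simp add: smooth_on_const)

lemma smooth_on_diff [intro]:
  "open U \<Longrightarrow> smooth_on U f \<Longrightarrow> smooth_on U g \<Longrightarrow> smooth_on U (\<lambda>u. f u - g u)"
  using smooth_on_add[of U f "\<lambda>u. - g u"] by (simp add: smooth_on_uminus)

lemma smooth_on_sum [intro]:
  "open U \<Longrightarrow> (\<And>i. i \<in> I \<Longrightarrow> smooth_on U (f i)) \<Longrightarrow> smooth_on U (\<lambda>u. \<Sum>i\<in>I. f i u)"
  by (simp add: smooth_on_def times_differentiable_on_sum)

lemma smooth_on_power [intro]:
  fixes f :: "_ \<Rightarrow> real"
  shows "open U \<Longrightarrow> smooth_on U f \<Longrightarrow> smooth_on U (\<lambda>u. f u ^ n)"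
  by (induction n) (auto intro: smooth_on_const)

lemma smooth_on_linear:
  "open U \<Longrightarrow> bounded_linear L \<Longrightarrow> smooth_on U f \<Longrightarrow> smooth_on U (\<lambda>u. L (f u))"
  by (simp add: smooth_on_def times_differentiable_on_linear)

lemma smooth_on_inner [intro]:
  "open U \<Longrightarrow> smooth_on U f \<Longrightarrow> smooth_on U (\<lambda>u. f u \<bullet> e)"
  by (rule smooth_on_linear[OF _ bounded_linear_inner_left])


lemma smooth_on_compose:
  fixes f :: "'b::real_normed_vector \<Rightarrow> 'c::euclidean_space"
  shows "open U \<Longrightarrow> open V \<Longrightarrow> f ` U \<subseteq> V \<Longrightarrow> smooth_on U f \<Longrightarrow> smooth_on V h \<Longrightarrow>
    smooth_on U (\<lambda>u. h (f u))"
  by (simp add: smooth_on_def times_differentiable_on_compose)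

lemma smooth_on_ident [intro]: "open U \<Longrightarrow> smooth_on U (\<lambda>u. u)"
  unfolding smooth_on_def
proof
  fix k assume "open U"
  then show "times_differentiable_on k U (\<lambda>u. u)"
    by (cases k) (auto intro: times_differentiable_on_const)
qed

lemma smooth_on_subset: "smooth_on U f \<Longrightarrow> V \<subseteq> U \<Longrightarrow> smooth_on V f"
proof -
  have "times_differentiable_on k U f \<Longrightarrow> V \<subseteq> U \<Longrightarrow> times_differentiable_on k V f" for k
    by (induction k arbitrary: f) (auto intro: continuous_on_subset)
  then show "smooth_on U f \<Longrightarrow> V \<subseteq> U \<Longrightarrow> smooth_on V f" unfolding smooth_on_def by blast
qed

lemma smooth_on_has_derivative:
  "smooth_on U f \<Longrightarrow> u \<in> U \<Longrightarrow> (f has_derivative frechet_derivative f (at u)) (at u)"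
  unfolding smooth_on_def using times_differentiable_on_SucD(1) by blast

lemma smooth_on_imp_differentiable:
  "smooth_on U f \<Longrightarrow> u \<in> U \<Longrightarrow> f differentiable (at u)"
  using smooth_on_has_derivative differentiableI by blast

lemma smooth_on_derivative [intro]:
  "smooth_on U f \<Longrightarrow> smooth_on U (\<lambda>u. frechet_derivative f (at u) v)"
  unfolding smooth_on_def using times_differentiable_on_SucD(2) by blast

lemma smooth_on_imp_continuous_on: "smooth_on U f \<Longrightarrow> continuous_on U f"
  unfolding smooth_on_def by (metis times_differentiable_on.simps(1))

text \<open>Both mixed second derivatives are limits of the same second difference quotient, by two
  applications of the mean value theorem in either order.\<close>

lemma second_difference_mean_value:
  fixes f :: "'b::real_normed_vector \<Rightarrow> real"
  assumes U: "open U" and f: "smooth_on U f" and s: "s > 0"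
    and seg: "\<And>a b. 0 \<le> a \<Longrightarrow> a \<le> s \<Longrightarrow> 0 \<le> b \<Longrightarrow> b \<le> s \<Longrightarrow> u + a *\<^sub>R x + b *\<^sub>R y \<in> U"
  shows "\<exists>a b. 0 < a \<and> a < s \<and> 0 < b \<and> b < s \<and>
    f (u + s *\<^sub>R x + s *\<^sub>R y) - f (u + s *\<^sub>R x) - f (u + s *\<^sub>R y) + f u =
    s * s * frechet_derivative (\<lambda>w. frechet_derivative f (at w) x) (at (u + a *\<^sub>R x + b *\<^sub>R y)) y"
proof -
  let ?Dx = "\<lambda>w. frechet_derivative f (at w) x"
  have line: "((\<lambda>t. h (w + t *\<^sub>R v)) has_real_derivative frechet_derivative h (at (w + t *\<^sub>R v)) v) (at t)"
    if h: "smooth_on U h" "w + t *\<^sub>R v \<in> U" for h :: "'b \<Rightarrow> real" and w v t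
  proof -
    have "(h \<circ> (\<lambda>t. w + t *\<^sub>R v) has_derivative
        frechet_derivative h (at (w + t *\<^sub>R v)) \<circ> (\<lambda>t. t *\<^sub>R v)) (at t)"
      by (rule diff_chain_at) (auto intro!: derivative_eq_intros smooth_on_has_derivative[OF h])
    moreover have "frechet_derivative h (at (w + t *\<^sub>R v)) (r *\<^sub>R v) =
        frechet_derivative h (at (w + t *\<^sub>R v)) v * r" for r
      using linear_frechet_derivative[OF smooth_on_imp_differentiable[OF h]]
      by (simp add: linear_scale)
    ultimately show ?thesis by (simp add: o_def has_field_derivative_def)
  qed
  have "\<exists>a>0. a < s \<and>
      (f (u + s *\<^sub>R y + s *\<^sub>R x) - f (u + s *\<^sub>R x)) - (f (u + s *\<^sub>R y + 0 *\<^sub>R x) - f (u + 0 *\<^sub>R x)) =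
      (s - 0) * (?Dx (u + s *\<^sub>R y + a *\<^sub>R x) - ?Dx (u + a *\<^sub>R x))"
  proof (rule MVT2[where f = "\<lambda>t. f (u + s *\<^sub>R y + t *\<^sub>R x) - f (u + t *\<^sub>R x)"])
    show "0 < s" by (rule s)
    show "((\<lambda>t. f (u + s *\<^sub>R y + t *\<^sub>R x) - f (u + t *\<^sub>R x)) has_real_derivative
        ?Dx (u + s *\<^sub>R y + t *\<^sub>R x) - ?Dx (u + t *\<^sub>R x)) (at t)" if "0 \<le> t" "t \<le> s" for t
      using seg[of t s] seg[of t 0] that s by (intro DERIV_diff line f) (auto simp: algebra_simps)
  qed
  then obtain a where a: "0 < a" "a < s"
    "f (u + s *\<^sub>R y + s *\<^sub>R x) - f (u + s *\<^sub>R x) - (f (u + s *\<^sub>R y) - f u) =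
      s * (?Dx (u + s *\<^sub>R y + a *\<^sub>R x) - ?Dx (u + a *\<^sub>R x))" by auto
  have "\<exists>b>0. b < s \<and>
      ?Dx (u + a *\<^sub>R x + s *\<^sub>R y) - ?Dx (u + a *\<^sub>R x + 0 *\<^sub>R y) =
      (s - 0) * frechet_derivative ?Dx (at (u + a *\<^sub>R x + b *\<^sub>R y)) y"
    using seg[of a] a by (intro MVT2 s line smooth_on_derivative f) auto
  then obtain b where b: "0 < b" "b < s"
    "?Dx (u + a *\<^sub>R x + s *\<^sub>R y) - ?Dx (u + a *\<^sub>R x) =
      s * frechet_derivative ?Dx (at (u + a *\<^sub>R x + b *\<^sub>R y)) y" by auto
  have "f (u + s *\<^sub>R x + s *\<^sub>R y) - f (u + s *\<^sub>R x) - f (u + s *\<^sub>R y) + f u =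
      s * s * frechet_derivative ?Dx (at (u + a *\<^sub>R x + b *\<^sub>R y)) y"
    using a(3) b(3) by (simp add: algebra_simps)
  then show ?thesis using a b by blast
qed

lemma mixed_derivatives_commute_real:
  fixes f :: "'b::real_normed_vector \<Rightarrow> real"
  assumes U: "open U" and f: "smooth_on U f" and u: "u \<in> U"
  shows "frechet_derivative (\<lambda>w. frechet_derivative f (at w) x) (at u) y =
    frechet_derivative (\<lambda>w. frechet_derivative f (at w) y) (at u) x"
proof (rule ccontr)
  let ?h = "\<lambda>x y w. frechet_derivative (\<lambda>w. frechet_derivative f (at w) x) (at w) y"
  assume ne: "\<not> ?thesis"
  define d where "d = \<bar>?h x y u - ?h y x u\<bar> / 2"
  have d: "d > 0" using ne by (simp add: d_def)
  have close: "\<forall>\<^sub>F w in nhds u. dist (?h x y w) (?h x y u) < d" for x y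
  proof -
    have "isCont (?h x y) u"
      using smooth_on_imp_continuous_on[OF smooth_on_derivative[OF smooth_on_derivative[OF f]]] U u
      by (simp add: continuous_on_eq_continuous_at)
    then have "(?h x y \<longlongrightarrow> ?h x y u) (nhds u)"
      unfolding isCont_def by (rule iffD1[OF tendsto_at_iff_tendsto_nhds])
    then show ?thesis using d by (rule tendstoD)
  qed
  have "\<forall>\<^sub>F w in nhds u. w \<in> U" using U u by (rule eventually_nhds_in_open)
  with close[of x y] close[of y x]
  have "\<forall>\<^sub>F w in nhds u. w \<in> U \<and> dist (?h x y w) (?h x y u) < d \<and> dist (?h y x w) (?h y x u) < d"
    by eventually_elim simp
  then obtain r where r: "r > 0" "\<And>w. dist w u < r \<Longrightarrow>
      w \<in> U \<and> dist (?h x y w) (?h x y u) < d \<and> dist (?h y x w) (?h y x u) < d"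
    unfolding eventually_nhds_metric by blast
  \<comment> \<open>\<open>s\<close> is small enough for the whole parallelogram to lie in the ball of radius \<open>r\<close>\<close>
  define s where "s = r / (norm x + norm y + 1)"
  have pos: "norm x + norm y + 1 > 0" using norm_ge_zero[of x] norm_ge_zero[of y] by linarith
  have s: "s > 0" using pos r by (simp add: s_def)
  have near: "dist (u + a *\<^sub>R x + b *\<^sub>R y) u < r" if "0 \<le> a" "a \<le> s" "0 \<le> b" "b \<le> s" for a b
  proof -
    have "norm (a *\<^sub>R x + b *\<^sub>R y) \<le> a * norm x + b * norm y"
      using norm_triangle_ineq[of "a *\<^sub>R x" "b *\<^sub>R y"] that by simp
    also have "\<dots> \<le> s * norm x + s * norm y"
      using that by (intro add_mono mult_right_mono) auto
    also have "\<dots> < s * (norm x + norm y + 1)" using s by (simp add: algebra_simps)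
    also have "\<dots> = r" using pos by (simp add: s_def)
    finally show ?thesis by (simp add: dist_norm add.assoc)
  qed
  have seg: "u + a *\<^sub>R x + b *\<^sub>R y \<in> U" if "0 \<le> a" "a \<le> s" "0 \<le> b" "b \<le> s" for a b
    using r(2)[OF near[OF that]] by simp
  have seg': "u + a *\<^sub>R y + b *\<^sub>R x \<in> U" if "0 \<le> a" "a \<le> s" "0 \<le> b" "b \<le> s" for a b
    using seg[OF that(3,4,1,2)] by (simp add: ac_simps)
  obtain a b where ab: "0 < a" "a < s" "0 < b" "b < s"
    "f (u + s *\<^sub>R x + s *\<^sub>R y) - f (u + s *\<^sub>R x) - f (u + s *\<^sub>R y) + f u =
     s * s * ?h x y (u + a *\<^sub>R x + b *\<^sub>R y)"
    using second_difference_mean_value[OF U f s seg] by auto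
  obtain a' b' where ab': "0 < a'" "a' < s" "0 < b'" "b' < s"
    "f (u + s *\<^sub>R y + s *\<^sub>R x) - f (u + s *\<^sub>R y) - f (u + s *\<^sub>R x) + f u =
     s * s * ?h y x (u + a' *\<^sub>R y + b' *\<^sub>R x)"
    using second_difference_mean_value[OF U f s seg'] by auto
  have "f (u + s *\<^sub>R x + s *\<^sub>R y) = f (u + s *\<^sub>R y + s *\<^sub>R x)" by (simp add: ac_simps)
  then have "s * s * ?h x y (u + a *\<^sub>R x + b *\<^sub>R y) = s * s * ?h y x (u + a' *\<^sub>R y + b' *\<^sub>R x)"
    using ab(5) ab'(5) by linarith
  then have "?h x y (u + a *\<^sub>R x + b *\<^sub>R y) = ?h y x (u + b' *\<^sub>R x + a' *\<^sub>R y)"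
    using s by (simp add: ac_simps)
  moreover have "dist (?h x y (u + a *\<^sub>R x + b *\<^sub>R y)) (?h x y u) < d"
    "dist (?h y x (u + b' *\<^sub>R x + a' *\<^sub>R y)) (?h y x u) < d"
    using r(2)[OF near[of a b]] r(2)[OF near[of b' a']] ab ab' by auto
  moreover have "\<not> (h = h' \<and> dist h c < \<bar>c - c'\<bar> / 2 \<and> dist h' c' < \<bar>c - c'\<bar> / 2)" for h h' c c' :: real
    by (auto simp: dist_real_def abs_if split: if_splits)
  ultimately show False unfolding d_def by blast
qed

lemma frechet_derivative_inner:
  fixes f :: "'b::real_normed_vector \<Rightarrow> 'c::euclidean_space"
  assumes "f differentiable (at u)"
  shows "frechet_derivative (\<lambda>w. f w \<bullet> e) (at u) v = frechet_derivative f (at u) v \<bullet> e"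
proof -
  have "((\<lambda>w. f w \<bullet> e) has_derivative (\<lambda>v. frechet_derivative f (at u) v \<bullet> e)) (at u)"
    using assms by (intro has_derivative_inner_left) (simp add: frechet_derivative_works[symmetric])
  then show ?thesis using frechet_derivative_at by metis
qed

lemma mixed_derivatives_commute:
  fixes f :: "'b::real_normed_vector \<Rightarrow> 'c::euclidean_space"
  assumes U: "open U" and f: "smooth_on U f" and u: "u \<in> U"
  shows "frechet_derivative (\<lambda>w. frechet_derivative f (at w) x) (at u) y =
    frechet_derivative (\<lambda>w. frechet_derivative f (at w) y) (at u) x"
proof (rule euclidean_eqI)
  fix e :: 'c assume "e \<in> Basis"
  have *: "frechet_derivative (\<lambda>w. frechet_derivative (\<lambda>w. f w \<bullet> e) (at w) x) (at u) y =
      frechet_derivative (\<lambda>w. frechet_derivative f (at w) x) (at u) y \<bullet> e" for x y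
  proof -
    have "frechet_derivative (\<lambda>w. frechet_derivative (\<lambda>w. f w \<bullet> e) (at w) x) (at u) =
        frechet_derivative (\<lambda>w. frechet_derivative f (at w) x \<bullet> e) (at u)"
      by (rule frechet_derivative_cong_open[OF U u])
        (rule frechet_derivative_inner[OF smooth_on_imp_differentiable[OF f]])
    then show ?thesis
      using frechet_derivative_inner[OF smooth_on_imp_differentiable[OF smooth_on_derivative[OF f] u]]
      by simp
  qed
  show "frechet_derivative (\<lambda>w. frechet_derivative f (at w) x) (at u) y \<bullet> e =
      frechet_derivative (\<lambda>w. frechet_derivative f (at w) y) (at u) x \<bullet> e"
    using mixed_derivatives_commute_real[OF U smooth_on_inner[OF U f] u, of e x y] * by simp
qed

section \<open>Linear systems with smooth coefficients\<close>

text \<open>A factor that is merely continuous does not matter where the other factor vanishes. This is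
  how continuity of the solution of a linear system implies its differentiability.\<close>

lemma has_derivative_mult_continuous_vanishing:
  fixes a f :: "'b::real_normed_vector \<Rightarrow> real"
  assumes a: "isCont a u" and f: "(f has_derivative f') (at u)" and f0: "f u = 0"
  shows "((\<lambda>w. a w * f w) has_derivative (\<lambda>h. a u * f' h)) (at u)"
proof -
  have bl: "bounded_linear f'" using f has_derivative_bounded_linear by blast
  obtain B where B: "B > 0" "\<And>h. norm (f' h) \<le> norm h * B"
    using bounded_linear.pos_bounded[OF bl] by blast
  have "((\<lambda>w. (a w - a u) * f w) has_derivative (\<lambda>h. 0)) (at u)"
    unfolding has_derivative_at_alt
  proof (intro conjI allI impI)
    fix e :: real assume e: "e > 0"
    define e' where "e' = e / (B + 1)"
    have e': "e' > 0" using e B by (simp add: e'_def)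
    obtain d1 where d1: "d1 > 0" "\<And>w. norm (w - u) < d1 \<Longrightarrow> norm (f w - f u - f' (w - u)) \<le> 1 * norm (w - u)"
      using f unfolding has_derivative_at_alt by (metis zero_less_one)
    obtain d2 where d2: "d2 > 0" "\<And>w. dist w u < d2 \<Longrightarrow> dist (a w) (a u) < e'"
      using a e' unfolding continuous_at_eps_delta by blast
    have "norm ((a w - a u) * f w - (a u - a u) * f u - 0) \<le> e * norm (w - u)"
      if w: "norm (w - u) < min d1 d2" for w
    proof -
      have "norm (f w) \<le> norm (f w - f u - f' (w - u)) + norm (f' (w - u))"
        using f0 norm_triangle_ineq[of "f w - f u - f' (w - u)" "f' (w - u)"] by simp
      also have "\<dots> \<le> (B + 1) * norm (w - u)"
        using d1(2)[of w] B(2)[of "w - u"] w by (simp add: algebra_simps)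
      finally have "norm (a w - a u) * norm (f w) \<le> e' * ((B + 1) * norm (w - u))"
        using d2(2)[of w] w e' by (intro mult_mono) (auto simp: dist_norm)
      then show ?thesis using B by (simp add: e'_def abs_mult)
    qed
    then show "\<exists>d>0. \<forall>w. norm (w - u) < d \<longrightarrow>
        norm ((a w - a u) * f w - (a u - a u) * f u - 0) \<le> e * norm (w - u)"
      using d1(1) d2(1) by (intro exI[of _ "min d1 d2"]) auto
  qed auto
  then have "((\<lambda>w. a u * f w + (a w - a u) * f w) has_derivative (\<lambda>h. a u * f' h + 0)) (at u)"
    using f by (intro has_derivative_add has_derivative_mult_right) auto
  then show ?thesis by (simp add: algebra_simps)
qed

definition bilinear_form :: "('d::real_vector \<Rightarrow> 'd \<Rightarrow> real) \<Rightarrow> bool" where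
  "bilinear_form B \<longleftrightarrow> (\<forall>x. linear (B x)) \<and> (\<forall>y. linear (\<lambda>x. B x y))"

definition nondegenerate :: "('d::zero \<Rightarrow> 'd \<Rightarrow> real) \<Rightarrow> bool" where
  "nondegenerate B \<longleftrightarrow> (\<forall>x. (\<forall>y. B x y = 0) \<longrightarrow> x = 0)"

lemma bilinear_formD:
  assumes "bilinear_form B"
  shows "B (x + y) z = B x z + B y z" "B z (x + y) = B z x + B z y"
    "B (x - y) z = B x z - B y z" "B z (x - y) = B z x - B z y"
    "B (c *\<^sub>R x) z = c * B x z" "B z (c *\<^sub>R x) = c * B z x"
    "B 0 z = 0" "B z 0 = 0" "B (- x) z = - B x z" "B z (- x) = - B z x"
proof -
  have l: "linear (\<lambda>x. B x z)" and r: "linear (B z)" for z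
    using assms by (auto simp: bilinear_form_def)
  show "B (x + y) z = B x z + B y z" "B (x - y) z = B x z - B y z"
    "B (c *\<^sub>R x) z = c * B x z" "B 0 z = 0" "B (- x) z = - B x z"
    using linear_add[OF l] linear_diff[OF l] linear_scale[OF l] linear_0[OF l] linear_neg[OF l] by auto
  show "B z (x + y) = B z x + B z y" "B z (x - y) = B z x - B z y"
    "B z (c *\<^sub>R x) = c * B z x" "B z 0 = 0" "B z (- x) = - B z x"
    using linear_add[OF r] linear_diff[OF r] linear_scale[OF r] linear_0[OF r] linear_neg[OF r] by auto
qed

text \<open>The inner product of the type \<open>'d\<close> is auxiliary: it identifies the form \<open>B\<close> with an
  endomorphism, so that nondegeneracy becomes bijectivity of a linear map.\<close>

definition gram :: "('d::euclidean_space \<Rightarrow> 'd \<Rightarrow> real) \<Rightarrow> 'd \<Rightarrow> 'd" where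
  "gram B x = (\<Sum>e\<in>Basis. B x e *\<^sub>R e)"

lemma gram_inner: "e \<in> Basis \<Longrightarrow> gram B x \<bullet> e = B x e"
  by (simp add: gram_def inner_sum_left_Basis)

lemma inner_gram: "bilinear_form B \<Longrightarrow> gram B x \<bullet> y = B x y"
  using linear_basis_expand[of "B x" y]
  by (simp add: gram_def inner_sum_left inner_sum_right bilinear_form_def inner_commute mult.commute)

lemma linear_gram: "bilinear_form B \<Longrightarrow> linear (gram B)"
  by (rule linearI) (auto simp: gram_def bilinear_formD scaleR_add_left sum.distrib scaleR_sum_right)

lemma inj_gram:
  assumes "bilinear_form B" "nondegenerate B"
  shows "inj (gram B)"
proof -
  have "x = 0" if "gram B x = 0" for x
    using assms that inner_gram[OF assms(1), of x] by (auto simp: nondegenerate_def)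
  then show ?thesis using linear_injective_0[OF linear_gram[OF assms(1)]] by blast
qed

lemma nondegenerate_represent:
  fixes B :: "'d::euclidean_space \<Rightarrow> 'd \<Rightarrow> real"
  assumes "bilinear_form B" "nondegenerate B" "linear l"
  shows "\<exists>x. \<forall>y. B x y = l y"
proof -
  have "surj (gram B)"
    using linear_injective_imp_surjective[OF linear_gram inj_gram] assms by blast
  then obtain x where "gram B x = (\<Sum>e\<in>Basis. l e *\<^sub>R e)" by (metis surjD)
  then have "B x y = (\<Sum>e\<in>Basis. l e *\<^sub>R e) \<bullet> y" for y
    using inner_gram[OF assms(1), of x y] by simp
  then have "B x y = l y" for y
    using linear_basis_expand[OF assms(3), of y]
    by (simp add: inner_sum_left inner_sum_right inner_commute mult.commute)
  then show ?thesis by blast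
qed

lemma nondegenerate_eqI:
  assumes "bilinear_form B" "nondegenerate B" "\<And>z. B x z = B y z"
  shows "x = y"
  using assms bilinear_formD(3)[OF assms(1), of x y] unfolding nondegenerate_def
  by (metis right_minus_eq)

text \<open>The solution \<open>v\<close> of \<open>A(v, z) = w(z)\<close> is as smooth as the right-hand side: it is continuous
  because \<open>A\<close> is bounded below, hence differentiable, and its derivatives solve systems with the
  same matrix. The Christoffel symbols are obtained in this way.\<close>

locale smooth_nondegenerate_family =
  fixes U :: "'b::real_normed_vector set" and A :: "'b \<Rightarrow> 'd::euclidean_space \<Rightarrow> 'd \<Rightarrow> real"
  assumes open_U: "open U"
    and bil: "\<And>u. u \<in> U \<Longrightarrow> bilinear_form (A u)"
    and nondeg: "\<And>u. u \<in> U \<Longrightarrow> nondegenerate (A u)"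
    and smooth: "\<And>x y. smooth_on U (\<lambda>u. A u x y)"
begin

lemma expand_left: "u \<in> U \<Longrightarrow> A u x z = (\<Sum>i\<in>Basis. (x \<bullet> i) * A u i z)"
  using linear_basis_expand[of "\<lambda>x. A u x z" x] bil[of u] by (simp add: bilinear_form_def)

lemma solution_difference:
  assumes v: "\<And>u z. u \<in> U \<Longrightarrow> A u (v u) z = w u z" and u: "u \<in> U" "u0 \<in> U"
  shows "A u0 (v u - v u0) e = (w u e - w u0 e) - (\<Sum>i\<in>Basis. (v u \<bullet> i) * (A u i e - A u0 i e))"
proof -
  have "A u0 (v u - v u0) e = A u (v u) e - A u0 (v u0) e - (A u (v u) e - A u0 (v u) e)"
    using bilinear_formD[OF bil[OF u(2)]] by simp
  then show ?thesis
    using v[OF u(1)] v[OF u(2)] expand_left[OF u(1), of "v u" e] expand_left[OF u(2), of "v u" e]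
    by (simp add: right_diff_distrib sum_subtractf)
qed

lemma solution_continuous:
  assumes w: "\<And>z. continuous_on U (\<lambda>u. w u z)"
    and v: "\<And>u z. u \<in> U \<Longrightarrow> A u (v u) z = w u z"
    and u0: "u0 \<in> U"
  shows "isCont v u0"
proof -
  have near: "\<forall>\<^sub>F u in at u0. u \<in> U" using open_U u0 by (rule eventually_at_in_open')
  obtain c where c: "c > 0" "\<And>x. c * norm x \<le> norm (gram (A u0) x)"
    using linear_inj_bounded_below_pos[OF linear_gram inj_gram] bil[OF u0] nondeg[OF u0] by metis
  define \<delta> where "\<delta> u = (\<Sum>e\<in>Basis. \<bar>w u e - w u0 e\<bar>)" for u
  define \<eta> where "\<eta> u = (\<Sum>e\<in>Basis. \<Sum>i\<in>Basis. \<bar>A u i e - A u0 i e\<bar>)" for u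
  have cont: "((\<lambda>u. h u) \<longlongrightarrow> h u0) (at u0)" if "continuous_on U h" for h :: "'b \<Rightarrow> real"
    using that open_U u0 by (simp add: continuous_on_eq_continuous_at isCont_def)
  have \<delta>: "(\<delta> \<longlongrightarrow> 0) (at u0)"
    unfolding \<delta>_def by (auto intro!: tendsto_eq_intros cont w)
  have \<eta>: "(\<eta> \<longlongrightarrow> 0) (at u0)"
    unfolding \<eta>_def by (auto intro!: tendsto_eq_intros cont smooth_on_imp_continuous_on[OF smooth])
  have "c * norm (v u - v u0) \<le> \<delta> u + \<eta> u * (norm (v u - v u0) + norm (v u0))" if u: "u \<in> U" for u
  proof -
    have "\<bar>A u0 (v u - v u0) e\<bar> \<le> \<bar>w u e - w u0 e\<bar> + norm (v u) * (\<Sum>i\<in>Basis. \<bar>A u i e - A u0 i e\<bar>)" for e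
    proof -
      have "\<bar>\<Sum>i\<in>Basis. (v u \<bullet> i) * (A u i e - A u0 i e)\<bar> \<le> (\<Sum>i\<in>Basis. \<bar>v u \<bullet> i\<bar> * \<bar>A u i e - A u0 i e\<bar>)"
        by (rule order_trans[OF sum_abs]) (simp add: abs_mult)
      also have "\<dots> \<le> (\<Sum>i\<in>Basis. norm (v u) * \<bar>A u i e - A u0 i e\<bar>)"
        by (intro sum_mono mult_right_mono) (auto simp: Basis_le_norm)
      also have "\<dots> = norm (v u) * (\<Sum>i\<in>Basis. \<bar>A u i e - A u0 i e\<bar>)" by (simp add: sum_distrib_left)
      finally show ?thesis
        using solution_difference[OF v u u0, of e] by linarith
    qed
    then have "(\<Sum>e\<in>Basis. \<bar>A u0 (v u - v u0) e\<bar>) \<le> \<delta> u + norm (v u) * \<eta> u"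
      unfolding \<delta>_def \<eta>_def sum_distrib_left sum.distrib[symmetric] by (intro sum_mono) simp
    moreover have "norm (gram (A u0) (v u - v u0)) \<le> (\<Sum>e\<in>Basis. \<bar>A u0 (v u - v u0) e\<bar>)"
      using norm_le_l1[of "gram (A u0) (v u - v u0)"] by (simp add: gram_inner)
    moreover have "norm (v u) * \<eta> u \<le> (norm (v u - v u0) + norm (v u0)) * \<eta> u"
      using norm_triangle_sub[of "v u" "v u0"]
      by (intro mult_right_mono) (auto simp: \<eta>_def sum_nonneg add.commute)
    ultimately show ?thesis using c(2)[of "v u - v u0"] by (simp add: mult.commute)
  qed
  note bound = this
  have "\<forall>\<^sub>F u in at u0. \<eta> u < c / 2" using \<eta> c(1) by (intro order_tendstoD) auto
  with near have "\<forall>\<^sub>F u in at u0. norm (v u - v u0) \<le> (2 / c) * (\<delta> u + \<eta> u * norm (v u0))"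
  proof eventually_elim
    case (elim u)
    have "\<eta> u * norm (v u - v u0) \<le> c / 2 * norm (v u - v u0)"
      using elim(2) by (intro mult_right_mono) auto
    then have "c / 2 * norm (v u - v u0) \<le> \<delta> u + \<eta> u * norm (v u0)"
      using bound[OF elim(1)] by (simp add: algebra_simps)
    then have "norm (v u - v u0) * c \<le> 2 * (\<delta> u + \<eta> u * norm (v u0))" by (simp add: mult.commute)
    then show ?case using pos_le_divide_eq[OF c(1)] c(1) by simp
  qed
  moreover have "((\<lambda>u. (2 / c) * (\<delta> u + \<eta> u * norm (v u0))) \<longlongrightarrow> 0) (at u0)"
    using c(1) by (auto intro!: tendsto_eq_intros \<delta> \<eta>)
  ultimately have "((\<lambda>u. v u - v u0) \<longlongrightarrow> 0) (at u0)"
    by (rule Lim_null_comparison)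
  then show ?thesis by (simp add: isCont_def LIM_zero_iff)
qed

lemma solution_differentiable:
  assumes w: "\<And>z. times_differentiable_on 1 U (\<lambda>u. w u z)"
    and v: "\<And>u z. u \<in> U \<Longrightarrow> A u (v u) z = w u z"
    and u0: "u0 \<in> U"
  shows "v differentiable (at u0)"
proof -
  note w' = times_differentiable_on_SucD[OF w[unfolded One_nat_def]]
  have "isCont v u0"
    by (rule solution_continuous[OF _ v u0]) (use w'(3) in auto)
  then have cont: "isCont (\<lambda>u. v u \<bullet> i) u0" for i by (intro continuous_intros)
  define rhs where "rhs u e = (w u e - w u0 e) - (\<Sum>i\<in>Basis. (v u \<bullet> i) * (A u i e - A u0 i e))" for u e
  have rhs: "(\<lambda>u. rhs u e) differentiable (at u0)" for e
    unfolding rhs_def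
  proof (intro differentiable_diff differentiable_sum ballI)
    fix i
    have "((\<lambda>u. A u i e - A u0 i e) has_derivative
        (\<lambda>h. frechet_derivative (\<lambda>u. A u i e) (at u0) h - 0)) (at u0)"
      by (intro has_derivative_diff has_derivative_const smooth_on_has_derivative[OF smooth u0])
    then show "(\<lambda>u. (v u \<bullet> i) * (A u i e - A u0 i e)) differentiable (at u0)"
      using has_derivative_mult_continuous_vanishing[OF cont[of i]] differentiable_def by fastforce
  qed (use w'(1)[OF u0] in \<open>auto simp: differentiable_def\<close>)
  have gram: "gram (A u0) (v u - v u0) = (\<Sum>e\<in>Basis. rhs u e *\<^sub>R e)" if u: "u \<in> U" for u
    using solution_difference[OF v u u0] by (simp add: gram_def rhs_def)
  obtain L where L: "linear L" "L \<circ> gram (A u0) = id"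
    using linear_injective_left_inverse[OF linear_gram inj_gram] bil[OF u0] nondeg[OF u0] by metis
  have eq: "v u0 + L (\<Sum>e\<in>Basis. rhs u e *\<^sub>R e) = v u" if u: "u \<in> U" for u
    using gram[OF u, symmetric] L(2) by (simp add: o_def fun_eq_iff)
  have "(\<lambda>u. v u0 + L (\<Sum>e\<in>Basis. rhs u e *\<^sub>R e)) differentiable (at u0)"
  proof -
    have "(\<lambda>u. \<Sum>e\<in>Basis. rhs u e *\<^sub>R e) differentiable (at u0)"
      using rhs by (auto intro!: differentiable_sum differentiable_scaleR)
    then obtain D where "((\<lambda>u. \<Sum>e\<in>Basis. rhs u e *\<^sub>R e) has_derivative D) (at u0)"
      by (auto simp: differentiable_def)
    then have "((\<lambda>u. L (\<Sum>e\<in>Basis. rhs u e *\<^sub>R e)) has_derivative (\<lambda>h. L (D h))) (at u0)"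
      using bounded_linear.has_derivative L(1) linear_conv_bounded_linear by blast
    then show ?thesis by (intro differentiable_add) (auto simp: differentiable_def)
  qed
  with eq show ?thesis by (rule differentiable_cong_open[OF open_U u0])
qed

lemma solution_times_differentiable:
  assumes w: "\<And>z. times_differentiable_on k U (\<lambda>u. w u z)"
    and v: "\<And>u z. u \<in> U \<Longrightarrow> A u (v u) z = w u z"
  shows "times_differentiable_on k U v"
  using assms
proof (induction k arbitrary: v w)
  case 0
  then show ?case
    using solution_continuous[of w v] by (auto intro!: continuous_at_imp_continuous_on)
next
  case (Suc k)
  have w1: "times_differentiable_on 1 U (\<lambda>u. w u z)" for z
    by (rule times_differentiable_on_mono[OF _ Suc.prems(1)]) simp
  have vk: "times_differentiable_on k U v"
    by (rule Suc.IH[OF times_differentiable_on_Suc_imp[OF Suc.prems(1)] Suc.prems(2)])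
  have dv: "v differentiable (at u)" if "u \<in> U" for u
    by (rule solution_differentiable[OF w1 Suc.prems(2) that])
  \<comment> \<open>differentiating \<open>A(v, z) = w(z)\<close> in the direction \<open>x\<close> gives \<open>A(Dv, z) = w'(z)\<close>\<close>
  define w' where "w' x u z = frechet_derivative (\<lambda>u. w u z) (at u) x -
    (\<Sum>i\<in>Basis. (v u \<bullet> i) * frechet_derivative (\<lambda>u. A u i z) (at u) x)" for x u z
  have w'k: "times_differentiable_on k U (\<lambda>u. w' x u z)" for x z
  proof -
    have "times_differentiable_on k U (\<lambda>u. frechet_derivative (\<lambda>u. w u z) (at u) x +
      (-1) *\<^sub>R (\<Sum>i\<in>Basis. (v u \<bullet> i) *\<^sub>R frechet_derivative (\<lambda>u. A u i z) (at u) x))"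
      by (intro times_differentiable_on_add[OF open_U] times_differentiable_on_scaleR[OF open_U]
          times_differentiable_on_sum[OF open_U] times_differentiable_on_const
          times_differentiable_on_linear[OF open_U bounded_linear_inner_left vk]
          times_differentiable_on_SucD(2)[OF Suc.prems(1)])
        (use smooth_on_derivative[OF smooth] in \<open>auto simp: smooth_on_def\<close>)
    then show ?thesis by (simp add: w'_def)
  qed
  have "A u (frechet_derivative v (at u) x) z = w' x u z" if u: "u \<in> U" for u x z
  proof -
    have "((\<lambda>u. \<Sum>i\<in>Basis. (v u \<bullet> i) * A u i z) has_derivative
        (\<lambda>h. \<Sum>i\<in>Basis. (v u \<bullet> i) * frechet_derivative (\<lambda>u. A u i z) (at u) h +
          (frechet_derivative v (at u) h \<bullet> i) * A u i z)) (at u)"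
      using dv[OF u] smooth_on_has_derivative[OF smooth u]
      by (intro has_derivative_sum has_derivative_mult has_derivative_inner_left)
        (auto simp: frechet_derivative_works)
    moreover have "(\<Sum>i\<in>Basis. (v u' \<bullet> i) * A u' i z) = w u' z" if "u' \<in> U" for u'
      using expand_left[OF that, of "v u'" z] Suc.prems(2)[OF that, of z] by linarith
    ultimately have "((\<lambda>u. w u z) has_derivative
        (\<lambda>h. \<Sum>i\<in>Basis. (v u \<bullet> i) * frechet_derivative (\<lambda>u. A u i z) (at u) h +
          (frechet_derivative v (at u) h \<bullet> i) * A u i z)) (at u)"
      by (rule has_derivative_transform_within_open[OF _ open_U u])
    then have "frechet_derivative (\<lambda>u. w u z) (at u) x =
        (\<Sum>i\<in>Basis. (v u \<bullet> i) * frechet_derivative (\<lambda>u. A u i z) (at u) x +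
          (frechet_derivative v (at u) x \<bullet> i) * A u i z)"
      by (rule fun_cong[OF frechet_derivative_at[symmetric]])
    then show ?thesis
      by (simp add: w'_def sum.distrib expand_left[OF u, of "frechet_derivative v (at u) x" z])
  qed
  then have "times_differentiable_on k U (\<lambda>u. frechet_derivative v (at u) x)" for x
    by (rule Suc.IH[OF w'k])
  then show ?case using dv by simp
qed

lemma solution_smooth:
  assumes "\<And>z. smooth_on U (\<lambda>u. w u z)" "\<And>u z. u \<in> U \<Longrightarrow> A u (v u) z = w u z"
  shows "smooth_on U v"
  using assms solution_times_differentiable unfolding smooth_on_def by blast

end

section \<open>Covariant differentiation in coordinates\<close>

lemma multilinear_linear:
  "multilinear k \<gamma> \<Longrightarrow> length xs = k \<Longrightarrow> i < k \<Longrightarrow> linear (\<lambda>x. \<gamma> (xs[i := x]))"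
  by (simp add: multilinear_def)

lemma multilinear_length: "multilinear k \<gamma> \<Longrightarrow> length xs \<noteq> k \<Longrightarrow> \<gamma> xs = 0"
  by (simp add: multilinear_def)

lemma multilinear_expand:
  fixes \<gamma> :: "'e::euclidean_space tensor"
  assumes "multilinear k \<gamma>" "length xs = k" "i < k"
  shows "\<gamma> (xs[i := x]) = (\<Sum>e\<in>Basis. (x \<bullet> e) * \<gamma> (xs[i := e]))"
  using linear_basis_expand[OF multilinear_linear[OF assms], of x] by simp

lemma multilinear_expand_nth:
  fixes \<gamma> :: "'e::euclidean_space tensor"
  assumes "multilinear k \<gamma>" "length xs = k" "i < k"
  shows "\<gamma> xs = (\<Sum>e\<in>Basis. (xs ! i \<bullet> e) * \<gamma> (xs[i := e]))"
  using multilinear_expand[OF assms, of "xs ! i"] by simp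

lemma multilinear_update_zero:
  "multilinear k \<gamma> \<Longrightarrow> length xs = k \<Longrightarrow> i < k \<Longrightarrow> \<gamma> (xs[i := 0]) = 0"
  using linear_0[OF multilinear_linear] by fastforce

text \<open>The product rule is proved by letting one more slot vary at a time and expanding that slot
  in an orthonormal basis.\<close>

lemma multilinear_has_derivative:
  fixes T :: "'b::real_normed_vector \<Rightarrow> 'e::euclidean_space tensor" and X :: "'b \<Rightarrow> 'e list"
  assumes U: "open U" "u \<in> U" and mult: "\<And>w. w \<in> U \<Longrightarrow> multilinear k (T w)"
    and T': "\<And>xs. length xs = k \<Longrightarrow> ((\<lambda>w. T w xs) has_derivative (\<lambda>h. T' h xs)) (at u)"
    and len: "\<And>w. length (X w) = k"
    and X': "\<And>i. i < k \<Longrightarrow> ((\<lambda>w. X w ! i) has_derivative X' i) (at u)"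
  shows "((\<lambda>w. T w (X w)) has_derivative
    (\<lambda>h. T' h (X u) + (\<Sum>i<k. T u ((X u)[i := X' i h])))) (at u)"
proof -
  have T'_expand: "T' h xs = (\<Sum>e\<in>Basis. (xs ! n \<bullet> e) * T' h (xs[n := e]))"
    if "length xs = k" "n < k" for xs n h
  proof -
    have "((\<lambda>w. \<Sum>e\<in>Basis. (xs ! n \<bullet> e) * T w (xs[n := e])) has_derivative
        (\<lambda>h. \<Sum>e\<in>Basis. (xs ! n \<bullet> e) * T' h (xs[n := e]))) (at u)"
      using that by (intro has_derivative_sum has_derivative_mult_right T') auto
    moreover have "(\<Sum>e\<in>Basis. (xs ! n \<bullet> e) * T w (xs[n := e])) = T w xs" if "w \<in> U" for w
      using multilinear_expand_nth[OF mult[OF that] \<open>length xs = k\<close> \<open>n < k\<close>] by simp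
    ultimately have "((\<lambda>w. T w xs) has_derivative
        (\<lambda>h. \<Sum>e\<in>Basis. (xs ! n \<bullet> e) * T' h (xs[n := e]))) (at u)"
      by (rule has_derivative_transform_within_open[OF _ U])
    from has_derivative_unique[OF T'[OF that(1)] this] show ?thesis by (rule fun_cong)
  qed
  have "((\<lambda>w. T w (X w)) has_derivative
      (\<lambda>h. T' h (X u) + (\<Sum>i<n. T u ((X u)[i := X' i h])))) (at u)"
    if "n \<le> k" "\<And>w. length (X w) = k" "\<And>i. i < k \<Longrightarrow> ((\<lambda>w. X w ! i) has_derivative X' i) (at u)"
      "\<And>i w. n \<le> i \<Longrightarrow> i < k \<Longrightarrow> X w ! i = X u ! i" for n and X :: "'b \<Rightarrow> 'e list" and X'
    using that
  proof (induction n arbitrary: X X')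
    case 0
    have "X w = X u" for w
      by (rule nth_equalityI) (simp add: 0(2), metis 0(2) 0(4) le0)
    then have "(\<lambda>w. T w (X w)) = (\<lambda>w. T w (X u))" by metis
    then show ?case using T'[OF 0(2)[of u]] by simp
  next
    case (Suc n)
    have n: "n < k" using Suc.prems(1) by simp
    define Y where "Y e w = (X w)[n := e]" for e w
    have Y: "length (Y e w) = k" for e w by (simp add: Y_def Suc.prems(2))
    have "((\<lambda>w. T w (Y e w)) has_derivative (\<lambda>h. T' h (Y e u) +
        (\<Sum>i<n. T u ((Y e u)[i := (if i = n then \<lambda>h. 0 else X' i) h])))) (at u)" for e
    proof (rule Suc.IH[OF _ Y])
      show "n \<le> k" using n by simp
      show "((\<lambda>w. Y e w ! i) has_derivative (if i = n then \<lambda>h. 0 else X' i)) (at u)" if "i < k" for i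
        using Suc.prems(3)[OF that] that by (auto simp: Y_def Suc.prems(2))
      show "Y e w ! i = Y e u ! i" if "n \<le> i" "i < k" for i w
      proof (cases "i = n")
        case False
        then show ?thesis using Suc.prems(4)[of i w] that by (simp add: Y_def)
      qed (use n in \<open>simp add: Y_def Suc.prems(2)\<close>)
    qed
    then have "((\<lambda>w. T w (Y e w)) has_derivative (\<lambda>h. T' h (Y e u) +
        (\<Sum>i<n. T u ((Y e u)[i := X' i h])))) (at u)" for e by simp
    then have D: "((\<lambda>w. \<Sum>e\<in>Basis. (X w ! n \<bullet> e) * T w (Y e w)) has_derivative
        (\<lambda>h. \<Sum>e\<in>Basis. (X u ! n \<bullet> e) * (T' h (Y e u) + (\<Sum>i<n. T u ((Y e u)[i := X' i h]))) +
          (X' n h \<bullet> e) * T u (Y e u))) (at u)"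
      by (intro has_derivative_sum has_derivative_mult has_derivative_inner_left Suc.prems(3)[OF n])
    have eq: "(\<Sum>e\<in>Basis. (X w ! n \<bullet> e) * T w (Y e w)) = T w (X w)" if "w \<in> U" for w
      unfolding Y_def by (rule multilinear_expand_nth[OF mult[OF that] Suc.prems(2) n, symmetric])
    have "(\<Sum>e\<in>Basis. (X u ! n \<bullet> e) * (T' h (Y e u) + (\<Sum>i<n. T u ((Y e u)[i := X' i h]))) +
          (X' n h \<bullet> e) * T u (Y e u)) =
        T' h (X u) + (\<Sum>i<Suc n. T u ((X u)[i := X' i h]))" for h
    proof -
      have "(\<Sum>e\<in>Basis. (X u ! n \<bullet> e) * T' h (Y e u)) = T' h (X u)"
        unfolding Y_def by (rule T'_expand[OF Suc.prems(2) n, symmetric])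
      moreover have "(\<Sum>e\<in>Basis. (X' n h \<bullet> e) * T u (Y e u)) = T u ((X u)[n := X' n h])"
        unfolding Y_def by (rule multilinear_expand[OF mult[OF U(2)] Suc.prems(2) n, symmetric])
      moreover have "(\<Sum>e\<in>Basis. (X u ! n \<bullet> e) * (\<Sum>i<n. T u ((Y e u)[i := X' i h]))) =
          (\<Sum>i<n. T u ((X u)[i := X' i h]))"
      proof -
        have "(\<Sum>e\<in>Basis. (X u ! n \<bullet> e) * (\<Sum>i<n. T u ((Y e u)[i := X' i h]))) =
            (\<Sum>i<n. \<Sum>e\<in>Basis. (X u ! n \<bullet> e) * T u ((Y e u)[i := X' i h]))"
          unfolding sum_distrib_left by (rule sum.swap)
        also have "\<dots> = (\<Sum>i<n. T u ((X u)[i := X' i h]))"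
        proof (rule sum.cong)
          fix i assume i: "i \<in> {..<n}"
          have "(X u)[n := e, i := y] = (X u)[i := y, n := e]" for e y
            using i by (intro list_update_swap) auto
          then show "(\<Sum>e\<in>Basis. (X u ! n \<bullet> e) * T u ((Y e u)[i := X' i h])) = T u ((X u)[i := X' i h])"
            using multilinear_expand_nth[OF mult[OF U(2)] _ n, of "(X u)[i := X' i h]", symmetric] i
            by (simp add: Y_def Suc.prems(2))
        qed simp
        finally show ?thesis .
      qed
      ultimately show ?thesis by (simp add: distrib_left sum.distrib)
    qed
    then show ?case
      using has_derivative_transform_within_open[OF D U eq] by simp
  qed
  from this[of k X X'] len X' show ?thesis by simp
qed

lemma multilinear_slot_has_derivative:
  fixes T :: "'b::real_normed_vector \<Rightarrow> 'e::euclidean_space tensor"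
  assumes U: "open U" "u \<in> U" and mult: "\<And>w. w \<in> U \<Longrightarrow> multilinear k (T w)"
    and T': "\<And>xs. length xs = k \<Longrightarrow> ((\<lambda>w. T w xs) has_derivative (\<lambda>h. T' h xs)) (at u)"
    and xs: "length xs = k" "i < k" and V: "(V has_derivative V') (at u)"
  shows "((\<lambda>w. T w (xs[i := V w])) has_derivative
    (\<lambda>h. T' h (xs[i := V u]) + T u (xs[i := V' h]))) (at u)"
proof -
  have "((\<lambda>w. T w (xs[i := V w])) has_derivative
      (\<lambda>h. T' h (xs[i := V u]) + (\<Sum>j<k. T u (xs[i := V u, j := (if j = i then V' else (\<lambda>h. 0)) h])))) (at u)"
    using xs V by (intro multilinear_has_derivative[OF U mult T']) (auto simp: nth_list_update)
  moreover have "(\<Sum>j<k. T u (xs[i := V u, j := (if j = i then V' else (\<lambda>h. 0)) h])) = T u (xs[i := V' h])" for h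
  proof -
    have "T u (xs[i := V u, j := (if j = i then V' else (\<lambda>h. 0)) h]) =
        (if j = i then T u (xs[i := V' h]) else 0)" if "j < k" for j
      using multilinear_update_zero[OF mult[OF U(2)], of "xs[i := V u]" j] xs that by auto
    then show ?thesis using xs by simp
  qed
  ultimately show ?thesis by simp
qed

lemma multilinear_slot_smooth:
  fixes T :: "'b::real_normed_vector \<Rightarrow> 'e::euclidean_space tensor"
  assumes U: "open U" and mult: "\<And>w. w \<in> U \<Longrightarrow> multilinear k (T w)"
    and T: "\<And>xs. length xs = k \<Longrightarrow> smooth_on U (\<lambda>w. T w xs)"
    and xs: "length xs = k" "i < k" and V: "smooth_on U V"
  shows "smooth_on U (\<lambda>w. T w (xs[i := V w]))"
proof -
  have "smooth_on U (\<lambda>w. \<Sum>e\<in>Basis. (V w \<bullet> e) * T w (xs[i := e]))"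
    using xs by (intro smooth_on_sum smooth_on_mult smooth_on_inner U V T) simp
  moreover have "(\<Sum>e\<in>Basis. (V w \<bullet> e) * T w (xs[i := e])) = T w (xs[i := V w])" if "w \<in> U" for w
    by (rule multilinear_expand[OF mult[OF that] xs, symmetric])
  ultimately show ?thesis by (rule smooth_on_cong[OF U, rotated])
qed

definition local_nabla ::
    "('e \<Rightarrow> 'e \<Rightarrow> 'e \<Rightarrow> 'e) \<Rightarrow> ('e::real_normed_vector \<Rightarrow> 'e tensor) \<Rightarrow> 'e \<Rightarrow> 'e tensor" where
  "local_nabla \<Gamma> T u xs = (case xs of [] \<Rightarrow> 0 | x # ys \<Rightarrow>
     frechet_derivative (\<lambda>w. T w ys) (at u) x - (\<Sum>i<length ys. T u (ys[i := \<Gamma> u x (ys ! i)])))"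

lemma local_nabla_Cons:
  "local_nabla \<Gamma> T u (x # ys) =
    frechet_derivative (\<lambda>w. T w ys) (at u) x - (\<Sum>i<length ys. T u (ys[i := \<Gamma> u x (ys ! i)]))"
  by (simp add: local_nabla_def)

definition local_curvature ::
    "('e \<Rightarrow> 'e \<Rightarrow> 'e \<Rightarrow> 'e::real_normed_vector) \<Rightarrow> 'e \<Rightarrow> 'e \<Rightarrow> 'e \<Rightarrow> 'e \<Rightarrow> 'e" where
  "local_curvature \<Gamma> u x y z =
     frechet_derivative (\<lambda>w. \<Gamma> w y z) (at u) x - frechet_derivative (\<lambda>w. \<Gamma> w x z) (at u) y
     + \<Gamma> u x (\<Gamma> u y z) - \<Gamma> u y (\<Gamma> u x z)"

text \<open>In the commutator of second covariant derivatives the second partial derivatives cancel, as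
  do all terms in which the two directions hit different slots; what remains in each slot is the
  curvature.\<close>

lemma local_ricci_identity:
  fixes T :: "'e::euclidean_space \<Rightarrow> 'e tensor"
  assumes U: "open U" "u \<in> U" and mult: "\<And>w. w \<in> U \<Longrightarrow> multilinear k (T w)"
    and T: "\<And>xs. length xs = k \<Longrightarrow> smooth_on U (\<lambda>w. T w xs)"
    and \<Gamma>: "\<And>x y. smooth_on U (\<lambda>w. \<Gamma> w x y)"
    and tf: "\<Gamma> u x y = \<Gamma> u y x"
    and zs: "length zs = k"
  shows "local_nabla \<Gamma> (local_nabla \<Gamma> T) u (x # y # zs) - local_nabla \<Gamma> (local_nabla \<Gamma> T) u (y # x # zs) =
    act (local_curvature \<Gamma> u x y) (T u) zs"
proof -
  define D where "D x xs = frechet_derivative (\<lambda>w. T w xs) (at u) x" for x xs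
  define DD where "DD x y = frechet_derivative (\<lambda>w. frechet_derivative (\<lambda>w. T w zs) (at w) y) (at u) x" for x y
  define off where "off x y j i = T u (zs[j := \<Gamma> u x (zs ! j), i := \<Gamma> u y (zs ! i)])" for x y j i
  define d\<Gamma> where "d\<Gamma> x y z = frechet_derivative (\<lambda>w. \<Gamma> w y z) (at u) x" for x y z
  have D: "((\<lambda>w. T w xs) has_derivative (\<lambda>h. D h xs)) (at u)" if "length xs = k" for xs
    using smooth_on_has_derivative[OF T[OF that] U(2)] unfolding D_def by simp
  have second: "local_nabla \<Gamma> (local_nabla \<Gamma> T) u (x # y # zs) =
      DD x y - (\<Sum>i<k. D x (zs[i := \<Gamma> u y (zs ! i)])) - (\<Sum>i<k. T u (zs[i := d\<Gamma> x y (zs ! i)]))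
      - local_nabla \<Gamma> T u (\<Gamma> u x y # zs)
      - (\<Sum>j<k. D y (zs[j := \<Gamma> u x (zs ! j)]))
      + (\<Sum>j<k. T u (zs[j := \<Gamma> u y (\<Gamma> u x (zs ! j))]))
      + (\<Sum>j<k. \<Sum>i<k. if i = j then 0 else off x y j i)" for x y
  proof -
    have "((\<lambda>w. local_nabla \<Gamma> T w (y # zs)) has_derivative
        (\<lambda>h. DD h y - (\<Sum>i<k. D h (zs[i := \<Gamma> u y (zs ! i)]) + T u (zs[i := d\<Gamma> h y (zs ! i)])))) (at u)"
      unfolding local_nabla_Cons zs DD_def d\<Gamma>_def
      using zs by (intro has_derivative_diff has_derivative_sum
          multilinear_slot_has_derivative[OF U mult D]
          smooth_on_has_derivative[OF \<Gamma> U(2)] smooth_on_has_derivative[OF smooth_on_derivative[OF T] U(2)]) auto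
    then have 1: "frechet_derivative (\<lambda>w. local_nabla \<Gamma> T w (y # zs)) (at u) x =
        DD x y - (\<Sum>i<k. D x (zs[i := \<Gamma> u y (zs ! i)]) + T u (zs[i := d\<Gamma> x y (zs ! i)]))"
      by (rule fun_cong[OF frechet_derivative_at[symmetric]])
    have 2: "local_nabla \<Gamma> T u (y # zs[j := \<Gamma> u x (zs ! j)]) =
        D y (zs[j := \<Gamma> u x (zs ! j)]) - T u (zs[j := \<Gamma> u y (\<Gamma> u x (zs ! j))])
          - (\<Sum>i<k. if i = j then 0 else off x y j i)" if j: "j < k" for j
    proof -
      have "T u (zs[j := \<Gamma> u x (zs ! j), i := \<Gamma> u y (zs[j := \<Gamma> u x (zs ! j)] ! i)]) =
          (if i = j then T u (zs[j := \<Gamma> u y (\<Gamma> u x (zs ! j))]) else 0) + (if i = j then 0 else off x y j i)"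
        if "i < k" for i
        using j zs by (auto simp: off_def)
      then have "(\<Sum>i<k. T u (zs[j := \<Gamma> u x (zs ! j), i := \<Gamma> u y (zs[j := \<Gamma> u x (zs ! j)] ! i)])) =
          T u (zs[j := \<Gamma> u y (\<Gamma> u x (zs ! j))]) + (\<Sum>i<k. if i = j then 0 else off x y j i)"
        using j by (simp add: sum.distrib)
      then show ?thesis using zs by (simp add: local_nabla_Cons D_def)
    qed
    have "local_nabla \<Gamma> (local_nabla \<Gamma> T) u (x # y # zs) =
        frechet_derivative (\<lambda>w. local_nabla \<Gamma> T w (y # zs)) (at u) x
        - (\<Sum>i<Suc k. local_nabla \<Gamma> T u ((y # zs)[i := \<Gamma> u x ((y # zs) ! i)]))"
      using zs by (simp only: local_nabla_Cons[of \<Gamma> "local_nabla \<Gamma> T"] list.size) simp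
    also have "(\<Sum>i<Suc k. local_nabla \<Gamma> T u ((y # zs)[i := \<Gamma> u x ((y # zs) ! i)])) =
        local_nabla \<Gamma> T u (\<Gamma> u x y # zs) + (\<Sum>j<k. local_nabla \<Gamma> T u (y # zs[j := \<Gamma> u x (zs ! j)]))"
      unfolding sum.lessThan_Suc_shift by simp
    finally show ?thesis
      unfolding 1 by (simp add: 2 sum.distrib sum_subtractf)
  qed
  have "DD x y = DD y x"
    unfolding DD_def by (rule mixed_derivatives_commute[OF U(1) T[OF zs] U(2)])
  moreover have "(\<Sum>j<k. \<Sum>i<k. if i = j then 0 else off x y j i) = (\<Sum>j<k. \<Sum>i<k. if i = j then 0 else off y x j i)"
    by (subst sum.swap) (auto simp: off_def intro!: sum.cong list_update_swap arg_cong[of _ _ "T u"])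
  moreover have "act (local_curvature \<Gamma> u x y) (T u) zs =
      - (\<Sum>i<k. T u (zs[i := d\<Gamma> x y (zs ! i)])) + (\<Sum>i<k. T u (zs[i := d\<Gamma> y x (zs ! i)]))
      - (\<Sum>i<k. T u (zs[i := \<Gamma> u x (\<Gamma> u y (zs ! i))])) + (\<Sum>i<k. T u (zs[i := \<Gamma> u y (\<Gamma> u x (zs ! i))]))"
  proof -
    have "T u (zs[i := local_curvature \<Gamma> u x y (zs ! i)]) =
        T u (zs[i := d\<Gamma> x y (zs ! i)]) - T u (zs[i := d\<Gamma> y x (zs ! i)])
        + T u (zs[i := \<Gamma> u x (\<Gamma> u y (zs ! i))]) - T u (zs[i := \<Gamma> u y (\<Gamma> u x (zs ! i))])" if "i < k" for i
    proof -
      note lin = multilinear_linear[OF mult[OF U(2)] zs that]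
      show ?thesis
        unfolding local_curvature_def d\<Gamma>_def linear_add[OF lin] linear_diff[OF lin] ..
    qed
    then have "(\<Sum>i<k. T u (zs[i := local_curvature \<Gamma> u x y (zs ! i)])) =
        (\<Sum>i<k. T u (zs[i := d\<Gamma> x y (zs ! i)]) - T u (zs[i := d\<Gamma> y x (zs ! i)])
        + T u (zs[i := \<Gamma> u x (\<Gamma> u y (zs ! i))]) - T u (zs[i := \<Gamma> u y (\<Gamma> u x (zs ! i))]))"
      by (intro sum.cong) auto
    then show ?thesis by (simp add: act_def zs sum.distrib sum_subtractf)
  qed
  ultimately show ?thesis unfolding second using tf by simp
qed

text \<open>This is the reason why the Levi-Civita connection is unique: the difference of two torsion-free
  metric connections has these symmetries.\<close>

lemma symmetric_skew_imp_zero: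
  fixes A :: "'a \<Rightarrow> 'a \<Rightarrow> 'a \<Rightarrow> real"
  assumes "\<And>x y z. A x y z = A y x z" "\<And>x y z. A x y z = - A x z y"
  shows "A x y z = 0"
proof -
  have "A x y z = - A x z y" "A x z y = A z x y" "A z x y = - A z y x" "A z y x = A y z x"
    "A y z x = - A y x z" "A y x z = A x y z" using assms by blast+
  then show ?thesis by linarith
qed

text \<open>The condition that characterizes the Levi-Civita connection at a point of a chart with metric
  coefficients \<open>G\<close>.\<close>

definition christoffel_condition ::
    "('e::real_normed_vector \<Rightarrow> 'e tensor) \<Rightarrow> 'e \<Rightarrow> ('e \<Rightarrow> 'e \<Rightarrow> 'e) \<Rightarrow> bool" where
  "christoffel_condition G u \<Gamma> \<longleftrightarrow> bilinear \<Gamma> \<and> (\<forall>x y. \<Gamma> x y = \<Gamma> y x) \<and>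
     (\<forall>x y z. frechet_derivative (\<lambda>w. G w [y, z]) (at u) x = G u [\<Gamma> x y, z] + G u [y, \<Gamma> x z])"

definition christoffel :: "('e::real_normed_vector \<Rightarrow> 'e tensor) \<Rightarrow> 'e \<Rightarrow> 'e \<Rightarrow> 'e \<Rightarrow> 'e" where
  "christoffel G u = (THE \<Gamma>. christoffel_condition G u \<Gamma>)"

lemma multilinear2_bilinear_form:
  "multilinear 2 \<gamma> \<Longrightarrow> bilinear_form (\<lambda>x y. \<gamma> [x, y])"
  using multilinear_linear[of 2 \<gamma> "[_, _]" 0] multilinear_linear[of 2 \<gamma> "[_, _]" 1]
  by (simp add: bilinear_form_def)

locale local_metric =
  fixes U :: "'e::euclidean_space set" and G :: "'e \<Rightarrow> 'e tensor"
  assumes open_U: "open U"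
    and multilinear_G: "\<And>u. u \<in> U \<Longrightarrow> multilinear 2 (G u)"
    and symmetric_G: "\<And>u x y. u \<in> U \<Longrightarrow> G u [x, y] = G u [y, x]"
    and nondegenerate_G: "\<And>u. u \<in> U \<Longrightarrow> nondegenerate (\<lambda>x y. G u [x, y])"
    and smooth_G: "\<And>x y. smooth_on U (\<lambda>u. G u [x, y])"
begin

lemma bilinear_G: "u \<in> U \<Longrightarrow> bilinear_form (\<lambda>x y. G u [x, y])"
  using multilinear2_bilinear_form multilinear_G by blast

sublocale G: smooth_nondegenerate_family U "\<lambda>u x y. G u [x, y]"
  using open_U bilinear_G nondegenerate_G smooth_G by unfold_locales auto

text \<open>Partial derivatives of the metric; they determine the Christoffel symbols.\<close>

definition dG :: "'e \<Rightarrow> 'e \<Rightarrow> 'e \<Rightarrow> 'e \<Rightarrow> real" where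
  "dG u x y z = frechet_derivative (\<lambda>w. G w [y, z]) (at u) x"

lemma dG_smooth: "smooth_on U (\<lambda>u. dG u x y z)"
  unfolding dG_def using smooth_on_derivative[OF smooth_G] .

lemma dG_has_derivative: "u \<in> U \<Longrightarrow> ((\<lambda>w. G w [y, z]) has_derivative (\<lambda>x. dG u x y z)) (at u)"
  unfolding dG_def using smooth_on_has_derivative[OF smooth_G, of u y z] by simp

lemma dG_symmetric: "u \<in> U \<Longrightarrow> dG u x y z = dG u x z y"
  unfolding dG_def using frechet_derivative_cong_open[OF open_U, of u "\<lambda>w. G w [y, z]" "\<lambda>w. G w [z, y]"]
    symmetric_G by simp

lemma dG_eqI:
  assumes "u \<in> U" "((\<lambda>w. f w) has_derivative f') (at u)" "\<And>w. w \<in> U \<Longrightarrow> f w = G w [y, z]"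
  shows "dG u x y z = f' x"
proof -
  have "((\<lambda>w. G w [y, z]) has_derivative f') (at u)"
    using has_derivative_transform_within_open[OF assms(2) open_U assms(1,3)] by simp
  from has_derivative_unique[OF dG_has_derivative[OF assms(1)] this] show ?thesis by (rule fun_cong)
qed

lemma dG_linear:
  assumes u: "u \<in> U"
  shows "linear (\<lambda>x. dG u x y z)" "linear (\<lambda>y. dG u x y z)" "linear (\<lambda>z. dG u x y z)"
proof -
  show "linear (\<lambda>x. dG u x y z)" using has_derivative_linear[OF dG_has_derivative[OF u]] .
  show right: "linear (\<lambda>z. dG u x y z)" for y
  proof (rule linearI)
    fix a b show "dG u x y (a + b) = dG u x y a + dG u x y b"
      by (rule dG_eqI[OF u has_derivative_add[OF dG_has_derivative dG_has_derivative]])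
        (use u in \<open>auto simp: bilinear_formD[OF bilinear_G]\<close>)
  next
    fix c a show "dG u x y (c *\<^sub>R a) = c *\<^sub>R dG u x y a"
      unfolding real_scaleR_def by (rule dG_eqI[OF u has_derivative_mult_right[OF dG_has_derivative]])
        (use u in \<open>auto simp: bilinear_formD[OF bilinear_G]\<close>)
  qed
  show "linear (\<lambda>y. dG u x y z)"
    using right[of z] dG_symmetric[OF u] by simp
qed

lemma christoffel_condition_unique:
  assumes u: "u \<in> U" and "christoffel_condition G u \<Gamma>" "christoffel_condition G u \<Gamma>'"
  shows "\<Gamma> = \<Gamma>'"
proof (intro ext)
  fix x y
  define A where "A x y z = G u [\<Gamma> x y - \<Gamma>' x y, z]" for x y z
  have "A x y z = A y x z" for x y z
    using assms(2,3) unfolding A_def christoffel_condition_def by metis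
  moreover have "A x y z = - A x z y" for x y z
  proof -
    have "G u [\<Gamma> x y, z] + G u [y, \<Gamma> x z] = G u [\<Gamma>' x y, z] + G u [y, \<Gamma>' x z]"
      using assms(2,3) unfolding christoffel_condition_def by metis
    then show ?thesis
      unfolding A_def using symmetric_G[OF u, of y]
      by (simp add: bilinear_formD[OF bilinear_G[OF u]])
  qed
  ultimately have "A x y z = 0" for z by (rule symmetric_skew_imp_zero)
  then have "\<Gamma> x y - \<Gamma>' x y = 0"
    using nondegenerate_G[OF u] unfolding A_def nondegenerate_def by blast
  then show "\<Gamma> x y = \<Gamma>' x y" by simp
qed

text \<open>Existence is the Koszul formula.\<close>

definition koszul :: "'e \<Rightarrow> 'e \<Rightarrow> 'e \<Rightarrow> 'e \<Rightarrow> real" where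
  "koszul u x y z = (dG u x y z + dG u y x z - dG u z x y) / 2"

lemma koszul_linear:
  assumes u: "u \<in> U"
  shows "linear (\<lambda>x. koszul u x y z)" "linear (\<lambda>y. koszul u x y z)" "linear (\<lambda>z. koszul u x y z)"
  by (rule linearI; simp add: koszul_def linear_add[OF dG_linear(1)[OF u]] linear_add[OF dG_linear(2)[OF u]]
      linear_add[OF dG_linear(3)[OF u]] linear_scale[OF dG_linear(1)[OF u]] linear_scale[OF dG_linear(2)[OF u]]
      linear_scale[OF dG_linear(3)[OF u]] algebra_simps add_divide_distrib diff_divide_distrib)+

lemma christoffel_condition_exists:
  assumes u: "u \<in> U"
  shows "\<exists>\<Gamma>. christoffel_condition G u \<Gamma>"
proof -
  note B = bilinear_G[OF u] and N = nondegenerate_G[OF u]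
  have "\<exists>v. \<forall>z. G u [v, z] = koszul u x y z" for x y
    using nondegenerate_represent[OF B N koszul_linear(3)[OF u]] .
  then obtain \<Gamma> where \<Gamma>: "\<And>x y z. G u [\<Gamma> x y, z] = koszul u x y z" by metis
  have "linear (\<Gamma> x)" for x
    by (rule linearI; rule nondegenerate_eqI[OF B N];
        simp add: bilinear_formD[OF B] \<Gamma> linear_add[OF koszul_linear(2)[OF u]] linear_scale[OF koszul_linear(2)[OF u]])
  moreover have "linear (\<lambda>x. \<Gamma> x y)" for y
    by (rule linearI; rule nondegenerate_eqI[OF B N];
        simp add: bilinear_formD[OF B] \<Gamma> linear_add[OF koszul_linear(1)[OF u]] linear_scale[OF koszul_linear(1)[OF u]])
  moreover have "\<Gamma> x y = \<Gamma> y x" for x y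
    by (rule nondegenerate_eqI[OF B N]) (simp add: \<Gamma> koszul_def dG_symmetric[OF u, of _ x y])
  moreover have "dG u x y z = G u [\<Gamma> x y, z] + G u [y, \<Gamma> x z]" for x y z
    unfolding symmetric_G[OF u, of y] \<Gamma> koszul_def
    using dG_symmetric[OF u, of x y z] dG_symmetric[OF u, of y x z] dG_symmetric[OF u, of z x y]
    by (simp add: field_simps)
  ultimately show ?thesis
    unfolding christoffel_condition_def bilinear_def dG_def by blast
qed

lemma christoffel_works: "u \<in> U \<Longrightarrow> christoffel_condition G u (christoffel G u)"
  unfolding christoffel_def
  using christoffel_condition_exists christoffel_condition_unique by (metis theI')

lemma christoffel_eqI: "u \<in> U \<Longrightarrow> christoffel_condition G u \<Gamma> \<Longrightarrow> christoffel G u = \<Gamma>"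
  using christoffel_works christoffel_condition_unique by blast

lemma christoffel_bilinear: "u \<in> U \<Longrightarrow> linear (christoffel G u x)" "u \<in> U \<Longrightarrow> linear (\<lambda>x. christoffel G u x y)"
  using christoffel_works unfolding christoffel_condition_def bilinear_def by auto

lemma christoffel_symmetric: "u \<in> U \<Longrightarrow> christoffel G u x y = christoffel G u y x"
  using christoffel_works unfolding christoffel_condition_def by auto

lemma christoffel_metric:
  "u \<in> U \<Longrightarrow> dG u x y z = G u [christoffel G u x y, z] + G u [y, christoffel G u x z]"
  using christoffel_works unfolding christoffel_condition_def dG_def by auto

lemma christoffel_koszul:
  assumes u: "u \<in> U"
  shows "G u [christoffel G u x y, z] = koszul u x y z"
  using christoffel_metric[OF u, of x y z] christoffel_metric[OF u, of y x z] christoffel_metric[OF u, of z x y]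
    christoffel_symmetric[OF u, of y x] christoffel_symmetric[OF u, of z x] christoffel_symmetric[OF u, of z y]
    symmetric_G[OF u, of y "christoffel G u x z"]
  by (simp add: koszul_def)

lemma christoffel_smooth: "smooth_on U (\<lambda>u. christoffel G u x y)"
proof (rule G.solution_smooth)
  show "smooth_on U (\<lambda>u. (1/2) * (dG u x y z + dG u y x z - dG u z x y))" for z
    by (intro smooth_on_mult smooth_on_diff smooth_on_add smooth_on_const dG_smooth open_U)
  show "G u [christoffel G u x y, z] = (1/2) * (dG u x y z + dG u y x z - dG u z x y)" if "u \<in> U" for u z
    using christoffel_koszul[OF that] by (simp add: koszul_def)
qed


lemma local_nabla_metric: "u \<in> U \<Longrightarrow> local_nabla (christoffel G) G u [x, y, z] = 0"
  using christoffel_metric[of u x y z] by (simp add: local_nabla_Cons dG_def lessThan_Suc numeral_2_eq_2)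

end

lemma local_nabla_cong:
  assumes "open U" "u \<in> U" "\<And>w. w \<in> U \<Longrightarrow> T w = T' w"
  shows "local_nabla \<Gamma> T u xs = local_nabla \<Gamma> T' u xs"
proof (cases xs)
  case (Cons x ys)
  have "frechet_derivative (\<lambda>w. T w ys) (at u) = frechet_derivative (\<lambda>w. T' w ys) (at u)"
    by (rule frechet_derivative_cong_open[OF assms(1,2)]) (simp add: assms(3))
  then show ?thesis using assms(2,3) by (simp add: Cons local_nabla_Cons)
qed (simp add: local_nabla_def)

lemma local_metric_subset:
  "local_metric U G \<Longrightarrow> open V \<Longrightarrow> V \<subseteq> U \<Longrightarrow> local_metric V G"
  unfolding local_metric_def by (blast intro: smooth_on_subset)

text \<open>The coordinate expression of a tensor field in a chart with image \<open>U\<close>.\<close>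

locale local_tensor =
  fixes U :: "'e::euclidean_space set" and k :: nat and T :: "'e \<Rightarrow> 'e tensor"
  assumes open_U: "open U"
    and multilinear_T: "\<And>u. u \<in> U \<Longrightarrow> multilinear k (T u)"
    and smooth_T: "\<And>xs. length xs = k \<Longrightarrow> smooth_on U (\<lambda>u. T u xs)"
begin

lemma has_derivative_T:
  "length xs = k \<Longrightarrow> u \<in> U \<Longrightarrow>
    ((\<lambda>w. T w xs) has_derivative (\<lambda>x. frechet_derivative (\<lambda>w. T w xs) (at u) x)) (at u)"
  using smooth_on_has_derivative[OF smooth_T] by simp

lemma derivative_multilinear:
  assumes u: "u \<in> U" and ys: "length ys = k" "i < k"
  shows "linear (\<lambda>y. frechet_derivative (\<lambda>w. T w (ys[i := y])) (at u) x)"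
proof (rule linearI)
  have len: "length (ys[i := y]) = k" for y using ys by simp
  note lin = multilinear_linear[OF multilinear_T ys]
  fix a b
  have "((\<lambda>w. T w (ys[i := a + b])) has_derivative (\<lambda>x. frechet_derivative (\<lambda>w. T w (ys[i := a])) (at u) x
      + frechet_derivative (\<lambda>w. T w (ys[i := b])) (at u) x)) (at u)"
    by (rule has_derivative_transform_within_open[OF _ open_U u])
      (rule has_derivative_add[OF has_derivative_T[OF len u] has_derivative_T[OF len u]],
       rule linear_add[OF lin, symmetric])
  then show "frechet_derivative (\<lambda>w. T w (ys[i := a + b])) (at u) x =
      frechet_derivative (\<lambda>w. T w (ys[i := a])) (at u) x + frechet_derivative (\<lambda>w. T w (ys[i := b])) (at u) x"
    by (rule fun_cong[OF frechet_derivative_at[symmetric]])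
next
  have len: "length (ys[i := y]) = k" for y using ys by simp
  note lin = multilinear_linear[OF multilinear_T ys]
  fix r b
  have "((\<lambda>w. T w (ys[i := r *\<^sub>R b])) has_derivative
      (\<lambda>x. r *\<^sub>R frechet_derivative (\<lambda>w. T w (ys[i := b])) (at u) x)) (at u)"
    by (rule has_derivative_transform_within_open[OF _ open_U u])
      (rule has_derivative_scaleR_right[OF has_derivative_T[OF len u]],
       rule linear_scale[OF lin, symmetric])
  then show "frechet_derivative (\<lambda>w. T w (ys[i := r *\<^sub>R b])) (at u) x =
      r *\<^sub>R frechet_derivative (\<lambda>w. T w (ys[i := b])) (at u) x"
    by (rule fun_cong[OF frechet_derivative_at[symmetric]])
qed

lemma local_nabla_wrong_length:
  assumes u: "u \<in> U" and "length ys \<noteq> k"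
  shows "local_nabla \<Gamma> T u (x # ys) = 0"
proof -
  have zero: "T w ys' = 0" if "w \<in> U" "length ys' = length ys" for w ys'
    using multilinear_length[OF multilinear_T[OF that(1)]] that assms by simp
  have "frechet_derivative (\<lambda>w. T w ys) (at u) = frechet_derivative (\<lambda>w. 0) (at u)"
    by (rule frechet_derivative_cong_open[OF open_U u]) (simp add: zero)
  then show ?thesis using u by (simp add: local_nabla_Cons zero)
qed

lemma local_nabla_multilinear:
  assumes u: "u \<in> U" and \<Gamma>: "bilinear (\<Gamma> u)"
  shows "multilinear (Suc k) (local_nabla \<Gamma> T u)"
  unfolding multilinear_def
proof (intro conjI allI impI)
  have \<Gamma>1: "linear (\<Gamma> u x)" and \<Gamma>2: "linear (\<lambda>x. \<Gamma> u x y)" for x y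
    using \<Gamma> by (auto simp: bilinear_def)
  fix xs :: "'e list" and i assume xs: "length xs = Suc k" and i: "i < Suc k"
  then obtain x ys where Cons: "xs = x # ys" and ys: "length ys = k" by (cases xs) auto
  note lin = multilinear_linear[OF multilinear_T[OF u]]
  show "linear (\<lambda>y. local_nabla \<Gamma> T u (xs[i := y]))"
  proof (cases i)
    case 0
    have "linear (\<lambda>y. frechet_derivative (\<lambda>w. T w ys) (at u) y)"
      using has_derivative_linear[OF has_derivative_T[OF ys u]] .
    moreover have "linear (\<lambda>y. \<Sum>j<k. T u (ys[j := \<Gamma> u y (ys ! j)]))"
      using ys by (intro linear_compose_sum ballI linear_compose[OF \<Gamma>2 lin, unfolded o_def]) auto
    ultimately show ?thesis
      using ys by (simp add: 0 Cons local_nabla_Cons linear_compose_sub)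
  next
    case (Suc i')
    then have i': "i' < k" using i by simp
    have "linear (\<lambda>y. T u (ys[i' := y, j := \<Gamma> u x (ys[i' := y] ! j)]))" if "j < k" for j
    proof (cases "j = i'")
      case True
      then show ?thesis
        using linear_compose[OF \<Gamma>1 lin[OF ys i'], of x] ys i' by (simp add: o_def)
    next
      case False
      then have "(\<lambda>y. T u (ys[i' := y, j := \<Gamma> u x (ys[i' := y] ! j)])) =
          (\<lambda>y. T u (ys[j := \<Gamma> u x (ys ! j), i' := y]))"
        by (simp add: list_update_swap)
      then show ?thesis using lin[of "ys[j := \<Gamma> u x (ys ! j)]" i'] ys i' by simp
    qed
    then have "linear (\<lambda>y. \<Sum>j<k. T u (ys[i' := y, j := \<Gamma> u x (ys[i' := y] ! j)]))"
      by (intro linear_compose_sum) auto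
    then show ?thesis
      using linear_compose_sub[OF derivative_multilinear[OF u ys i']] ys
      by (simp add: Suc Cons local_nabla_Cons)
  qed
next
  fix xs :: "'e list" assume "length xs \<noteq> Suc k"
  then show "local_nabla \<Gamma> T u xs = 0"
    using local_nabla_wrong_length[OF u] by (cases xs) (auto simp: local_nabla_def)
qed

lemma local_nabla_smooth:
  assumes \<Gamma>: "\<And>x y. smooth_on U (\<lambda>u. \<Gamma> u x y)" and ys: "length ys = k"
  shows "smooth_on U (\<lambda>u. local_nabla \<Gamma> T u (x # ys))"
  unfolding local_nabla_Cons ys
  by (intro smooth_on_diff smooth_on_sum open_U smooth_on_derivative smooth_T
      multilinear_slot_smooth[OF open_U multilinear_T smooth_T] \<Gamma>) (use ys in auto)

end

text \<open>The second derivatives of the change of coordinates \<open>\<phi>\<close>, which the product rule produces in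
  every slot, are cancelled by the inhomogeneous term in the transformation of \<open>\<Gamma>\<close>.\<close>

lemma local_nabla_transform:
  assumes W: "open W" "u \<in> W" and \<phi>: "smooth_on W \<phi>" "\<phi> ` W \<subseteq> V"
    and T': "local_tensor V k T'"
    and T: "\<And>w ys. w \<in> W \<Longrightarrow> T w ys = T' (\<phi> w) (map (frechet_derivative \<phi> (at w)) ys)"
    and \<Gamma>: "\<And>x y. frechet_derivative \<phi> (at u) (\<Gamma> u x y) =
      frechet_derivative (\<lambda>w. frechet_derivative \<phi> (at w) y) (at u) x
      + \<Gamma>' (\<phi> u) (frechet_derivative \<phi> (at u) x) (frechet_derivative \<phi> (at u) y)"
  shows "local_nabla \<Gamma> T u xs = local_nabla \<Gamma>' T' (\<phi> u) (map (frechet_derivative \<phi> (at u)) xs)"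
proof (cases xs)
  case Nil then show ?thesis by (simp add: local_nabla_def)
next
  case (Cons x ys)
  interpret T': local_tensor V k T' by (rule T')
  define F where "F = frechet_derivative \<phi> (at u)"
  have \<phi>u: "\<phi> u \<in> V" using \<phi>(2) W(2) by auto
  show ?thesis
  proof (cases "length ys = k")
    case False
    have zero: "T w ys' = 0" if "w \<in> W" "length ys' = length ys" for w ys'
      using multilinear_length[OF T'.multilinear_T] T[OF that(1)] \<phi>(2) that False by auto
    have "frechet_derivative (\<lambda>w. T w ys) (at u) = frechet_derivative (\<lambda>w. 0) (at u)"
      by (rule frechet_derivative_cong_open[OF W]) (simp add: zero)
    then have "local_nabla \<Gamma> T u xs = 0" using W by (simp add: Cons local_nabla_Cons zero)
    then show ?thesis using T'.local_nabla_wrong_length[OF \<phi>u] False by (simp add: Cons)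
  next
    case ys: True
    define D where "D h xs = frechet_derivative (\<lambda>w. T' w xs) (at (\<phi> u)) (F h)" for h xs
    define H where "H x y = frechet_derivative (\<lambda>w. frechet_derivative \<phi> (at w) y) (at u) x" for x y
    have D: "((\<lambda>w. T' (\<phi> w) xs) has_derivative (\<lambda>h. D h xs)) (at u)" if "length xs = k" for xs
      using diff_chain_at[OF smooth_on_has_derivative[OF \<phi>(1) W(2)] T'.has_derivative_T[OF that \<phi>u]]
      by (simp add: o_def D_def F_def)
    have "((\<lambda>w. T' (\<phi> w) (map (frechet_derivative \<phi> (at w)) ys)) has_derivative
        (\<lambda>h. D h (map (frechet_derivative \<phi> (at u)) ys) +
          (\<Sum>i<k. T' (\<phi> u) ((map (frechet_derivative \<phi> (at u)) ys)[i := H h (ys ! i)])))) (at u)"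
    proof (rule multilinear_has_derivative[OF W _ D])
      show "multilinear k (T' (\<phi> w))" if "w \<in> W" for w using T'.multilinear_T \<phi>(2) that by auto
      show "((\<lambda>w. map (frechet_derivative \<phi> (at w)) ys ! i) has_derivative (\<lambda>h. H h (ys ! i))) (at u)"
        if "i < k" for i
        using smooth_on_has_derivative[OF smooth_on_derivative[OF \<phi>(1)] W(2)] that ys by (simp add: H_def)
    qed (use ys in auto)
    then have "((\<lambda>w. T w ys) has_derivative (\<lambda>h. D h (map F ys) +
        (\<Sum>i<k. T' (\<phi> u) ((map F ys)[i := H h (ys ! i)])))) (at u)"
      unfolding F_def by (rule has_derivative_transform_within_open[OF _ W]) (simp add: T)
    then have "frechet_derivative (\<lambda>w. T w ys) (at u) x = D x (map F ys) +
        (\<Sum>i<k. T' (\<phi> u) ((map F ys)[i := H x (ys ! i)]))"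
      by (rule fun_cong[OF frechet_derivative_at[symmetric]])
    moreover have "T u (ys[i := \<Gamma> u x (ys ! i)]) = T' (\<phi> u) ((map F ys)[i := H x (ys ! i)])
        + T' (\<phi> u) ((map F ys)[i := \<Gamma>' (\<phi> u) (F x) (F (ys ! i))])" if "i < k" for i
    proof -
      have "T u (ys[i := \<Gamma> u x (ys ! i)]) = T' (\<phi> u) ((map F ys)[i := F (\<Gamma> u x (ys ! i))])"
        by (simp add: T[OF W(2)] F_def map_update)
      also have "F (\<Gamma> u x (ys ! i)) = H x (ys ! i) + \<Gamma>' (\<phi> u) (F x) (F (ys ! i))"
        unfolding F_def H_def by (rule \<Gamma>)
      finally show ?thesis
        using linear_add[OF multilinear_linear[OF T'.multilinear_T[OF \<phi>u], of "map F ys" i]] ys that by simp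
    qed
    ultimately show ?thesis
      by (simp add: Cons local_nabla_Cons ys sum.distrib D_def F_def[symmetric])
  qed
qed

lemma local_metric_imp_local_tensor: "local_metric U G \<Longrightarrow> local_tensor U 2 G"
  unfolding local_metric_def local_tensor_def
  by (auto simp: numeral_2_eq_2 length_Suc_conv)

text \<open>Pairing the difference \<open>\<Delta>\<close> of the two sides with the metric gives a tensor that is symmetric in
  its first two arguments by equality of mixed derivatives, and skew in the last two because both
  connections are metric.\<close>

lemma christoffel_transform:
  assumes W: "open W" "u \<in> W" and \<phi>: "smooth_on W \<phi>" "\<phi> ` W \<subseteq> V"
    and G: "local_metric W G" and G': "local_metric V G'"
    and T: "\<And>w ys. w \<in> W \<Longrightarrow> G w ys = G' (\<phi> w) (map (frechet_derivative \<phi> (at w)) ys)"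
    and surj: "surj (frechet_derivative \<phi> (at u))"
  shows "frechet_derivative \<phi> (at u) (christoffel G u x y) =
      frechet_derivative (\<lambda>w. frechet_derivative \<phi> (at w) y) (at u) x
      + christoffel G' (\<phi> u) (frechet_derivative \<phi> (at u) x) (frechet_derivative \<phi> (at u) y)"
proof -
  interpret G: local_metric W G by (rule G)
  interpret G': local_metric V G' by (rule G')
  define F where "F = frechet_derivative \<phi> (at u)"
  define H where "H x y = frechet_derivative (\<lambda>w. frechet_derivative \<phi> (at w) y) (at u) x" for x y
  have \<phi>u: "\<phi> u \<in> V" using \<phi>(2) W(2) by auto
  note B' = bilinear_formD[OF G'.bilinear_G[OF \<phi>u]]
  define \<Delta> where "\<Delta> x y = F (christoffel G u x y) - H x y - christoffel G' (\<phi> u) (F x) (F y)" for x y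
  have dG: "G.dG u x y z = G'.dG (\<phi> u) (F x) (F y) (F z) + G' (\<phi> u) [H x y, F z] + G' (\<phi> u) [F y, H x z]"
    for x y z
  proof -
    have D: "((\<lambda>w. G' (\<phi> w) xs) has_derivative
        (\<lambda>h. frechet_derivative (\<lambda>w. G' w xs) (at (\<phi> u)) (F h))) (at u)" if "length xs = 2" for xs
      using diff_chain_at[OF smooth_on_has_derivative[OF \<phi>(1) W(2)]
          local_tensor.has_derivative_T[OF local_metric_imp_local_tensor[OF G'] that \<phi>u]]
      by (simp add: o_def F_def)
    have "((\<lambda>w. G' (\<phi> w) (map (frechet_derivative \<phi> (at w)) [y, z])) has_derivative
        (\<lambda>h. frechet_derivative (\<lambda>w. G' w (map (frechet_derivative \<phi> (at u)) [y, z])) (at (\<phi> u)) (F h) +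
          (\<Sum>i<2. G' (\<phi> u) ((map (frechet_derivative \<phi> (at u)) [y, z])[i := H h ([y, z] ! i)])))) (at u)"
    proof (rule multilinear_has_derivative[OF W _ D])
      show "multilinear 2 (G' (\<phi> w))" if "w \<in> W" for w using G'.multilinear_G \<phi>(2) that by auto
      show "((\<lambda>w. map (frechet_derivative \<phi> (at w)) [y, z] ! i) has_derivative (\<lambda>h. H h ([y, z] ! i))) (at u)"
        if "i < 2" for i
        using smooth_on_has_derivative[OF smooth_on_derivative[OF \<phi>(1)] W(2)] that
        by (auto simp: H_def less_2_cases_iff)
    qed auto
    from G.dG_eqI[OF W(2) this, of y z x]
    show ?thesis by (simp add: T G'.dG_def F_def numeral_2_eq_2)
  qed
  have GF: "G u [x, y] = G' (\<phi> u) [F x, F y]" for x y using T[OF W(2), of "[x, y]"] by (simp add: F_def)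
  have skew: "G' (\<phi> u) [\<Delta> x y, F z] = - G' (\<phi> u) [\<Delta> x z, F y]" for x y z
    using dG[of x y z] G.christoffel_metric[OF W(2), of x y z] G'.christoffel_metric[OF \<phi>u, of "F x" "F y" "F z"]
      G'.symmetric_G[OF \<phi>u, of "F y"]
    by (simp add: \<Delta>_def B' GF)
  have "H x y = H y x" for x y
    unfolding H_def by (rule mixed_derivatives_commute[OF W(1) \<phi>(1) W(2)])
  then have sym: "G' (\<phi> u) [\<Delta> x y, F z] = G' (\<phi> u) [\<Delta> y x, F z]" for x y z
    using G.christoffel_symmetric[OF W(2), of x y] G'.christoffel_symmetric[OF \<phi>u, of "F x" "F y"]
    by (simp add: \<Delta>_def)
  have "G' (\<phi> u) [\<Delta> x y, F z] = 0" for z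
    using sym skew by (rule symmetric_skew_imp_zero[of "\<lambda>x y z. G' (\<phi> u) [\<Delta> x y, F z]"])
  then have "G' (\<phi> u) [\<Delta> x y, z] = 0" for z
    using surj unfolding F_def[symmetric] by (metis surjD)
  then have "\<Delta> x y = 0" using G'.nondegenerate_G[OF \<phi>u] unfolding nondegenerate_def by blast
  then show ?thesis by (simp add: \<Delta>_def F_def H_def algebra_simps)
qed

lemma levi_civita_christoffel: "levi_civita M g c u = christoffel (in_chart M c g) u"
  unfolding levi_civita_def christoffel_def christoffel_condition_def ..

section \<open>Covariant differentiation on manifolds\<close>

locale manifold_charts =
  fixes M :: "('a, 'e::euclidean_space) manifold"
  assumes smooth_manifold: "smooth_manifold M"
begin

abbreviation transition :: "('a, 'e) chart \<Rightarrow> ('a, 'e) chart \<Rightarrow> 'e \<Rightarrow> 'e" where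
  "transition c c' \<equiv> snd c' \<circ> chart_inv c"

lemma chart_open: "c \<in> atlas M \<Longrightarrow> open (chart_image c)"
  using smooth_manifold by (simp add: smooth_manifold_def)

lemma chart_domain_open: "c \<in> atlas M \<Longrightarrow> openin (man_topology M) (fst c)"
  using smooth_manifold by (simp add: smooth_manifold_def)

lemma chart_domain_subset: "c \<in> atlas M \<Longrightarrow> fst c \<subseteq> points M"
  using chart_domain_open openin_subset by blast

lemma chart_homeo: "c \<in> atlas M \<Longrightarrow>
    homeomorphic_map (subtopology (man_topology M) (fst c)) (top_of_set (chart_image c)) (snd c)"
  using smooth_manifold by (simp add: smooth_manifold_def)

lemma chart_inj: "c \<in> atlas M \<Longrightarrow> inj_on (snd c) (fst c)"
  using homeomorphic_imp_injective_map[OF chart_homeo, of c] chart_domain_subset[of c]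
  by (simp add: Int_absorb1)

lemma chart_inv_left: "c \<in> atlas M \<Longrightarrow> q \<in> fst c \<Longrightarrow> chart_inv c (snd c q) = q"
  by (simp add: chart_inv_def chart_inj)

lemma chart_inv_right: "u \<in> chart_image c \<Longrightarrow> snd c (chart_inv c u) = u"
  by (simp add: chart_inv_def chart_image_def f_inv_into_f)

lemma chart_inv_in: "u \<in> chart_image c \<Longrightarrow> chart_inv c u \<in> fst c"
  by (simp add: chart_inv_def chart_image_def inv_into_into)

lemma chart_inv_point: "c \<in> atlas M \<Longrightarrow> u \<in> chart_image c \<Longrightarrow> chart_inv c u \<in> points M"
  using chart_inv_in[of u c] chart_domain_subset[of c] by blast

lemma chart_at: "p \<in> points M \<Longrightarrow> chart_at M p \<in> atlas M" "p \<in> points M \<Longrightarrow> p \<in> fst (chart_at M p)"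
  using smooth_manifold by (auto simp: smooth_manifold_def)

lemma chart_at_image: "p \<in> points M \<Longrightarrow> snd (chart_at M p) p \<in> chart_image (chart_at M p)"
  using chart_at[of p] by (simp add: chart_image_def)

lemma chart_at_inv: "p \<in> points M \<Longrightarrow> chart_inv (chart_at M p) (snd (chart_at M p) p) = p"
  using chart_at[of p] chart_inv_left[of "chart_at M p" p] by simp

lemma chart_image_of_open:
  assumes "c \<in> atlas M" "openin (man_topology M) S"
  shows "open (snd c ` (fst c \<inter> S))"
proof -
  have "openin (subtopology (man_topology M) (fst c)) (fst c \<inter> S)"
    using assms openin_subtopology_Int2 by blast
  then have "openin (top_of_set (chart_image c)) (snd c ` (fst c \<inter> S))"
    using homeomorphic_imp_open_map[OF chart_homeo[OF assms(1)]] by (simp add: open_map_def)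
  then show ?thesis using chart_open[OF assms(1)] openin_open_trans by blast
qed

lemma overlap_open: "c \<in> atlas M \<Longrightarrow> c' \<in> atlas M \<Longrightarrow> open (snd c ` (fst c \<inter> fst c'))"
  using chart_image_of_open[OF _ chart_domain_open] by simp

lemma overlap_iff:
  "c \<in> atlas M \<Longrightarrow> u \<in> snd c ` (fst c \<inter> S) \<longleftrightarrow> u \<in> chart_image c \<and> chart_inv c u \<in> S"
proof
  assume "c \<in> atlas M" "u \<in> snd c ` (fst c \<inter> S)"
  then show "u \<in> chart_image c \<and> chart_inv c u \<in> S"
    using chart_inv_left[of c] by (auto simp: chart_image_def)
next
  assume "u \<in> chart_image c \<and> chart_inv c u \<in> S"
  then show "u \<in> snd c ` (fst c \<inter> S)"
    using chart_inv_right[of u c] chart_inv_in[of u c] by (metis IntI imageI)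
qed

lemma transition_smooth:
  "c \<in> atlas M \<Longrightarrow> c' \<in> atlas M \<Longrightarrow> smooth_on (snd c ` (fst c \<inter> fst c')) (transition c c')"
  using smooth_manifold by (simp add: smooth_manifold_def)

lemma transition_image: "c \<in> atlas M \<Longrightarrow> transition c c' ` (snd c ` (fst c \<inter> fst c')) \<subseteq> chart_image c'"
  using chart_inv_left[of c] by (auto simp: chart_image_def)

lemma transition_overlap:
  "c \<in> atlas M \<Longrightarrow> c' \<in> atlas M \<Longrightarrow> w \<in> snd c ` (fst c \<inter> fst c') \<Longrightarrow>
    transition c c' w \<in> snd c' ` (fst c' \<inter> fst c) \<and> chart_inv c' (transition c c' w) = chart_inv c w"
  using chart_inv_left[of c] chart_inv_left[of c'] by auto

text \<open>The frame at \<open>w\<close> refers to the chart preferred at the point itself, which changes with \<open>w\<close>.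
  This is no obstacle: by the chain rule through a fixed chart \<open>c'\<close>, coordinate expressions in \<open>c\<close> and
  \<open>c'\<close> differ by the derivative of the transition map only.\<close>

lemma frame_transition:
  assumes c: "c \<in> atlas M" "c' \<in> atlas M" and w: "w \<in> snd c ` (fst c \<inter> fst c')"
  shows "frame M c w x = frame M c' (transition c c' w) (frechet_derivative (transition c c') (at w) x)"
proof -
  define q where "q = chart_inv c w"
  define c'' where "c'' = chart_at M q"
  have q: "q \<in> fst c" "q \<in> fst c'" using w overlap_iff[OF c(1)] chart_inv_in[of w c] by (auto simp: q_def)
  have c'': "c'' \<in> atlas M" "q \<in> fst c''"
    using chart_at chart_domain_subset[OF c(1)] q unfolding c''_def by auto
  have q': "chart_inv c' (transition c c' w) = q"
    using transition_overlap[OF c w] by (simp add: q_def)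
  define W where "W = snd c ` (fst c \<inter> (fst c' \<inter> fst c''))"
  have W: "open W" "w \<in> W"
    using chart_image_of_open[OF c(1) openin_Int[OF chart_domain_open[OF c(2)] chart_domain_open[OF c''(1)]]]
      c'' w q overlap_iff[OF c(1)] unfolding W_def q_def by auto
  have "transition c c'' v = (transition c' c'' \<circ> transition c c') v" if "v \<in> W" for v
    using that c chart_inv_left[of c] chart_inv_left[of c'] unfolding W_def by auto
  then have "frechet_derivative (transition c c'') (at w) =
      frechet_derivative (transition c' c'' \<circ> transition c c') (at w)"
    by (rule frechet_derivative_cong_open[OF W])
  also have "\<dots> = frechet_derivative (transition c' c'') (at (transition c c' w)) \<circ>
      frechet_derivative (transition c c') (at w)"
  proof (rule frechet_derivative_compose)
    show "transition c c' differentiable at w"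
      by (rule smooth_on_imp_differentiable[OF transition_smooth[OF c] w])
    have "transition c c' w \<in> snd c' ` (fst c' \<inter> fst c'')"
      using transition_overlap[OF c w] q' c'' overlap_iff[OF c(2)] by auto
    then show "transition c' c'' differentiable at (transition c c' w)"
      by (rule smooth_on_imp_differentiable[OF transition_smooth[OF c(2) c''(1)]])
  qed
  finally show ?thesis
    unfolding frame_def q_def[symmetric] c''_def[symmetric] q' by (simp add: c''_def q_def o_def)
qed

lemma in_chart_transition:
  assumes c: "c \<in> atlas M" "c' \<in> atlas M" and w: "w \<in> snd c ` (fst c \<inter> fst c')"
  shows "in_chart M c T w ys =
    in_chart M c' T (transition c c' w) (map (frechet_derivative (transition c c') (at w)) ys)"
proof -
  have "frame M c w = (\<lambda>x. frame M c' (transition c c' w) (frechet_derivative (transition c c') (at w) x))"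
    by (rule ext) (rule frame_transition[OF c w])
  then have "map (frame M c w) ys =
      map (frame M c' (transition c c' w)) (map (frechet_derivative (transition c c') (at w)) ys)"
    by (simp only: map_map o_def)
  then show ?thesis using transition_overlap[OF c w] by (simp only: in_chart_def)
qed

lemma frame_chart_at:
  assumes p: "p \<in> points M"
  shows "frame M (chart_at M p) (snd (chart_at M p) p) x = x"
proof -
  let ?c = "chart_at M p"
  have "frechet_derivative (transition ?c ?c) (at (snd ?c p)) = frechet_derivative (\<lambda>x. x) (at (snd ?c p))"
    by (rule frechet_derivative_cong_open[OF chart_open[OF chart_at(1)[OF p]] chart_at_image[OF p]])
      (simp add: chart_inv_right)
  then show ?thesis by (simp add: frame_def chart_at_inv[OF p])
qed

lemma in_chart_at: "p \<in> points M \<Longrightarrow> in_chart M (chart_at M p) T (snd (chart_at M p) p) = T p"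
  by (auto simp: in_chart_def frame_chart_at chart_at_inv map_idI)

lemma frame_linear:
  assumes c: "c \<in> atlas M" and u: "u \<in> chart_image c"
  shows "linear (frame M c u)"
proof -
  have q: "chart_inv c u \<in> points M" using chart_inv_point[OF c u] .
  have "u \<in> snd c ` (fst c \<inter> fst (chart_at M (chart_inv c u)))"
    using overlap_iff[OF c] u chart_at[OF q] by simp
  then show ?thesis
    unfolding frame_def
    by (intro linear_frechet_derivative smooth_on_imp_differentiable[OF transition_smooth[OF c chart_at(1)[OF q]]])
qed

lemma transition_derivative:
  assumes c: "c \<in> atlas M" and u: "u \<in> chart_image c"
  defines "c' \<equiv> chart_at M (chart_inv c u)"
  shows "u \<in> snd c ` (fst c \<inter> fst c')" "transition c c' u = snd c' (chart_inv c u)"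
    "frechet_derivative (transition c c') (at u) = frame M c u"
  using overlap_iff[OF c] u chart_at[OF chart_inv_point[OF c u]] by (simp_all add: c'_def frame_def)

lemma frame_surj:
  assumes c: "c \<in> atlas M" and u: "u \<in> chart_image c"
  shows "surj (frame M c u)"
proof -
  define c' where "c' = chart_at M (chart_inv c u)"
  have q: "chart_inv c u \<in> points M" using chart_inv_point[OF c u] .
  have c': "c' \<in> atlas M" using chart_at(1)[OF q] by (simp add: c'_def)
  define u' where "u' = transition c c' u"
  have w: "u \<in> snd c ` (fst c \<inter> fst c')" using transition_derivative(1)[OF c u] by (simp add: c'_def)
  have u': "u' \<in> snd c' ` (fst c' \<inter> fst c)" "chart_inv c' u' = chart_inv c u"
    using transition_overlap[OF c c' w] by (auto simp: u'_def)
  have "transition c' c u' = u" using u'(2) chart_inv_right[OF u] by simp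
  then have "frame M c' u' x = frame M c u (frechet_derivative (transition c' c) (at u') x)" for x
    using frame_transition[OF c' c u'(1)] by simp
  moreover have "frame M c' u' x = x" for x
    using frame_chart_at[OF q, of x] by (simp add: u'_def c'_def)
  ultimately show ?thesis by (metis surjI)
qed

lemma frame_inj: "c \<in> atlas M \<Longrightarrow> u \<in> chart_image c \<Longrightarrow> inj (frame M c u)"
  using frame_linear frame_surj linear_surjective_imp_injective by blast

lemma tensor_field_local:
  assumes T: "tensor_field M k T" and c: "c \<in> atlas M"
  shows "local_tensor (chart_image c) k (in_chart M c T)"
proof
  show "open (chart_image c)" by (rule chart_open[OF c])
  show "multilinear k (in_chart M c T u)" if u: "u \<in> chart_image c" for u
  proof -
    have m: "multilinear k (T (chart_inv c u))"
      using T chart_inv_point[OF c u] by (simp add: tensor_field_def)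
    show ?thesis
      unfolding multilinear_def in_chart_def
      using linear_compose[OF frame_linear[OF c u] multilinear_linear[OF m]] multilinear_length[OF m]
      by (auto simp: map_update o_def)
  qed
  show "smooth_on (chart_image c) (\<lambda>u. in_chart M c T u xs)" if "length xs = k" for xs
    using T c that by (simp add: tensor_field_def)
qed

end

locale metric_manifold = manifold_charts M for M :: "('a, 'e::euclidean_space) manifold" +
  fixes g :: "'a \<Rightarrow> 'e tensor"
  assumes metric: "pseudo_riemannian M g"
begin

lemma tensor_field_g: "tensor_field M 2 g"
  using metric by (simp add: pseudo_riemannian_def symmetric2_field_def)

lemma symmetric_g: "p \<in> points M \<Longrightarrow> g p [x, y] = g p [y, x]"
  using metric by (simp add: pseudo_riemannian_def symmetric2_field_def symmetric2_def)

lemma bilinear_g: "p \<in> points M \<Longrightarrow> bilinear_form (\<lambda>x y. g p [x, y])"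
  using tensor_field_g unfolding tensor_field_def by (blast intro: multilinear2_bilinear_form)

lemma nondegenerate_g: "p \<in> points M \<Longrightarrow> nondegenerate (\<lambda>x y. g p [x, y])"
  using metric by (simp add: pseudo_riemannian_def nondegenerate_def)

lemma local_metric_g:
  assumes c: "c \<in> atlas M"
  shows "local_metric (chart_image c) (in_chart M c g)"
proof -
  interpret T: local_tensor "chart_image c" 2 "in_chart M c g"
    by (rule tensor_field_local[OF tensor_field_g c])
  show ?thesis
  proof
    show "open (chart_image c)" by (rule chart_open[OF c])
    fix u assume u: "u \<in> chart_image c"
    note q = chart_inv_point[OF c u]
    show "multilinear 2 (in_chart M c g u)" by (rule T.multilinear_T[OF u])
    show "in_chart M c g u [x, y] = in_chart M c g u [y, x]" for x y
      by (simp add: in_chart_def symmetric_g[OF q])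
    show "nondegenerate (\<lambda>x y. in_chart M c g u [x, y])"
      unfolding nondegenerate_def
    proof (intro allI impI)
      fix x assume "\<forall>y. in_chart M c g u [x, y] = 0"
      then have zero: "g (chart_inv c u) [frame M c u x, frame M c u y] = 0" for y
        by (simp add: in_chart_def)
      have "g (chart_inv c u) [frame M c u x, y] = 0" for y
      proof -
        obtain y' where "y = frame M c u y'" using frame_surj[OF c u] by (rule surjE)
        then show ?thesis using zero by simp
      qed
      then have "frame M c u x = frame M c u 0"
        using nondegenerate_g[OF q] linear_0[OF frame_linear[OF c u]] by (simp add: nondegenerate_def)
      then show "x = 0" by (rule injD[OF frame_inj[OF c u]])
    qed
  qed (use T.smooth_T in auto)
qed


abbreviation Chr :: "('a, 'e) chart \<Rightarrow> 'e \<Rightarrow> 'e \<Rightarrow> 'e \<Rightarrow> 'e" where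
  "Chr c \<equiv> christoffel (in_chart M c g)"

lemma nabla_local_nabla:
  "p \<in> points M \<Longrightarrow> nabla M g T p xs =
    local_nabla (Chr (chart_at M p)) (in_chart M (chart_at M p) T) (snd (chart_at M p) p) xs"
  by (simp add: nabla_def local_nabla_def levi_civita_christoffel Let_def split: list.split)

text \<open>The definition of \<open>nabla\<close> uses a different chart at every point. To differentiate once more one
  needs a formula valid in a whole neighbourhood, and this lemma provides it.\<close>

lemma in_chart_nabla:
  assumes T: "tensor_field M k T" and c: "c \<in> atlas M" and u: "u \<in> chart_image c"
  shows "in_chart M c (nabla M g T) u xs = local_nabla (Chr c) (in_chart M c T) u xs"
proof -
  define c' where "c' = chart_at M (chart_inv c u)"
  have q: "chart_inv c u \<in> points M" using chart_inv_point[OF c u] .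
  have c': "c' \<in> atlas M" using chart_at(1)[OF q] by (simp add: c'_def)
  let ?\<phi> = "transition c c'" and ?W = "snd c ` (fst c \<inter> fst c')"
  have W: "open ?W" "u \<in> ?W" and \<phi>: "smooth_on ?W ?\<phi>" "?\<phi> ` ?W \<subseteq> chart_image c'"
    using overlap_open[OF c c'] transition_derivative(1)[OF c u] transition_smooth[OF c c'] transition_image[OF c]
    by (simp_all add: c'_def)
  have F: "frechet_derivative ?\<phi> (at u) = frame M c u"
    using transition_derivative(3)[OF c u] by (simp add: c'_def)
  have sub: "local_metric ?W (in_chart M c g)"
    by (rule local_metric_subset[OF local_metric_g[OF c] W(1)]) (auto simp: chart_image_def)
  have "local_nabla (Chr c) (in_chart M c T) u xs =
      local_nabla (Chr c') (in_chart M c' T) (?\<phi> u) (map (frechet_derivative ?\<phi> (at u)) xs)"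
  proof (rule local_nabla_transform[OF W \<phi> tensor_field_local[OF T c']])
    show "in_chart M c T w ys = in_chart M c' T (?\<phi> w) (map (frechet_derivative ?\<phi> (at w)) ys)"
      if "w \<in> ?W" for w ys by (rule in_chart_transition[OF c c' that])
    show "frechet_derivative ?\<phi> (at u) (Chr c u x y) =
        frechet_derivative (\<lambda>w. frechet_derivative ?\<phi> (at w) y) (at u) x +
        Chr c' (?\<phi> u) (frechet_derivative ?\<phi> (at u) x) (frechet_derivative ?\<phi> (at u) y)" for x y
    proof (rule christoffel_transform[OF W \<phi> sub local_metric_g[OF c'] in_chart_transition[OF c c']])
      show "surj (frechet_derivative ?\<phi> (at u))" unfolding F by (rule frame_surj[OF c u])
    qed
  qed
  also have "\<dots> = nabla M g T (chart_inv c u) (map (frame M c u) xs)"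
    unfolding nabla_local_nabla[OF q] c'_def[symmetric] F by simp
  finally show ?thesis by (simp add: in_chart_def)
qed

lemma tensor_field_nabla:
  assumes T: "tensor_field M k T"
  shows "tensor_field M (Suc k) (nabla M g T)"
  unfolding tensor_field_def
proof (intro conjI ballI allI impI)
  fix p assume p: "p \<in> points M"
  let ?c = "chart_at M p"
  interpret G: local_metric "chart_image ?c" "in_chart M ?c g" by (rule local_metric_g[OF chart_at(1)[OF p]])
  interpret T: local_tensor "chart_image ?c" k "in_chart M ?c T" by (rule tensor_field_local[OF T chart_at(1)[OF p]])
  have "multilinear (Suc k) (local_nabla (Chr ?c) (in_chart M ?c T) (snd ?c p))"
    by (rule T.local_nabla_multilinear[OF chart_at_image[OF p]])
      (simp add: bilinear_def G.christoffel_bilinear chart_at_image[OF p])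
  moreover have "nabla M g T p = local_nabla (Chr ?c) (in_chart M ?c T) (snd ?c p)"
    by (rule ext) (rule nabla_local_nabla[OF p])
  ultimately show "multilinear (Suc k) (nabla M g T p)" by simp
next
  fix p xs assume "p \<notin> points M" then show "nabla M g T p xs = 0" by (simp add: nabla_def)
next
  fix c and xs :: "'e list" assume c: "c \<in> atlas M" and "length xs = Suc k"
  then obtain x ys where xs: "xs = x # ys" "length ys = k" by (cases xs) auto
  interpret G: local_metric "chart_image c" "in_chart M c g" by (rule local_metric_g[OF c])
  interpret T: local_tensor "chart_image c" k "in_chart M c T" by (rule tensor_field_local[OF T c])
  have "smooth_on (chart_image c) (\<lambda>u. local_nabla (Chr c) (in_chart M c T) u xs)"
    unfolding xs(1) by (rule T.local_nabla_smooth[OF G.christoffel_smooth xs(2)])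
  then show "smooth_on (chart_image c) (\<lambda>u. in_chart M c (nabla M g T) u xs)"
    by (rule smooth_on_cong[OF chart_open[OF c], rotated]) (simp add: in_chart_nabla[OF T c])
qed

lemma curvature_local:
  assumes p: "p \<in> points M"
  shows "curvature M g p x y z = local_curvature (Chr (chart_at M p)) (snd (chart_at M p) p) x y z"
proof -
  interpret G: local_metric "chart_image (chart_at M p)" "in_chart M (chart_at M p) g"
    by (rule local_metric_g[OF chart_at(1)[OF p]])
  have "Chr (chart_at M p) (snd (chart_at M p) p) 0 z = 0"
    using linear_0[OF G.christoffel_bilinear(2)[OF chart_at_image[OF p]]] .
  moreover have "nabla_vec M g (chart_at M p) (\<lambda>_. a) (\<lambda>_. z) = (\<lambda>w. Chr (chart_at M p) w a z)" for a
    by (rule ext) (simp add: nabla_vec_def levi_civita_christoffel)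
  ultimately show ?thesis
    by (simp add: curvature_def nabla_vec_def[of M g "chart_at M p" _ "\<lambda>w. Chr (chart_at M p) w _ z"]
        nabla_vec_def[of M g "chart_at M p" "lie_bracket _ _"] lie_bracket_def
        local_curvature_def levi_civita_christoffel Let_def)
qed

lemma nabla_nabla_local:
  assumes T: "tensor_field M k T" and p: "p \<in> points M"
  defines "c \<equiv> chart_at M p"
  shows "nabla M g (nabla M g T) p xs =
    local_nabla (Chr c) (local_nabla (Chr c) (in_chart M c T)) (snd c p) xs"
  unfolding nabla_local_nabla[OF p] c_def
  by (rule local_nabla_cong[OF chart_open[OF chart_at(1)[OF p]] chart_at_image[OF p]])
    (rule ext, rule in_chart_nabla[OF T chart_at(1)[OF p]])

theorem ricci_identity:
  assumes T: "tensor_field M k T" and p: "p \<in> points M" and zs: "length zs = k"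
  shows "nabla M g (nabla M g T) p (x # y # zs) - nabla M g (nabla M g T) p (y # x # zs) =
    act (curvature M g p x y) (T p) zs"
proof -
  let ?c = "chart_at M p"
  interpret G: local_metric "chart_image ?c" "in_chart M ?c g" by (rule local_metric_g[OF chart_at(1)[OF p]])
  interpret T: local_tensor "chart_image ?c" k "in_chart M ?c T" by (rule tensor_field_local[OF T chart_at(1)[OF p]])
  have "curvature M g p x y = local_curvature (Chr ?c) (snd ?c p) x y"
    by (rule ext) (rule curvature_local[OF p])
  then show ?thesis
    unfolding nabla_nabla_local[OF T p]
    using local_ricci_identity[where \<Gamma> = "Chr ?c", OF T.open_U chart_at_image[OF p] T.multilinear_T T.smooth_T G.christoffel_smooth
        G.christoffel_symmetric[OF chart_at_image[OF p]] zs]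
    by (simp add: in_chart_at[OF p])
qed

lemma nabla_g: "p \<in> points M \<Longrightarrow> nabla M g g p [x, y, z] = 0"
  using local_metric.local_nabla_metric[OF local_metric_g[OF chart_at(1)] chart_at_image]
  by (simp add: nabla_local_nabla)

end

section \<open>Algebra of symmetrized curvature tensors\<close>

lemma all_length2: "(\<forall>xs. length xs = 2 \<longrightarrow> P xs) \<longleftrightarrow> (\<forall>a b. P [a, b])"
  by (auto simp: numeral_2_eq_2 length_Suc_conv)

lemma all_length3: "(\<forall>xs. length xs = 3 \<longrightarrow> P xs) \<longleftrightarrow> (\<forall>a b c. P [a, b, c])"
  by (auto simp: numeral_3_eq_3 length_Suc_conv)

lemma all_length4: "(\<forall>xs. length xs = 4 \<longrightarrow> P xs) \<longleftrightarrow> (\<forall>a b c d. P [a, b, c, d])"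
  by (auto simp: eval_nat_numeral length_Suc_conv)

lemma multilinear2I:
  assumes "\<And>x. linear (\<lambda>v. \<gamma> [v, x])" "\<And>x. linear (\<lambda>v. \<gamma> [x, v])"
    and zero: "\<And>xs. length xs \<noteq> 2 \<Longrightarrow> \<gamma> xs = 0"
  shows "multilinear 2 \<gamma>"
proof -
  have "linear (\<lambda>v. \<gamma> ([x, y][i := v]))" if "i < 2" for x y i
    using less_2_cases[OF that] assms by auto
  then have "\<forall>xs. length xs = 2 \<longrightarrow> (\<forall>i<2. linear (\<lambda>v. \<gamma> (xs[i := v])))"
    unfolding all_length2 by blast
  then show ?thesis using zero unfolding multilinear_def by blast
qed

lemma multilinear4I:
  assumes "\<And>x y z. linear (\<lambda>v. \<gamma> [v, x, y, z])" "\<And>x y z. linear (\<lambda>v. \<gamma> [x, v, y, z])"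
    "\<And>x y z. linear (\<lambda>v. \<gamma> [x, y, v, z])" "\<And>x y z. linear (\<lambda>v. \<gamma> [x, y, z, v])"
    and zero: "\<And>xs. length xs \<noteq> 4 \<Longrightarrow> \<gamma> xs = 0"
  shows "multilinear 4 \<gamma>"
proof -
  have "linear (\<lambda>v. \<gamma> ([x, y, z, w][i := v]))" if "i < 4" for x y z w i
    using that assms by (auto simp: less_Suc_eq eval_nat_numeral)
  then have "\<forall>xs. length xs = 4 \<longrightarrow> (\<forall>i<4. linear (\<lambda>v. \<gamma> (xs[i := v])))"
    unfolding all_length4 by blast
  then show ?thesis using zero unfolding multilinear_def by blast
qed

lemma multilinear4D:
  assumes "multilinear 4 \<gamma>"
  shows "linear (\<lambda>v. \<gamma> [v, x, y, z])" "linear (\<lambda>v. \<gamma> [x, v, y, z])"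
    "linear (\<lambda>v. \<gamma> [x, y, v, z])" "linear (\<lambda>v. \<gamma> [x, y, z, v])"
  using multilinear_linear[OF assms, of "[_, x, y, z]" 0] multilinear_linear[OF assms, of "[x, _, y, z]" 1]
    multilinear_linear[OF assms, of "[x, y, _, z]" 2] multilinear_linear[OF assms, of "[x, y, z, _]" 3]
  by (simp_all add: numeral_2_eq_2 numeral_3_eq_3)

lemma multilinear3D:
  assumes "multilinear 3 \<gamma>"
  shows "linear (\<lambda>v. \<gamma> [v, x, y])" "linear (\<lambda>v. \<gamma> [x, v, y])" "linear (\<lambda>v. \<gamma> [x, y, v])"
  using multilinear_linear[OF assms, of "[_, x, y]" 0] multilinear_linear[OF assms, of "[x, _, y]" 1]
    multilinear_linear[OF assms, of "[x, y, _]" 2]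
  by (simp_all add: numeral_2_eq_2)

lemma multilinear2D:
  assumes "multilinear 2 \<gamma>"
  shows "linear (\<lambda>v. \<gamma> [v, x])" "linear (\<lambda>v. \<gamma> [x, v])"
  using multilinear_linear[OF assms, of "[_, x]" 0] multilinear_linear[OF assms, of "[x, _]" 1]
  by simp_all

lemmas multilinear_distrib4 = multilinear4D[THEN linear_add] multilinear4D[THEN linear_diff]
  multilinear4D[THEN linear_scale]
lemmas multilinear_distrib3 = multilinear3D[THEN linear_add] multilinear3D[THEN linear_diff]
  multilinear3D[THEN linear_scale]
lemmas multilinear_distrib2 = multilinear2D[THEN linear_add] multilinear2D[THEN linear_diff]
  multilinear2D[THEN linear_scale]

text \<open>The polarized form of the defining identities, which is what survives differentiation.\<close>

definition curvature_symmetries :: "('v \<Rightarrow> 'v \<Rightarrow> 'v \<Rightarrow> 'v \<Rightarrow> real) \<Rightarrow> bool" where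
  "curvature_symmetries f \<longleftrightarrow> (\<forall>x y z w. f x y z w = f y x z w \<and> f x y z w = f x y w z \<and>
     f x y z w = f z w x y \<and> f x y z w + f y z x w + f z x y w = 0)"

lemma curvature_symmetriesD:
  assumes "curvature_symmetries f"
  shows "f x y z w = f y x z w" "f x y z w = f x y w z" "f x y z w = f z w x y"
    "f x y z w + f y z x w + f z x y w = 0"
  using assms unfolding curvature_symmetries_def by blast+

text \<open>Exchange of pairs follows from the cyclic identity by the usual alternating sum of its four
  instances on the faces of an octahedron.\<close>

lemma curvature_symmetriesI:
  assumes s: "\<And>x y z w. f x y z w = f y x z w" "\<And>x y z w. f x y z w = f x y w z"
    and cyc: "\<And>x y z w. f x y z w + f y z x w + f z x y w = 0"
  shows "curvature_symmetries f"
proof -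
  have "f x y z w = f z w x y" for x y z w
    using cyc[of x y z w] cyc[of w x y z] cyc[of z w x y] cyc[of y z w x] by (simp add: s)
  then show ?thesis unfolding curvature_symmetries_def using assms by blast
qed

lemma curvature_symmetriesI':
  assumes s: "\<And>x y z w. f x y z w = f y x z w" "\<And>x y z w. f x y z w = f x y w z"
    and cyc: "\<And>x y z w. f x y z w + f x z w y + f x w y z = 0"
  shows "curvature_symmetries f"
proof -
  have pair: "f x y z w = f z w x y" for x y z w
    using cyc[of x y z w] cyc[of y z w x] cyc[of z w x y] cyc[of w x y z] by (simp add: s)
  have "f x y z w + f y z x w + f z x y w = 0" for x y z w
  proof -
    have "f x y z w = f w z x y" "f y z x w = f w x y z" "f z x y w = f w y z x"
      using s(1)[of z w x y] s(1)[of x w y z] s(1)[of y w z x]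
        pair[of x y z w] pair[of y z x w] pair[of z x y w] by simp_all
    then show ?thesis using cyc[of w x y z] by simp
  qed
  then show ?thesis by (intro curvature_symmetriesI s)
qed

text \<open>The cyclic identity is the polarization of the cubic equation \<open>\<gamma>(u, u, u, v) = 0\<close>.\<close>

lemma sym_curvature_like_symmetries:
  fixes \<gamma> :: "'v::real_vector tensor"
  assumes "multilinear 4 \<gamma>" "sym_curvature_like \<gamma>"
  shows "curvature_symmetries (\<lambda>x y z w. \<gamma> [x, y, z, w])"
proof (rule curvature_symmetriesI)
  note add = multilinear4D[OF assms(1), THEN linear_add]
  show s: "\<gamma> [x, y, z, w] = \<gamma> [y, x, z, w]" "\<gamma> [x, y, z, w] = \<gamma> [x, y, w, z]" for x y z w
    using assms(2) by (auto simp: sym_curvature_like_def)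
  have d: "\<gamma> [u, u, u, v] = 0" for u v using assms(2) by (simp add: sym_curvature_like_def)
  show "\<gamma> [x, y, z, w] + \<gamma> [y, z, x, w] + \<gamma> [z, x, y, w] = 0" for x y z w
    using d[of "x + y + z" w] d[of "x + y" w] d[of "y + z" w] d[of "x + z" w] d[of x w] d[of y w] d[of z w]
      s(1)[of y x z w] s(1)[of z y x w] s(1)[of z x y w]
      s(1)[of y x x w] s(1)[of z x x w] s(1)[of y x y w] s(1)[of z y y w] s(1)[of z x z w] s(1)[of z y z w]
    by (simp add: add)
qed

lemma symmetries_sym_curvature_like:
  assumes "curvature_symmetries (\<lambda>x y z w. \<gamma> [x, y, z, w])"
  shows "sym_curvature_like \<gamma>"
proof -
  note D = curvature_symmetriesD[OF assms]
  have "\<gamma> [u, u, u, v] = 0" for u v using D(4)[of u u u v] by simp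
  then show ?thesis unfolding sym_curvature_like_def using D(1,2) by blast
qed

text \<open>\<open>P\<^sub>2\<^sub>,\<^sub>2\<close> is normalized to be a projector.\<close>

lemma P22_curvature:
  assumes "curvature_symmetries f"
  shows "P22 f [x, y, z, w] = f x y z w"
  using curvature_symmetriesD(4)[OF assms, of x y z w]
    curvature_symmetriesD(1)[OF assms] curvature_symmetriesD(2)[OF assms] curvature_symmetriesD(3)[OF assms]
  by (simp add: P22_def S22_def alternate_odd_even_def)

text \<open>Exchange of the first two arguments and exchange of pairs in the last four generate all
  permutations, so \<open>F\<close> is totally symmetric and the cyclic identity reads \<open>3 F = 0\<close>.\<close>

lemma curvature_symmetric_derivative_zero:
  assumes F: "\<And>y. curvature_symmetries (F y)" and s: "\<And>y x a b c. F y x a b c = F x y a b c"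
  shows "F y x a b c = 0"
proof -
  note D = curvature_symmetriesD[OF F]
  have swap: "F y x a b c = F y x b a c" for y x a b c
  proof -
    have "F y x a b c = F y a x b c" by (rule D(1))
    also have "\<dots> = F a y x b c" by (rule s)
    also have "\<dots> = F a b c y x" by (rule D(3))
    also have "\<dots> = F b a c y x" by (rule s)
    also have "\<dots> = F b y x a c" by (rule D(3))
    also have "\<dots> = F y b x a c" by (rule s)
    also have "\<dots> = F y x b a c" by (rule D(1))
    finally show ?thesis .
  qed
  have "F y a b x c = F y x a b c"
    using swap[of y a b x c] D(1)[of y a x b c] by simp
  moreover have "F y b x a c = F y x a b c"
    using swap[of y x a b c] D(1)[of y b x a c] by simp
  ultimately show ?thesis using D(4)[of y x a b c] by simp
qed

text \<open>The Young symmetries of \<open>\<nabla>\<kappa>\<close> for a Killing tensor \<open>\<kappa>\<close>, in polarized form.\<close>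

definition hook_symmetries :: "('v \<Rightarrow> 'v \<Rightarrow> 'v \<Rightarrow> real) \<Rightarrow> bool" where
  "hook_symmetries f \<longleftrightarrow> (\<forall>x y z. f x y z = f x z y \<and> f x y z + f y z x + f z x y = 0)"

lemma hook_symmetriesD:
  assumes "hook_symmetries f"
  shows "f x y z = f x z y" "f x y z + f y z x + f z x y = 0"
  using assms unfolding hook_symmetries_def by blast+

lemma killing_hook:
  fixes \<beta> :: "'v::real_vector tensor"
  assumes m: "multilinear 3 \<beta>" and s: "\<And>x y z. \<beta> [x, y, z] = \<beta> [x, z, y]" and d: "\<And>x. \<beta> [x, x, x] = 0"
  shows "hook_symmetries (\<lambda>x y z. \<beta> [x, y, z])"
  unfolding hook_symmetries_def
proof (intro allI conjI)
  fix x y z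
  show "\<beta> [x, y, z] = \<beta> [x, z, y]" by (rule s)
  show "\<beta> [x, y, z] + \<beta> [y, z, x] + \<beta> [z, x, y] = 0"
    using d[of "x + y + z"] d[of "x + y"] d[of "y + z"] d[of "x + z"] d[of x] d[of y] d[of z]
      s[of x z y] s[of y z x] s[of z y x] s[of x y x] s[of x z x] s[of y y x] s[of y z y] s[of z z x] s[of z z y]
    by (simp add: multilinear3D[OF m, THEN linear_add])
qed

lemma P21_hook:
  assumes "hook_symmetries f"
  shows "P21 f [x, y, z] = f x y z"
  using hook_symmetriesD(2)[OF assms, of x y z] hook_symmetriesD(1)[OF assms, of x z y]
    hook_symmetriesD(1)[OF assms, of y z x] hook_symmetriesD(1)[OF assms, of z y x]
  by (simp add: P21_def S21_def)

text \<open>On tensors with hook symmetries the product \<open>\<beta> \<odot> \<lambda>\<close> needs no symmetrization. In this form it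
  arises on the cone, where \<open>\<lambda>\<close> moves one argument into the radial direction.\<close>

lemma odot31_hook:
  assumes "hook_symmetries (\<lambda>x y z. \<beta> [x, y, z])"
  shows "odot31 \<beta> l [x, y, z, w] =
    l x * \<beta> [y, z, w] + l y * \<beta> [x, z, w] + l z * \<beta> [w, x, y] + l w * \<beta> [z, x, y]"
proof -
  note s = hook_symmetriesD(1)[OF assms] and c = hook_symmetriesD(2)[OF assms]
  have "l x * (\<beta> [y, z, w] + \<beta> [z, w, y] + \<beta> [w, y, z]) = 0"
    "l y * (\<beta> [x, z, w] + \<beta> [z, w, x] + \<beta> [w, x, z]) = 0"
    "l z * (\<beta> [w, x, y] + \<beta> [x, y, w] + \<beta> [y, w, x]) = 0"
    "l w * (\<beta> [z, x, y] + \<beta> [x, y, z] + \<beta> [y, z, x]) = 0"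
    by (simp_all only: c mult_zero_right)
  then have "3 * odot31 \<beta> l [x, y, z, w] =
      3 * (l x * \<beta> [y, z, w] + l y * \<beta> [x, z, w] + l z * \<beta> [w, x, y] + l w * \<beta> [z, x, y])"
    using s[of y z w] s[of z w y] s[of w y z] s[of x z w] s[of z w x] s[of w x z] s[of x y w] s[of y w x]
      s[of z x y] s[of x y z] s[of y z x] s[of w x y]
    by (simp add: odot31_def S22_def alternate_odd_even_def distrib_left)
  then show ?thesis by simp
qed

lemma odot31_symmetries:
  assumes "hook_symmetries (\<lambda>x y z. \<beta> [x, y, z])"
  shows "curvature_symmetries (\<lambda>x y z w. odot31 \<beta> l [x, y, z, w])"
proof (rule curvature_symmetriesI)
  note s = hook_symmetriesD(1)[OF assms] and c = hook_symmetriesD(2)[OF assms]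
  show "odot31 \<beta> l [x, y, z, w] = odot31 \<beta> l [y, x, z, w]" for x y z w
    unfolding odot31_hook[OF assms] using s[of w x y] s[of z x y] by simp
  show "odot31 \<beta> l [x, y, z, w] = odot31 \<beta> l [x, y, w, z]" for x y z w
    unfolding odot31_hook[OF assms] using s[of y z w] s[of x z w] by simp
  show "odot31 \<beta> l [x, y, z, w] + odot31 \<beta> l [y, z, x, w] + odot31 \<beta> l [z, x, y, w] = 0" for x y z w
  proof -
    have "l x * (\<beta> [y, z, w] + \<beta> [z, w, y] + \<beta> [w, y, z]) = 0"
      "l y * (\<beta> [x, z, w] + \<beta> [z, w, x] + \<beta> [w, x, z]) = 0"
      "l z * (\<beta> [w, x, y] + \<beta> [x, y, w] + \<beta> [y, w, x]) = 0"
      "l w * (\<beta> [z, x, y] + \<beta> [x, y, z] + \<beta> [y, z, x]) = 0"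
      by (simp_all only: c mult_zero_right)
    then show ?thesis
      unfolding odot31_hook[OF assms]
      using s[of y z w] s[of z w y] s[of w y z] s[of x z w] s[of z w x] s[of w x z] s[of x y w] s[of y w x]
        s[of z x y] s[of x y z] s[of y z x] s[of w x y]
      by (simp add: distrib_left)
  qed
qed

text \<open>This is why \<open>\<kappa> \<odot> g\<close> is the right correction of \<open>\<kappa>\<^sup>2\<close> in the definition of \<open>C\<^sup>\<kappa>\<close>.\<close>

lemma P22_odot21:
  assumes "\<And>x y. \<kappa> [x, y] = \<kappa> [y, x]" "\<And>x y. g [x, y] = g [y, x]"
  shows "P22 (\<lambda>x y z w. 2 * odot21 \<kappa> (\<lambda>v. g [x, v]) [y, z, w]) [x, y, z, w] = odot22 \<kappa> g [x, y, z, w]"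
  by (simp add: P22_def odot22_def S22_def alternate_odd_even_def odot21_def assms algebra_simps)

lemma P22_diff: "P22 (\<lambda>x y z w. f x y z w - h x y z w) xs = P22 f xs - P22 h xs"
  by (simp add: P22_def S22_def alternate_odd_even_def algebra_simps split: list.split)

section \<open>Nullity at a point\<close>

locale pointwise_metric =
  fixes B :: "'v::euclidean_space \<Rightarrow> 'v \<Rightarrow> real"
  assumes bil: "bilinear_form B" and sym: "\<And>x y. B x y = B y x" and nondeg: "nondegenerate B"
begin

text \<open>The endomorphism \<open>x \<and> y\<close>.\<close>

definition W :: "'v \<Rightarrow> 'v \<Rightarrow> 'v \<Rightarrow> 'v" where
  "W x y z = B x z *\<^sub>R y - B y z *\<^sub>R x"

text \<open>\<open>(\<beta>(y, \<cdot>, \<cdot>) \<odot> x\<^sup>\<sharp>)(a, b, c)\<close>, written out.\<close>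

definition Theta :: "'v tensor \<Rightarrow> 'v \<Rightarrow> 'v \<Rightarrow> 'v \<Rightarrow> 'v \<Rightarrow> 'v \<Rightarrow> real" where
  "Theta \<beta> x y a b c = B x a * \<beta> [y, b, c] - 1/2 * B x b * \<beta> [y, a, c] - 1/2 * B x c * \<beta> [y, a, b]"

text \<open>\<open>curv_on \<beta> y x a b c\<close> is the value at \<open>(a, b, c)\<close> that the two equations of the prolonged
  system impose on \<open>R\<^sub>y\<^sub>,\<^sub>x \<cdot> \<beta>\<close>.\<close>

definition curv_on :: "'v tensor \<Rightarrow> 'v \<Rightarrow> 'v \<Rightarrow> 'v \<Rightarrow> 'v \<Rightarrow> 'v \<Rightarrow> real" where
  "curv_on \<beta> y x a b c = - odot31 \<beta> (B y) [x, a, b, c] + odot31 \<beta> (B x) [y, a, b, c]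
     - 2 * Theta \<beta> x y a b c + 2 * Theta \<beta> y x a b c"

text \<open>Three times the totally symmetric part, if \<open>\<beta>\<close> is symmetric in its last two arguments.\<close>

definition total :: "'v tensor \<Rightarrow> 'v \<Rightarrow> 'v \<Rightarrow> 'v \<Rightarrow> real" where
  "total \<beta> x y z = \<beta> [x, y, z] + \<beta> [y, z, x] + \<beta> [z, x, y]"

text \<open>The obstruction to \<open>y\<^sup>\<sharp> \<otimes> t(x, \<cdot>, \<cdot>)\<close> being symmetric in \<open>x\<close> and \<open>y\<close>.\<close>

definition skew_part :: "('v \<Rightarrow> 'v \<Rightarrow> 'v \<Rightarrow> real) \<Rightarrow> 'v \<Rightarrow> 'v \<Rightarrow> 'v \<Rightarrow> 'v \<Rightarrow> 'v \<Rightarrow> real" where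
  "skew_part t y x a b c = B y a * t x b c - B x a * t y b c"

text \<open>For a Killing tensor, where \<open>total \<beta>\<close> vanishes, this value is \<open>- (y \<and> x) \<cdot> \<beta>\<close>; in general
  there is a correction by the totally symmetric part.\<close>

lemma curv_on_defect:
  assumes m: "multilinear 3 \<beta>" and s: "\<And>x y z. \<beta> [x, y, z] = \<beta> [x, z, y]"
  shows "3 * (curv_on \<beta> y x a b c + act (W y x) \<beta> [a, b, c]) =
    skew_part (total \<beta>) y x a b c - 2 * skew_part (total \<beta>) y x b a c - 2 * skew_part (total \<beta>) y x c a b"
proof -
  have "act (W y x) \<beta> [a, b, c] =
    - (B y a * \<beta> [x, b, c] - B x a * \<beta> [y, b, c] + B y b * \<beta> [a, x, c] - B x b * \<beta> [a, y, c]
       + B y c * \<beta> [a, b, x] - B x c * \<beta> [a, b, y])"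
    by (simp add: act_def W_def multilinear_distrib3[OF m] numeral_3_eq_3)
  then show ?thesis
    by (simp add: curv_on_def Theta_def odot31_def S22_def alternate_odd_even_def total_def skew_part_def
        s sym algebra_simps)
qed

lemma curv_on_killing:
  assumes "multilinear 3 \<beta>" "hook_symmetries (\<lambda>x y z. \<beta> [x, y, z])"
  shows "curv_on \<beta> y x a b c = - act (W y x) \<beta> [a, b, c]"
proof -
  have "total \<beta> x y z = 0" for x y z using hook_symmetriesD(2)[OF assms(2)] by (simp add: total_def)
  then show ?thesis
    using curv_on_defect[OF assms(1) hook_symmetriesD(1)[OF assms(2)], of y x a b c]
    by (simp add: skew_part_def)
qed

lemma raise_index:
  assumes "multilinear 2 \<kappa>"
  obtains K where "linear K" "\<And>x y. B (K x) y = \<kappa> [x, y]"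
proof -
  have "\<exists>v. \<forall>y. B v y = \<kappa> [x, y]" for x
    using nondegenerate_represent[OF bil nondeg multilinear2D(2)[OF assms]] .
  then obtain K where K: "\<And>x y. B (K x) y = \<kappa> [x, y]" by metis
  have "linear K"
    by (rule linearI; rule nondegenerate_eqI[OF bil nondeg];
        simp add: K bilinear_formD[OF bil] multilinear_distrib2[OF assms])
  then show ?thesis using K that by blast
qed

text \<open>By nondegeneracy \<open>t(K x) x = t(x) K x\<close>. Polarizing this at some \<open>x1\<close> with \<open>t(x1) = 1\<close> gives
  \<open>K y = \<mu> y + s x1\<close> with \<open>\<mu>\<close> independent of \<open>y\<close>, and the equation for \<open>y\<close> itself gives \<open>s = 0\<close> unless
  \<open>y\<close> is a multiple of \<open>x1\<close>.\<close>

lemma proportional_imp_scalar: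
  assumes K: "linear K" and t: "linear t" and t0: "t x0 \<noteq> (0::real)"
    and par: "\<And>x a. B x a * t (K x) = B (K x) a * t x"
  shows "\<exists>\<mu>. \<forall>x. K x = \<mu> *\<^sub>R x"
proof -
  have p: "t (K x) *\<^sub>R x = t x *\<^sub>R K x" for x
    by (rule nondegenerate_eqI[OF bil nondeg]) (use par in \<open>simp add: bilinear_formD[OF bil] mult.commute\<close>)
  define x1 where "x1 = (1 / t x0) *\<^sub>R x0"
  have t1: "t x1 = 1" using t0 by (simp add: x1_def linear_scale[OF t])
  define \<mu> where "\<mu> = t (K x1)"
  have K1: "K x1 = \<mu> *\<^sub>R x1" using p[of x1] by (simp add: t1 \<mu>_def)
  have "K y = \<mu> *\<^sub>R y" for y
  proof -
    have "t (K x1) *\<^sub>R y + t (K y) *\<^sub>R x1 = t x1 *\<^sub>R K y + t y *\<^sub>R K x1"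
      using p[of "x1 + y"] p[of x1] p[of y]
      by (simp add: linear_add[OF K] linear_add[OF t] scaleR_add_left scaleR_add_right)
        (simp add: add.commute)
    then have "\<mu> *\<^sub>R y + t (K y) *\<^sub>R x1 = K y + t y *\<^sub>R \<mu> *\<^sub>R x1"
      unfolding \<mu>_def[symmetric] t1 unfolding K1 by simp
    then have Ky: "K y = \<mu> *\<^sub>R y + (t (K y) - \<mu> * t y) *\<^sub>R x1"
      by (simp add: algebra_simps)
    define s where "s = t (K y) - \<mu> * t y"
    have "(\<mu> * t y + s) *\<^sub>R y = t y *\<^sub>R (\<mu> *\<^sub>R y + s *\<^sub>R x1)"
      using p[of y] Ky unfolding s_def by (metis add.commute diff_add_cancel)
    then have "s *\<^sub>R (y - t y *\<^sub>R x1) = 0" by (simp add: algebra_simps)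
    then consider "s = 0" | "y = t y *\<^sub>R x1" by auto
    then show ?thesis
    proof cases
      case 1 then show ?thesis using Ky by (simp add: s_def)
    next
      case 2 then show ?thesis using linear_scale[OF K, of "t y" x1] K1 by (metis scaleR_left_commute)
    qed
  qed
  then show ?thesis by blast
qed

text \<open>The hypothesis \<open>null\<close> means that \<open>K\<close> can be moved between the last two arguments of \<open>R + \<and>\<close>.
  By exchange of pairs it can be moved between the first two, and as \<open>R + \<and>\<close> is skew in these, it
  vanishes on \<open>(K x, x)\<close>.\<close>

lemma curvature_on_raised:
  assumes K: "\<And>x y. B (K x) y = \<kappa> [x, y]" and \<kappa>: "\<And>x y. \<kappa> [x, y] = \<kappa> [y, x]"
    and skew: "\<And>x y z w. B (R x y z) w = - B (R x y w) z"
    and pair: "\<And>x y z w. B (R x y z) w = B (R z w x) y"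
    and null: "\<And>x y a b. act (R x y) \<kappa> [a, b] = - act (W x y) \<kappa> [a, b]"
  shows "R (K x) x z = - W (K x) x z"
proof -
  define e where "e x y a b = B (R x y a) b + B (W x y a) b" for x y a b
  note b = bilinear_formD[OF bil]
  have W_skew: "B (W x y a) b = - B (W x y b) a" for x y a b by (simp add: W_def b)
  have W_pair: "B (W x y a) b = B (W a b x) y" for x y a b by (simp add: W_def b sym algebra_simps)
  have e_skew: "e x y a b = - e x y b a" for x y a b
    using skew[of x y a b] W_skew[of x y a b] by (simp add: e_def)
  have e_pair: "e x y a b = e a b x y" for x y a b
    using pair[of x y a b] W_pair[of x y a b] by (simp add: e_def)
  have val: "\<kappa> [v, b] = B v (K b)" for v b using K[of b v] \<kappa>[of b v] sym[of "K b" v] by simp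
  have "e x y a (K b') + e x y b' (K a) = 0" for x y a b'
    using null[of x y a b'] \<kappa>[of a "R x y b'"] \<kappa>[of a "W x y b'"]
    by (simp add: act_def e_def val numeral_2_eq_2)
  from this[of z w x x for z w] have "e z w x (K x) = 0" for z w by simp
  then have "e (K x) x z w = 0" for w
    using e_pair[of "K x" x z w] e_skew[of z w "K x" x] by simp
  then have "B (R (K x) x z) w = B (- W (K x) x z) w" for w
    by (simp add: e_def b eq_neg_iff_add_eq_0)
  then show ?thesis by (rule nondegenerate_eqI[OF bil nondeg])
qed

text \<open>On the pairs \<open>(K x, x)\<close> the action of \<open>R\<close> on \<open>\<beta>\<close> is that of \<open>- K x \<and> x\<close>, so the correction in
  \<open>curv_on_defect\<close> must vanish there. Hence, unless \<open>\<kappa>\<close> is a multiple of the metric at the point,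
  the totally symmetric part of \<open>\<nabla>\<kappa>\<close> vanishes there.\<close>

lemma total_nonzero_imp_scalar:
  assumes \<kappa>: "multilinear 2 \<kappa>" "\<And>x y. \<kappa> [x, y] = \<kappa> [y, x]"
    and \<beta>: "multilinear 3 \<beta>" "\<And>x y z. \<beta> [x, y, z] = \<beta> [x, z, y]"
    and skew: "\<And>x y z w. B (R x y z) w = - B (R x y w) z"
    and pair: "\<And>x y z w. B (R x y z) w = B (R z w x) y"
    and null: "\<And>x y a b. act (R x y) \<kappa> [a, b] = - act (W x y) \<kappa> [a, b]"
    and curv: "\<And>y x a b c. act (R y x) \<beta> [a, b, c] = curv_on \<beta> y x a b c"
    and nz: "total \<beta> x0 b0 c0 \<noteq> 0"
  shows "\<exists>\<mu>. \<forall>x y. \<kappa> [x, y] = \<mu> * B x y"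
proof -
  obtain K where K: "linear K" "\<And>x y. B (K x) y = \<kappa> [x, y]" using raise_index[OF \<kappa>(1)] by blast
  have sk: "skew_part (total \<beta>) (K x) x a b c = 0" for x a b c
  proof -
    have "R (K x) x = (\<lambda>z. - W (K x) x z)"
      using curvature_on_raised[OF K(2) \<kappa>(2) skew pair null] by blast
    then have "act (R (K x) x) \<beta> [a, b, c] = - act (W (K x) x) \<beta> [a, b, c]" for a b c
      by (simp add: act_def numeral_3_eq_3 multilinear3D[OF \<beta>(1), THEN linear_neg])
    then have d: "skew_part (total \<beta>) (K x) x a b c - 2 * skew_part (total \<beta>) (K x) x b a c
        - 2 * skew_part (total \<beta>) (K x) x c a b = 0" for a b c
      using curv_on_defect[OF \<beta>, of "K x" x a b c] curv[of "K x" x a b c] by simp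
    have "skew_part (total \<beta>) y x a b c = skew_part (total \<beta>) y x a c b" for y x a b c
      by (simp add: skew_part_def total_def \<beta>(2) add_ac)
    \<comment> \<open>summing \<open>d\<close> cyclically shows that the cyclic sum of \<open>skew_part\<close> is zero, and then \<open>d\<close> itself
      is three times \<open>skew_part\<close>\<close>
    then show ?thesis
      using d[of a b c] d[of b a c] d[of c a b] by (smt (verit))
  qed
  have "linear (\<lambda>x. total \<beta> x b0 c0)"
    unfolding total_def by (intro linear_compose_add multilinear3D[OF \<beta>(1)])
  moreover have "B x a * total \<beta> (K x) b0 c0 = B (K x) a * total \<beta> x b0 c0" for x a
    using sk[of x a b0 c0] by (simp add: skew_part_def)
  ultimately obtain \<mu> where "\<And>x. K x = \<mu> *\<^sub>R x"
    using proportional_imp_scalar[OF K(1), of "\<lambda>x. total \<beta> x b0 c0" x0] nz by blast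
  then have "\<kappa> [x, y] = \<mu> * B x y" for x y using K(2)[of x y] by (simp add: bilinear_formD[OF bil])
  then show ?thesis by blast
qed

lemma exists_nonnull: "\<exists>v. B v v \<noteq> 0"
proof (rule ccontr)
  assume "\<not> ?thesis"
  then have z: "B v v = 0" for v by blast
  have "B x y = 0" for x y
    using z[of "x + y"] z[of x] z[of y] sym[of x y] by (simp add: bilinear_formD[OF bil])
  then have "(x::'v) = 0" for x using nondeg by (auto simp: nondegenerate_def)
  moreover obtain e :: 'v where "e \<in> Basis" using nonempty_Basis by blast
  ultimately show False using nonzero_Basis by blast
qed

lemma orthogonal_pair:
  assumes "DIM('v) \<ge> 2" and v: "B v v \<noteq> 0"
  obtains w w' where "B v w = 0" "B v w' = 0" "B w w' \<noteq> 0"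
proof -
  note b = bilinear_formD[OF bil]
  have "dim (span {v}) < DIM('v)"
    using assms(1) dim_le_card'[of "{v}"] by simp
  then have "span {v} \<noteq> UNIV" by (metis dim_UNIV less_irrefl)
  then obtain x where x: "x \<notin> span {v}" by blast
  define w where "w = x - (B v x / B v v) *\<^sub>R v"
  have "w \<noteq> 0" using x by (metis w_def eq_iff_diff_eq_0 insertI1 span_base span_scale)
  then obtain y where y: "B w y \<noteq> 0" using nondeg by (auto simp: nondegenerate_def)
  define w' where "w' = y - (B v y / B v v) *\<^sub>R v"
  have "B v w = 0" "B v w' = 0" using v by (simp_all add: w_def w'_def b)
  moreover have "B w w' = B w y" using \<open>B v w = 0\<close> sym[of w v] by (simp add: w'_def b)
  ultimately show ?thesis using that y by simp
qed

text \<open>The remaining possibility is that \<open>\<kappa>\<close> is a multiple \<open>f g\<close> of the metric near the point, so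
  that \<open>\<nabla>\<kappa> = df \<otimes> g\<close>. Evaluating on vectors adapted to a nonnull \<open>v\<close> gives \<open>df(v) = 0\<close>.\<close>

lemma scalar_total_zero:
  assumes dim: "DIM('v) \<ge> 2"
    and \<beta>: "multilinear 3 \<beta>" and prod: "\<And>x y z. \<beta> [x, y, z] = l x * B y z" and l: "linear l"
    and skew: "\<And>x y z w. B (R x y z) w = - B (R x y w) z"
    and curv: "\<And>y x a b c. act (R y x) \<beta> [a, b, c] = curv_on \<beta> y x a b c"
  shows "\<beta> [x, y, z] = 0"
proof -
  note b = bilinear_formD[OF bil]
  have d: "skew_part (total \<beta>) y x a b c - 2 * skew_part (total \<beta>) y x b a c
        - 2 * skew_part (total \<beta>) y x c a b = 0" if "B b c = 0" for y x a b c
  proof -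
    have "act (R y x) \<beta> [a, b, c] = - l a * (B (R y x b) c + B b (R y x c))"
      using that by (simp add: act_def numeral_3_eq_3 prod algebra_simps)
    then have "act (R y x) \<beta> [a, b, c] = 0"
      using skew[of y x b c] sym[of b "R y x c"] by simp
    moreover have "act (W y x) \<beta> [a, b, c] = - l a * (B (W y x b) c + B b (W y x c))"
      using that by (simp add: act_def numeral_3_eq_3 prod algebra_simps)
    then have "act (W y x) \<beta> [a, b, c] = 0"
      by (simp add: W_def b sym algebra_simps)
    moreover have "\<beta> [x, y, z] = \<beta> [x, z, y]" for x y z using prod sym by simp
    ultimately show ?thesis
      using curv_on_defect[OF \<beta>, of y x a b c] curv[of y x a b c] by simp
  qed
  have l0: "l v * B v v = 0" for v
  proof (cases "B v v = 0")
    case False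
    then obtain w w' where w: "B v w = 0" "B v w' = 0" "B w w' \<noteq> 0" using orthogonal_pair[OF dim] by blast
    \<comment> \<open>\<open>b = a = x = v\<close> and \<open>c = w'\<close>, \<open>y = w\<close> orthogonal to \<open>v\<close> leave only terms with \<open>l v\<close>\<close>
    have "5 * l v * B v v * B w w' = 0"
      using d[of v w' w v v] w sym[of w v] sym[of w' v] sym[of w' w]
      by (simp add: skew_part_def total_def prod algebra_simps)
    then show ?thesis using w(3) by simp
  qed simp
  have "l u = 0" for u
  proof (rule ccontr)
    assume lu: "l u \<noteq> 0"
    then have "u \<noteq> 0" using linear_0[OF l] by auto
    then obtain z where z: "B u z \<noteq> 0" using nondeg by (auto simp: nondegenerate_def)
    have uu: "B u u = 0" using l0[of u] lu by simp
    \<comment> \<open>for null \<open>u\<close>, the cubic polynomial \<open>l v * B v v\<close> in \<open>t\<close>, where \<open>v = u + t z\<close>, has the linear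
      coefficient \<open>2 X\<close>; four values of \<open>t\<close> suffice to see that this is zero\<close>
    define X where "X = l u * B u z"
    define Y where "Y = l u * B z z + 2 * l z * B u z"
    define Z where "Z = l z * B z z"
    have "2 * X * t + Y * (t * t) + Z * (t * t * t) = 0" for t
      using l0[of "u + t *\<^sub>R z"] uu sym[of z u]
      by (simp add: X_def Y_def Z_def b linear_add[OF l] linear_scale[OF l] algebra_simps)
    from this[of 1] this[of "-1"] this[of 2] this[of "-2"] have "X = 0" by simp
    then show False using lu z by (simp add: X_def)
  qed
  then show ?thesis by (simp add: prod)
qed

end

section \<open>The prolonged Killing system\<close>

lemma curvature_symmetries_add:
  assumes "curvature_symmetries f" "curvature_symmetries h"
  shows "curvature_symmetries (\<lambda>x y z w. f x y z w + h x y z w)"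
proof (rule curvature_symmetriesI)
  note f = curvature_symmetriesD[OF assms(1)] and h = curvature_symmetriesD[OF assms(2)]
  fix x y z w
  show "f x y z w + h x y z w = f y x z w + h y x z w" using f(1)[of x y z w] h(1)[of x y z w] by simp
  show "f x y z w + h x y z w = f x y w z + h x y w z" using f(2)[of x y z w] h(2)[of x y z w] by simp
  show "f x y z w + h x y z w + (f y z x w + h y z x w) + (f z x y w + h z x y w) = 0"
    using f(4)[of x y z w] h(4)[of x y z w] by linarith
qed

context metric_manifold
begin

text \<open>Partial derivatives and Christoffel symbols at \<open>p\<close> in the preferred chart around \<open>p\<close>, where the
  frame at \<open>p\<close> is the identity.\<close>

definition dT :: "('a \<Rightarrow> 'e tensor) \<Rightarrow> 'a \<Rightarrow> 'e \<Rightarrow> 'e list \<Rightarrow> real" where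
  "dT T p x ys = frechet_derivative (\<lambda>w. in_chart M (chart_at M p) T w ys) (at (snd (chart_at M p) p)) x"

definition christ :: "'a \<Rightarrow> 'e \<Rightarrow> 'e \<Rightarrow> 'e" where
  "christ p = Chr (chart_at M p) (snd (chart_at M p) p)"

lemma dT_has_derivative:
  assumes "tensor_field M k T" "p \<in> points M" "length ys = k"
  shows "((\<lambda>w. in_chart M (chart_at M p) T w ys) has_derivative (\<lambda>x. dT T p x ys)) (at (snd (chart_at M p) p))"
  unfolding dT_def
  using local_tensor.has_derivative_T[OF tensor_field_local[OF assms(1) chart_at(1)[OF assms(2)]]
      assms(3) chart_at_image[OF assms(2)]] .

lemma dT_eqI:
  assumes "p \<in> points M" "(f has_derivative f') (at (snd (chart_at M p) p))"
    "\<And>w. w \<in> chart_image (chart_at M p) \<Longrightarrow> f w = in_chart M (chart_at M p) T w ys"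
  shows "dT T p x ys = f' x"
proof -
  have "((\<lambda>w. in_chart M (chart_at M p) T w ys) has_derivative f') (at (snd (chart_at M p) p))"
    using has_derivative_transform_within_open[OF assms(2) chart_open[OF chart_at(1)[OF assms(1)]]
        chart_at_image[OF assms(1)] assms(3)] by simp
  then show ?thesis unfolding dT_def by (rule fun_cong[OF frechet_derivative_at[symmetric]])
qed

lemma dT_cong:
  assumes p: "p \<in> points M" and "\<And>w. w \<in> chart_image (chart_at M p) \<Longrightarrow>
    in_chart M (chart_at M p) T w ys = in_chart M (chart_at M p) T' w ys'"
  shows "dT T p x ys = dT T' p x ys'"
  unfolding dT_def
  using frechet_derivative_cong_open[OF chart_open[OF chart_at(1)[OF p]] chart_at_image[OF p] assms(2)] by simp

lemma dT_cyclic: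
  assumes T: "tensor_field M k T" and p: "p \<in> points M"
    and len: "length ys1 = k" "length ys2 = k" "length ys3 = k"
    and rel: "\<And>w. w \<in> chart_image (chart_at M p) \<Longrightarrow> in_chart M (chart_at M p) T w ys1 +
      in_chart M (chart_at M p) T w ys2 + in_chart M (chart_at M p) T w ys3 = 0"
  shows "dT T p x ys1 + dT T p x ys2 + dT T p x ys3 = 0"
proof -
  have "((\<lambda>w. - in_chart M (chart_at M p) T w ys1 - in_chart M (chart_at M p) T w ys2) has_derivative
      (\<lambda>x. - dT T p x ys1 - dT T p x ys2)) (at (snd (chart_at M p) p))"
    by (intro has_derivative_diff has_derivative_minus dT_has_derivative[OF T p] len)
  then have "dT T p x ys3 = - dT T p x ys1 - dT T p x ys2"
    by (rule dT_eqI[OF p]) (use rel in \<open>simp add: add_eq_0_iff\<close>)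
  then show ?thesis by simp
qed

lemma nabla_eq:
  "p \<in> points M \<Longrightarrow> nabla M g T p (x # ys) =
    dT T p x ys - (\<Sum>i<length ys. T p (ys[i := christ p x (ys ! i)]))"
  by (simp add: nabla_local_nabla local_nabla_Cons dT_def christ_def in_chart_at)

lemma nabla2: "p \<in> points M \<Longrightarrow> nabla M g T p [x, a, b] =
    dT T p x [a, b] - T p [christ p x a, b] - T p [a, christ p x b]"
  by (simp add: nabla_eq)

lemma nabla3: "p \<in> points M \<Longrightarrow> nabla M g T p [x, a, b, c] =
    dT T p x [a, b, c] - T p [christ p x a, b, c] - T p [a, christ p x b, c] - T p [a, b, christ p x c]"
  by (simp add: nabla_eq)

lemma nabla4: "p \<in> points M \<Longrightarrow> nabla M g T p [x, a, b, c, d] =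
    dT T p x [a, b, c, d] - T p [christ p x a, b, c, d] - T p [a, christ p x b, c, d]
    - T p [a, b, christ p x c, d] - T p [a, b, c, christ p x d]"
  by (simp add: nabla_eq)

lemma dT_g: "p \<in> points M \<Longrightarrow> dT g p x [a, b] = g p [christ p x a, b] + g p [a, christ p x b]"
  using nabla_g[of p x a b] nabla2[of p g x a b] by simp

lemma pointwise_metric: "p \<in> points M \<Longrightarrow> pointwise_metric (\<lambda>x y. g p [x, y])"
  using bilinear_g symmetric_g nondegenerate_g by unfold_locales auto

abbreviation W :: "'a \<Rightarrow> 'e \<Rightarrow> 'e \<Rightarrow> 'e \<Rightarrow> 'e" where
  "W p \<equiv> pointwise_metric.W (\<lambda>x y. g p [x, y])"

abbreviation Theta :: "'a \<Rightarrow> 'e tensor \<Rightarrow> 'e \<Rightarrow> 'e \<Rightarrow> 'e \<Rightarrow> 'e \<Rightarrow> 'e \<Rightarrow> real" where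
  "Theta p \<equiv> pointwise_metric.Theta (\<lambda>x y. g p [x, y])"

abbreviation curv_on :: "'a \<Rightarrow> 'e tensor \<Rightarrow> 'e \<Rightarrow> 'e \<Rightarrow> 'e \<Rightarrow> 'e \<Rightarrow> 'e \<Rightarrow> real" where
  "curv_on p \<equiv> pointwise_metric.curv_on (\<lambda>x y. g p [x, y])"

lemma wedge_W: "p \<in> points M \<Longrightarrow> wedge g p x y = W p x y"
  by (rule ext) (simp add: wedge_def pointwise_metric.W_def[OF pointwise_metric])

text \<open>As \<open>g\<close> is parallel, the Ricci identity for \<open>g\<close> makes the curvature skew in its last two
  arguments.\<close>

lemma nabla_g_zero: "nabla M g g = (\<lambda>p xs. 0)"
proof (intro ext)
  fix p and xs :: "'e list"
  have m: "multilinear 3 (nabla M g g p)" if "p \<in> points M"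
    using tensor_field_nabla[OF tensor_field_g] that by (simp add: tensor_field_def numeral_3_eq_3 numeral_2_eq_2)
  show "nabla M g g p xs = 0"
  proof (cases "p \<in> points M \<and> length xs = 3")
    case True
    then have "\<forall>x y z. nabla M g g p [x, y, z] = 0" using nabla_g by blast
    then show ?thesis using True all_length3[of "\<lambda>xs. nabla M g g p xs = 0"] by blast
  qed (use multilinear_length[OF m] in \<open>auto simp: nabla_def\<close>)
qed

lemma nabla_zero: "nabla M g (\<lambda>p xs. 0) p xs = 0"
  by (simp add: nabla_def in_chart_def Let_def split: list.split)

lemma curvature_skew_metric:
  assumes p: "p \<in> points M"
  shows "g p [curvature M g p x y z, w] = - g p [curvature M g p x y w, z]"
proof -
  have "act (curvature M g p x y) (g p) [z, w] = 0"
    using ricci_identity[OF tensor_field_g p, of "[z, w]" x y] by (simp add: nabla_g_zero nabla_zero)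
  then show ?thesis
    using symmetric_g[OF p, of z "curvature M g p x y w"] by (simp add: act_def)
qed

lemma curvature_skew: "p \<in> points M \<Longrightarrow> curvature M g p x y z = - curvature M g p y x z"
  by (simp add: curvature_local local_curvature_def)

lemma curvature_bianchi:
  assumes p: "p \<in> points M"
  shows "curvature M g p x y z + curvature M g p y z x + curvature M g p z x y = 0"
proof -
  let ?c = "chart_at M p"
  interpret G: local_metric "chart_image ?c" "in_chart M ?c g" by (rule local_metric_g[OF chart_at(1)[OF p]])
  have "frechet_derivative (\<lambda>w. Chr ?c w a b) (at (snd ?c p)) = frechet_derivative (\<lambda>w. Chr ?c w b a) (at (snd ?c p))"
    for a b
    by (rule frechet_derivative_cong_open[OF G.open_U chart_at_image[OF p] G.christoffel_symmetric])
  note this[of y x] this[of z x] this[of z y]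
  moreover have "Chr ?c (snd ?c p) a b = Chr ?c (snd ?c p) b a" for a b
    by (rule G.christoffel_symmetric[OF chart_at_image[OF p]])
  note this[of y x] this[of z x] this[of z y]
  ultimately show ?thesis
    unfolding curvature_local[OF p] local_curvature_def by simp
qed

lemma curvature_pair:
  assumes p: "p \<in> points M"
  shows "g p [curvature M g p x y z, w] = g p [curvature M g p z w x, y]"
proof -
  define r where "r x y z w = g p [curvature M g p x y z, w]" for x y z w
  note b = bilinear_formD[OF bilinear_g[OF p]]
  have s: "r x y z w = - r y x z w" "r x y z w = - r x y w z" for x y z w
    using curvature_skew[OF p, of x y z] curvature_skew_metric[OF p, of x y z w] by (simp_all add: r_def b)
  have cyc: "r x y z w + r y z x w + r z x y w = 0" for x y z w
    using curvature_bianchi[OF p, of x y z] b(1)[of "curvature M g p x y z + curvature M g p y z x" "curvature M g p z x y" w]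
    by (simp add: r_def b)
  have "r x y z w = r z w x y"
    using cyc[of x y z w] cyc[of y z w x] cyc[of z w x y] cyc[of w x y z]
      s(2)[of x y w z] s(2)[of y z w x] s(1)[of x z w y] s(2)[of z x w y] s(2)[of z w y x] s(2)[of w x y z]
      s(1)[of w y z x] s(2)[of y w z x] by linarith
  then show ?thesis by (simp add: r_def)
qed

text \<open>A linear relation between the values of a tensor field on permuted arguments holds near \<open>p\<close> in
  coordinates, so it can be differentiated.\<close>

lemma nabla_symmetric2:
  assumes p: "p \<in> points M" and s: "\<And>q x y. q \<in> points M \<Longrightarrow> T q [x, y] = T q [y, x]"
  shows "nabla M g T p [x, a, b] = nabla M g T p [x, b, a]"
proof -
  have "dT T p x [a, b] = dT T p x [b, a]"
    by (rule dT_cong[OF p]) (simp add: in_chart_def s[OF chart_inv_point[OF chart_at(1)[OF p]]])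
  then show ?thesis using s[OF p, of _ a] s[OF p, of _ b] by (simp add: nabla2[OF p])
qed

lemma nabla_symmetric3:
  assumes p: "p \<in> points M" and s: "\<And>q x y z. q \<in> points M \<Longrightarrow> T q [x, y, z] = T q [x, z, y]"
  shows "nabla M g T p [x, a, b, c] = nabla M g T p [x, a, c, b]"
proof -
  have "dT T p x [a, b, c] = dT T p x [a, c, b]"
    by (rule dT_cong[OF p]) (simp only: in_chart_def list.map s[OF chart_inv_point[OF chart_at(1)[OF p]], of _ _ "frame M (chart_at M p) _ c"])
  then show ?thesis
    using s[OF p, of "christ p x a" b c] s[OF p, of a "christ p x b" c] s[OF p, of a b "christ p x c"]
    by (simp add: nabla3[OF p])
qed

lemma nabla_cyclic3:
  assumes T: "tensor_field M 3 T" and p: "p \<in> points M"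
    and s: "\<And>q x y z. q \<in> points M \<Longrightarrow> T q [x, y, z] + T q [y, z, x] + T q [z, x, y] = 0"
  shows "nabla M g T p [x, a, b, c] + nabla M g T p [x, b, c, a] + nabla M g T p [x, c, a, b] = 0"
proof -
  have "dT T p x [a, b, c] + dT T p x [b, c, a] + dT T p x [c, a, b] = 0"
    by (rule dT_cyclic[OF T p]) (simp_all add: in_chart_def s[OF chart_inv_point[OF chart_at(1)[OF p]]])
  then show ?thesis
    using s[OF p, of "christ p x a" b c] s[OF p, of a "christ p x b" c] s[OF p, of a b "christ p x c"]
    by (simp add: nabla3[OF p])
qed

lemma nabla_curvature_symmetries:
  assumes T: "tensor_field M 4 T" and p: "p \<in> points M"
    and s: "\<And>q. q \<in> points M \<Longrightarrow> curvature_symmetries (\<lambda>x y z w. T q [x, y, z, w])"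
  shows "curvature_symmetries (\<lambda>a b c d. nabla M g T p [x, a, b, c, d])"
proof (rule curvature_symmetriesI)
  let ?C = "christ p x"
  note q = curvature_symmetriesD[OF s[OF chart_inv_point[OF chart_at(1)[OF p]]]]
  note sp = curvature_symmetriesD[OF s[OF p]]
  fix a b c d
  have "dT T p x [a, b, c, d] = dT T p x [b, a, c, d]"
    by (rule dT_cong[OF p]) (simp only: in_chart_def list.map q(1)[of _ "frame M (chart_at M p) _ a"])
  then show "nabla M g T p [x, a, b, c, d] = nabla M g T p [x, b, a, c, d]"
    using sp(1)[of "?C a" b c d] sp(1)[of a "?C b" c d] sp(1)[of a b "?C c" d] sp(1)[of a b c "?C d"]
    by (simp add: nabla4[OF p])
  have "dT T p x [a, b, c, d] = dT T p x [a, b, d, c]"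
    by (rule dT_cong[OF p]) (simp only: in_chart_def list.map q(2)[of _ _ _ "frame M (chart_at M p) _ c"])
  then show "nabla M g T p [x, a, b, c, d] = nabla M g T p [x, a, b, d, c]"
    using sp(2)[of "?C a" b c d] sp(2)[of a "?C b" c d] sp(2)[of a b "?C c" d] sp(2)[of a b c "?C d"]
    by (simp add: nabla4[OF p])
  have "dT T p x [a, b, c, d] + dT T p x [b, c, a, d] + dT T p x [c, a, b, d] = 0"
    by (rule dT_cyclic[OF T p]) (simp_all add: in_chart_def q(4))
  then show "nabla M g T p [x, a, b, c, d] + nabla M g T p [x, b, c, a, d] + nabla M g T p [x, c, a, b, d] = 0"
    using sp(4)[of "?C a" b c d] sp(4)[of a "?C b" c d] sp(4)[of a b "?C c" d] sp(4)[of a b c "?C d"]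
    by (simp add: nabla4[OF p])
qed

text \<open>The two equations of (b) are separated because the first one by itself, with \<open>C\<close> a
  symmetrized curvature tensor, gives the first nullity condition and \<open>C = C\<^sup>\<kappa>\<close>.\<close>

definition first_equation :: "('a \<Rightarrow> 'e tensor) \<Rightarrow> ('a \<Rightarrow> 'e tensor) \<Rightarrow> bool" where
  "first_equation \<kappa> C \<longleftrightarrow> (\<forall>p\<in>points M. \<forall>x a b c. C p [x, a, b, c] =
     nabla M g (nabla M g \<kappa>) p [x, a, b, c] + 2 * odot21 (\<kappa> p) (flat g p x) [a, b, c])"

definition second_equation :: "('a \<Rightarrow> 'e tensor) \<Rightarrow> ('a \<Rightarrow> 'e tensor) \<Rightarrow> bool" where
  "second_equation \<kappa> C \<longleftrightarrow> (\<forall>p\<in>points M. \<forall>x a b c d.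
     nabla M g C p [x, a, b, c, d] = - odot31 (nabla M g \<kappa> p) (flat g p x) [a, b, c, d])"

lemma prolongation_pairs_iff:
  "(\<kappa>, C) \<in> prolongation_pairs M g \<longleftrightarrow>
    symmetric2_field M \<kappa> \<and> sym_curvature_field M C \<and> first_equation \<kappa> C \<and> second_equation \<kappa> C"
  unfolding prolongation_pairs_def first_equation_def second_equation_def
  by (simp add: all_length3 all_length4)

lemma nullity_killing_tensors_iff:
  "\<kappa> \<in> nullity_killing_tensors M g \<longleftrightarrow> killing2 M g \<kappa> \<and>
     (\<forall>p\<in>points M. \<forall>x y a b. act (curvature M g p x y) (\<kappa> p) [a, b] = - act (W p x y) (\<kappa> p) [a, b]) \<and>
     (\<forall>p\<in>points M. \<forall>x y a b c. act (curvature M g p x y) (nabla M g \<kappa> p) [a, b, c] =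
        - act (W p x y) (nabla M g \<kappa> p) [a, b, c])"
  unfolding nullity_killing_tensors_def by (simp add: all_length2 all_length3 wedge_W)

lemma first_equationD:
  "first_equation \<kappa> C \<Longrightarrow> p \<in> points M \<Longrightarrow> C p [x, a, b, c] = nabla M g (nabla M g \<kappa>) p [x, a, b, c] +
    2 * (g p [x, a] * \<kappa> p [b, c] - 1/2 * g p [x, b] * \<kappa> p [a, c] - 1/2 * g p [x, c] * \<kappa> p [a, b])"
  by (simp add: first_equation_def odot21_def flat_def)

text \<open>In \<open>\<kappa> \<odot> x\<^sup>\<sharp>\<close>, viewed as a 4-tensor with \<open>x\<close> as a further argument, only \<open>\<kappa>\<close> is differentiated
  because \<open>g\<close> is parallel.\<close>

lemma nabla_first_equation:
  assumes \<kappa>: "tensor_field M 2 \<kappa>" and C: "first_equation \<kappa> C" and p: "p \<in> points M"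
  shows "nabla M g C p [y, x, a, b, c] = nabla M g (nabla M g (nabla M g \<kappa>)) p [y, x, a, b, c] +
    2 * Theta p (nabla M g \<kappa> p) x y a b c"
proof -
  let ?c = "chart_at M p" and ?u = "snd (chart_at M p) p" and ?N = "nabla M g (nabla M g \<kappa>)"
  have N: "tensor_field M 4 ?N"
    using tensor_field_nabla[OF tensor_field_nabla[OF \<kappa>]] by (simp add: numeral_2_eq_2 eval_nat_numeral)
  note D = dT_has_derivative[OF _ p]
  let ?K = "in_chart M ?c \<kappa>" and ?G = "in_chart M ?c g"
  have "dT C p y [x, a, b, c] = dT ?N p y [x, a, b, c] +
    2 * ((g p [x, a] * dT \<kappa> p y [b, c] + dT g p y [x, a] * \<kappa> p [b, c])
      - 1/2 * (g p [x, b] * dT \<kappa> p y [a, c] + dT g p y [x, b] * \<kappa> p [a, c])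
      - 1/2 * (g p [x, c] * dT \<kappa> p y [a, b] + dT g p y [x, c] * \<kappa> p [a, b]))"
  proof (rule dT_eqI[OF p])
    have "((\<lambda>w. in_chart M ?c ?N w [x, a, b, c] + 2 * (?G w [x, a] * ?K w [b, c]
        - 1/2 * (?G w [x, b] * ?K w [a, c]) - 1/2 * (?G w [x, c] * ?K w [a, b]))) has_derivative
      (\<lambda>y. dT ?N p y [x, a, b, c] +
        2 * ((?G ?u [x, a] * dT \<kappa> p y [b, c] + dT g p y [x, a] * ?K ?u [b, c])
        - 1/2 * (?G ?u [x, b] * dT \<kappa> p y [a, c] + dT g p y [x, b] * ?K ?u [a, c])
        - 1/2 * (?G ?u [x, c] * dT \<kappa> p y [a, b] + dT g p y [x, c] * ?K ?u [a, b])))) (at ?u)"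
      by (intro has_derivative_add has_derivative_diff has_derivative_mult has_derivative_mult_right
          D[OF N] D[OF \<kappa>] D[OF tensor_field_g]) simp_all
    then show "((\<lambda>w. in_chart M ?c ?N w [x, a, b, c] + 2 * (?G w [x, a] * ?K w [b, c]
        - 1/2 * (?G w [x, b] * ?K w [a, c]) - 1/2 * (?G w [x, c] * ?K w [a, b]))) has_derivative
      (\<lambda>y. dT ?N p y [x, a, b, c] +
        2 * ((g p [x, a] * dT \<kappa> p y [b, c] + dT g p y [x, a] * \<kappa> p [b, c])
        - 1/2 * (g p [x, b] * dT \<kappa> p y [a, c] + dT g p y [x, b] * \<kappa> p [a, c])
        - 1/2 * (g p [x, c] * dT \<kappa> p y [a, b] + dT g p y [x, c] * \<kappa> p [a, b])))) (at ?u)"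
      by (simp only: in_chart_at[OF p])
    fix w assume "w \<in> chart_image ?c"
    then show "in_chart M ?c ?N w [x, a, b, c] + 2 * (?G w [x, a] * ?K w [b, c]
        - 1/2 * (?G w [x, b] * ?K w [a, c]) - 1/2 * (?G w [x, c] * ?K w [a, b])) = in_chart M ?c C w [x, a, b, c]"
      by (simp add: in_chart_def first_equationD[OF C chart_inv_point[OF chart_at(1)[OF p]]])
  qed
  then show ?thesis
    by (simp add: nabla4[OF p] first_equationD[OF C p] nabla2[OF p] dT_g[OF p]
        pointwise_metric.Theta_def[OF pointwise_metric[OF p]] algebra_simps)
qed

text \<open>The Ricci identity for \<open>\<nabla>\<kappa>\<close>, with the third derivatives of \<open>\<kappa>\<close> expressed by \<open>\<nabla>C\<close>.\<close>

lemma curvature_on_derivative: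
  assumes \<kappa>: "tensor_field M 2 \<kappa>" and C: "first_equation \<kappa> C" and p: "p \<in> points M"
  shows "act (curvature M g p y x) (nabla M g \<kappa> p) [a, b, c] =
    nabla M g C p [y, x, a, b, c] - nabla M g C p [x, y, a, b, c]
    - 2 * Theta p (nabla M g \<kappa> p) x y a b c + 2 * Theta p (nabla M g \<kappa> p) y x a b c"
  using ricci_identity[OF tensor_field_nabla[OF \<kappa>] p, of "[a, b, c]" y x]
    nabla_first_equation[OF \<kappa> C p, of y x a b c] nabla_first_equation[OF \<kappa> C p, of x y a b c] by simp

text \<open>The Ricci identity for \<open>\<kappa>\<close>: the antisymmetrization of \<open>2 \<kappa> \<odot> x\<^sup>\<sharp>\<close> in \<open>x\<close> and the first
  argument is \<open>(x \<and> y) \<cdot> \<kappa>\<close>.\<close>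

lemma curvature_on_killing_iff:
  assumes \<kappa>: "symmetric2_field M \<kappa>" and C: "first_equation \<kappa> C" and p: "p \<in> points M"
  shows "act (curvature M g p x y) (\<kappa> p) [a, b] = - act (W p x y) (\<kappa> p) [a, b] \<longleftrightarrow>
    C p [x, y, a, b] = C p [y, x, a, b]"
proof -
  have t: "tensor_field M 2 \<kappa>" and s: "\<And>x y. \<kappa> p [x, y] = \<kappa> p [y, x]"
    using \<kappa> p by (auto simp: symmetric2_field_def symmetric2_def)
  have m: "multilinear 2 (\<kappa> p)" using t p by (simp add: tensor_field_def)
  have "act (W p x y) (\<kappa> p) [a, b] = g p [y, a] * \<kappa> p [x, b] - g p [x, a] * \<kappa> p [y, b]
      + g p [y, b] * \<kappa> p [a, x] - g p [x, b] * \<kappa> p [a, y]"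
    by (simp add: act_def pointwise_metric.W_def[OF pointwise_metric[OF p]] multilinear_distrib2[OF m])
  moreover have "act (curvature M g p x y) (\<kappa> p) [a, b] =
      nabla M g (nabla M g \<kappa>) p [x, y, a, b] - nabla M g (nabla M g \<kappa>) p [y, x, a, b]"
    using ricci_identity[OF t p, of "[a, b]" x y] by simp
  ultimately show ?thesis
    using s[of a x] s[of a y] symmetric_g[OF p, of y x]
    by (simp add: first_equationD[OF C p]) argo
qed

lemma first_equation_C_of:
  assumes \<kappa>: "symmetric2_field M \<kappa>" and C: "first_equation \<kappa> C" and p: "p \<in> points M"
    and s: "curvature_symmetries (\<lambda>x y z w. C p [x, y, z, w])"
  shows "C_of M g \<kappa> p [x, y, z, w] = C p [x, y, z, w]"
proof -
  have \<kappa>s: "\<And>x y. \<kappa> p [x, y] = \<kappa> p [y, x]"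
    using \<kappa> p by (auto simp: symmetric2_field_def symmetric2_def)
  have "(\<lambda>x1 x2 x3 x4. nabla M g (nabla M g \<kappa>) p [x1, x2, x3, x4]) =
      (\<lambda>x1 x2 x3 x4. C p [x1, x2, x3, x4] - 2 * odot21 (\<kappa> p) (\<lambda>v. g p [x1, v]) [x2, x3, x4])"
    using C p by (simp add: first_equation_def flat_def[abs_def])
  then show ?thesis
    using P22_curvature[OF s, of x y z w] P22_odot21[of "\<kappa> p" "g p" x y z w, OF \<kappa>s symmetric_g[OF p]]
    by (simp only: C_of_def prolong2_def P22_diff)
qed

lemma C_of_degenerate:
  assumes "tensor_field M 2 \<kappa>" and "p \<notin> points M \<or> length xs \<noteq> 4"
  shows "C_of M g \<kappa> p xs = 0"
  using assms
  by (auto simp: C_of_def prolong2_def odot22_def P22_def S22_def alternate_odd_even_def tensor_field_def nabla_def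
      split: list.split)

lemma flat_eq: "flat g p x = (\<lambda>y. g p [x, y])"
  by (rule ext) (simp add: flat_def)

lemma tensor_field_multilinear: "tensor_field M k T \<Longrightarrow> p \<in> points M \<Longrightarrow> multilinear k (T p)"
  by (simp add: tensor_field_def)

lemma tensor_field_nabla2: "tensor_field M 2 T \<Longrightarrow> tensor_field M 3 (nabla M g T)"
  using tensor_field_nabla[of 2 T] by (simp add: eval_nat_numeral)

lemma tensor_field_nabla3: "tensor_field M 3 T \<Longrightarrow> tensor_field M 4 (nabla M g T)"
  using tensor_field_nabla[of 3 T] by (simp add: eval_nat_numeral)

lemma first_equation_tensor_field:
  assumes \<kappa>: "tensor_field M 2 \<kappa>" and C: "first_equation \<kappa> C"
    and zero: "\<And>p xs. p \<notin> points M \<or> length xs \<noteq> 4 \<Longrightarrow> C p xs = 0"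
  shows "tensor_field M 4 C"
  unfolding tensor_field_def
proof (intro conjI ballI allI impI)
  fix p assume p: "p \<in> points M"
  note mult = multilinear_distrib4[OF tensor_field_multilinear[OF tensor_field_nabla3[OF tensor_field_nabla2[OF \<kappa>]] p]]
    multilinear_distrib2[OF tensor_field_multilinear[OF \<kappa> p]]
    multilinear_distrib2[OF tensor_field_multilinear[OF tensor_field_g p]]
  have "linear (\<lambda>v. C p [v, a, b, c])" "linear (\<lambda>v. C p [a, v, b, c])"
    "linear (\<lambda>v. C p [a, b, v, c])" "linear (\<lambda>v. C p [a, b, c, v])" for a b c
    by (rule linearI; simp add: first_equationD[OF C p] mult algebra_simps)+
  then show "multilinear 4 (C p)" by (rule multilinear4I) (simp add: zero)
next
  fix p xs assume "p \<notin> points M" then show "C p xs = 0" using zero by blast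
next
  fix c and xs :: "'e list" assume c: "c \<in> atlas M" and "length xs = 4"
  then obtain x1 x2 x3 x4 where xs: "xs = [x1, x2, x3, x4]"
    using all_length4[of "\<lambda>xs. \<exists>x1 x2 x3 x4. xs = [x1, x2, x3, x4]"] by blast
  note sm = local_tensor.smooth_T[OF tensor_field_local[OF _ c]]
  have "smooth_on (chart_image c) (\<lambda>w. in_chart M c (nabla M g (nabla M g \<kappa>)) w [x1, x2, x3, x4] +
      2 * (in_chart M c g w [x1, x2] * in_chart M c \<kappa> w [x3, x4]
      - 1/2 * (in_chart M c g w [x1, x3] * in_chart M c \<kappa> w [x2, x4])
      - 1/2 * (in_chart M c g w [x1, x4] * in_chart M c \<kappa> w [x2, x3])))"
    by (intro smooth_on_add smooth_on_diff smooth_on_mult smooth_on_const chart_open[OF c]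
        sm[OF tensor_field_nabla3[OF tensor_field_nabla2[OF \<kappa>]]] sm[OF tensor_field_g] sm[OF \<kappa>]) simp_all
  then show "smooth_on (chart_image c) (\<lambda>w. in_chart M c C w xs)"
    unfolding xs by (rule smooth_on_cong[OF chart_open[OF c], rotated])
      (simp add: in_chart_def first_equationD[OF C chart_inv_point[OF c]])
qed

lemma killing_hook_symmetries:
  assumes \<kappa>: "killing2 M g \<kappa>" and p: "p \<in> points M"
  shows "hook_symmetries (\<lambda>x y z. nabla M g \<kappa> p [x, y, z])"
proof (rule killing_hook)
  have t: "tensor_field M 2 \<kappa>" and s: "\<And>q x y. q \<in> points M \<Longrightarrow> \<kappa> q [x, y] = \<kappa> q [y, x]"
    using \<kappa> by (auto simp: killing2_def symmetric2_field_def symmetric2_def)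
  show "multilinear 3 (nabla M g \<kappa> p)" by (rule tensor_field_multilinear[OF tensor_field_nabla2[OF t] p])
  show "nabla M g \<kappa> p [x, y, z] = nabla M g \<kappa> p [x, z, y]" for x y z
    by (rule nabla_symmetric2[where T = \<kappa>, OF p s])
  show "nabla M g \<kappa> p [x, x, x] = 0" for x using \<kappa> p by (simp add: killing2_def)
qed

text \<open>From (a) to (b): nullity on \<open>\<kappa>\<close> and the Killing equation make \<open>\<nabla>\<^sup>2\<kappa> + 2 \<kappa> \<odot> x\<^sup>\<sharp>\<close> curvature-like,
  so that the projection in \<open>C\<^sup>\<kappa>\<close> does not change it. Nullity on \<open>\<nabla>\<kappa>\<close> says that
  \<open>\<nabla>C + \<nabla>\<kappa> \<odot> x\<^sup>\<sharp>\<close> is symmetric in its first two arguments, hence zero.\<close>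

theorem killing_imp_prolongation_pair:
  assumes \<kappa>: "\<kappa> \<in> nullity_killing_tensors M g"
  shows "(\<kappa>, C_of M g \<kappa>) \<in> prolongation_pairs M g"
proof -
  have killing: "killing2 M g \<kappa>"
    and null2: "\<And>p x y a b. p \<in> points M \<Longrightarrow>
      act (curvature M g p x y) (\<kappa> p) [a, b] = - act (W p x y) (\<kappa> p) [a, b]"
    and null3: "\<And>p x y a b c. p \<in> points M \<Longrightarrow> act (curvature M g p x y) (nabla M g \<kappa> p) [a, b, c] =
      - act (W p x y) (nabla M g \<kappa> p) [a, b, c]"
    using \<kappa> unfolding nullity_killing_tensors_iff by blast+
  then have sf: "symmetric2_field M \<kappa>" and t: "tensor_field M 2 \<kappa>"
    and s: "\<And>q x y. q \<in> points M \<Longrightarrow> \<kappa> q [x, y] = \<kappa> q [y, x]"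
    by (auto simp: killing2_def symmetric2_field_def symmetric2_def)
  note hook = killing_hook_symmetries[OF killing]
  let ?C = "C_of M g \<kappa>"
  define D where "D p xs = (case xs of [x, a, b, c] \<Rightarrow> nabla M g (nabla M g \<kappa>) p [x, a, b, c] +
    2 * odot21 (\<kappa> p) (flat g p x) [a, b, c] | _ \<Rightarrow> 0)" for p xs
  have D: "first_equation \<kappa> D" by (simp add: first_equation_def D_def)
  have symD: "curvature_symmetries (\<lambda>x y z w. D p [x, y, z, w])" if p: "p \<in> points M" for p
  proof (rule curvature_symmetriesI')
    note h = hook_symmetriesD[OF hook]
    show "D p [x, y, z, w] = D p [y, x, z, w]" for x y z w
      using curvature_on_killing_iff[OF sf D p] null2[OF p] by blast
    show "D p [x, y, z, w] = D p [x, y, w, z]" for x y z w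
      using nabla_symmetric3[where T = "nabla M g \<kappa>", OF p h(1), of x y z w] s[OF p, of z w] by (simp add: first_equationD[OF D p])
    show "D p [x, y, z, w] + D p [x, z, w, y] + D p [x, w, y, z] = 0" for x y z w
      using nabla_cyclic3[OF tensor_field_nabla2[OF t] p h(2), of x y z w]
        s[OF p, of z y] s[OF p, of w y] s[OF p, of w z]
      by (simp add: first_equationD[OF D p] algebra_simps)
  qed
  have CD: "?C p [x, y, z, w] = D p [x, y, z, w]" if "p \<in> points M" for p x y z w
    by (rule first_equation_C_of[OF sf D that symD[OF that]])
  have first: "first_equation \<kappa> ?C" using D CD by (simp add: first_equation_def)
  have symC: "curvature_symmetries (\<lambda>x y z w. ?C p [x, y, z, w])" if "p \<in> points M" for p
    using symD[OF that] by (simp add: CD[OF that])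
  have tC: "tensor_field M 4 ?C"
    by (rule first_equation_tensor_field[OF t first C_of_degenerate[OF t]])
  have "nabla M g ?C p [y, x, a, b, c] = - odot31 (nabla M g \<kappa> p) (flat g p y) [x, a, b, c]"
    if p: "p \<in> points M" for p y x a b c
  proof -
    interpret pm: pointwise_metric "\<lambda>x y. g p [x, y]" by (rule pointwise_metric[OF p])
    \<comment> \<open>the second equation says that \<open>F\<close> vanishes\<close>
    define F where "F y x a b c = nabla M g ?C p [y, x, a, b, c] +
      odot31 (nabla M g \<kappa> p) (flat g p y) [x, a, b, c]" for y x a b c
    have "F y x a b c = 0"
    proof (rule curvature_symmetric_derivative_zero[of F])
      show "curvature_symmetries (F y)" for y
      proof -
        have "F y = (\<lambda>x a b c. nabla M g ?C p [y, x, a, b, c] +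
            odot31 (nabla M g \<kappa> p) (flat g p y) [x, a, b, c])" by (intro ext) (simp add: F_def)
        then show ?thesis
          by (simp only: curvature_symmetries_add[OF nabla_curvature_symmetries[OF tC p symC]
            odot31_symmetries[OF hook[OF p]]])
      qed
      show "F y x a b c = F x y a b c" for y x a b c
        using curvature_on_derivative[OF t first p, of y x a b c] null3[OF p, of y x a b c]
          pm.curv_on_killing[OF tensor_field_multilinear[OF tensor_field_nabla2[OF t] p] hook[OF p], of y x a b c]
        by (simp add: F_def flat_eq pm.curv_on_def)
    qed
    then show ?thesis by (simp add: F_def)
  qed
  then have "second_equation \<kappa> ?C" by (simp add: second_equation_def)
  moreover have "sym_curvature_field M ?C"
    using tC symmetries_sym_curvature_like[OF symC] by (simp add: sym_curvature_field_def)
  ultimately show ?thesis using sf first by (simp add: prolongation_pairs_iff)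
qed

text \<open>From (b) to (a): the point is that the totally symmetric part of \<open>\<nabla>\<kappa>\<close> vanishes. Where it does
  not, it does not vanish nearby either, so \<open>\<kappa> = f g\<close> near that point and \<open>\<nabla>\<kappa> = df \<otimes> g\<close>.\<close>

lemma prolongation_pair_total_zero:
  assumes dim: "DIM('e) \<ge> 2" and pair: "(\<kappa>, C) \<in> prolongation_pairs M g" and p: "p \<in> points M"
  shows "nabla M g \<kappa> p [x, y, z] + nabla M g \<kappa> p [y, z, x] + nabla M g \<kappa> p [z, x, y] = 0"
proof (rule ccontr)
  assume nonzero: "\<not> ?thesis"
  have sf: "symmetric2_field M \<kappa>" and sC: "sym_curvature_field M C"
    and first: "first_equation \<kappa> C" and second: "second_equation \<kappa> C"
    using pair by (simp_all add: prolongation_pairs_iff)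
  then have t: "tensor_field M 2 \<kappa>" and tC: "tensor_field M 4 C"
    and s: "\<And>q x y. q \<in> points M \<Longrightarrow> \<kappa> q [x, y] = \<kappa> q [y, x]"
    by (auto simp: sym_curvature_field_def symmetric2_field_def symmetric2_def)
  note t3 = tensor_field_nabla2[OF t]
  note s3 = nabla_symmetric2[where T = \<kappa>, OF _ s]
  have curv: "act (curvature M g q y x) (nabla M g \<kappa> q) [a, b, c] = curv_on q (nabla M g \<kappa> q) y x a b c"
    if q: "q \<in> points M" for q y x a b c
    using curvature_on_derivative[OF t first q, of y x a b c] second q
    by (simp add: second_equation_def flat_eq pointwise_metric.curv_on_def[OF pointwise_metric[OF q]])
  define tot where "tot q x y z = nabla M g \<kappa> q [x, y, z] + nabla M g \<kappa> q [y, z, x] + nabla M g \<kappa> q [z, x, y]"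
    for q x y z
  have scalar: "\<exists>\<mu>. \<forall>x y. \<kappa> q [x, y] = \<mu> * g q [x, y]" if q: "q \<in> points M" "tot q x y z \<noteq> 0" for q x y z
  proof -
    interpret pm: pointwise_metric "\<lambda>x y. g q [x, y]" by (rule pointwise_metric[OF q(1)])
    have symC: "curvature_symmetries (\<lambda>x y z w. C q [x, y, z, w])"
      using sC q(1) by (intro sym_curvature_like_symmetries) (auto simp: sym_curvature_field_def tensor_field_def)
    have "act (curvature M g q x y) (\<kappa> q) [a, b] = - act (W q x y) (\<kappa> q) [a, b]" for x y a b
      using curvature_on_killing_iff[OF sf first q(1)] curvature_symmetriesD(1)[OF symC] by blast
    moreover have "pm.total (nabla M g \<kappa> q) x y z \<noteq> 0" using q(2) by (simp add: pm.total_def tot_def)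
    ultimately show ?thesis
      using pm.total_nonzero_imp_scalar[OF tensor_field_multilinear[OF t q(1)] s[OF q(1)]
          tensor_field_multilinear[OF t3 q(1)] s3[OF q(1)]
          curvature_skew_metric[OF q(1)] curvature_pair[OF q(1)] _ curv[OF q(1)]] by blast
  qed
  let ?c = "chart_at M p" and ?u = "snd (chart_at M p) p"
  let ?K = "in_chart M ?c \<kappa>" and ?G = "in_chart M ?c g" and ?N = "in_chart M ?c (nabla M g \<kappa>)"
  note c = chart_at(1)[OF p] and u = chart_at_image[OF p]
  define f where "f w = ?N w [x, y, z] + ?N w [y, z, x] + ?N w [z, x, y]" for w
  have "smooth_on (chart_image ?c) f"
    unfolding f_def by (intro smooth_on_add chart_open[OF c] local_tensor.smooth_T[OF tensor_field_local[OF t3 c]]) simp_all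
  then have cont: "continuous_on (chart_image ?c) f" by (rule smooth_on_imp_continuous_on)
  \<comment> \<open>\<open>\<kappa>\<close> is a multiple of \<open>g\<close> on \<open>V\<close>; the factor is \<open>\<kappa>(v, v) / g(v, v)\<close> for a constant nonnull \<open>v\<close>\<close>
  define V where "V = chart_image ?c \<inter> f -` (- {0})"
  have V: "open V" unfolding V_def by (rule continuous_open_preimage[OF cont chart_open[OF c]]) (simp add: open_Compl)
  have uV: "?u \<in> V" using nonzero u by (simp add: V_def f_def in_chart_at[OF p])
  interpret pm: pointwise_metric "\<lambda>x y. g p [x, y]" by (rule pointwise_metric[OF p])
  obtain v where v: "g p [v, v] \<noteq> 0" using pm.exists_nonnull by blast
  have near: "?K w [a, b] * ?G w [v, v] = ?K w [v, v] * ?G w [a, b]" if w: "w \<in> V" for w a b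
  proof -
    have "tot (chart_inv ?c w) (frame M ?c w x) (frame M ?c w y) (frame M ?c w z) \<noteq> 0"
      using w by (simp add: V_def f_def in_chart_def tot_def)
    then obtain \<mu> where "\<And>x y. \<kappa> (chart_inv ?c w) [x, y] = \<mu> * g (chart_inv ?c w) [x, y]"
      using scalar[OF chart_inv_point[OF c]] w unfolding V_def by blast
    then show ?thesis by (simp add: in_chart_def)
  qed
  obtain \<mu> where \<mu>: "\<And>x y. \<kappa> p [x, y] = \<mu> * g p [x, y]"
    using scalar[OF p] nonzero unfolding tot_def by blast
  have prod: "nabla M g \<kappa> p [h, a, b] = nabla M g \<kappa> p [h, v, v] / g p [v, v] * g p [a, b]" for h a b
  proof -
    note D = dT_has_derivative[OF t p] dT_has_derivative[OF tensor_field_g p]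
    have "((\<lambda>w. ?K w [a, b] * ?G w [v, v]) has_derivative
        (\<lambda>h. ?K ?u [a, b] * dT g p h [v, v] + dT \<kappa> p h [a, b] * ?G ?u [v, v])) (at ?u)"
      by (intro has_derivative_mult D) simp_all
    then have "((\<lambda>w. ?K w [v, v] * ?G w [a, b]) has_derivative
        (\<lambda>h. ?K ?u [a, b] * dT g p h [v, v] + dT \<kappa> p h [a, b] * ?G ?u [v, v])) (at ?u)"
      by (rule has_derivative_transform_within_open[OF _ V uV near])
    moreover have "((\<lambda>w. ?K w [v, v] * ?G w [a, b]) has_derivative
        (\<lambda>h. ?K ?u [v, v] * dT g p h [a, b] + dT \<kappa> p h [v, v] * ?G ?u [a, b])) (at ?u)"
      by (intro has_derivative_mult D) simp_all
    ultimately have "(\<lambda>h. ?K ?u [a, b] * dT g p h [v, v] + dT \<kappa> p h [a, b] * ?G ?u [v, v]) =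
        (\<lambda>h. ?K ?u [v, v] * dT g p h [a, b] + dT \<kappa> p h [v, v] * ?G ?u [a, b])"
      by (rule has_derivative_unique)
    from fun_cong[OF this, of h]
    have "\<kappa> p [a, b] * dT g p h [v, v] + dT \<kappa> p h [a, b] * g p [v, v] =
        \<kappa> p [v, v] * dT g p h [a, b] + dT \<kappa> p h [v, v] * g p [a, b]"
      by (simp add: in_chart_at[OF p])
    then have "nabla M g \<kappa> p [h, a, b] * g p [v, v] = nabla M g \<kappa> p [h, v, v] * g p [a, b]"
      by (simp add: nabla2[OF p] dT_g[OF p] \<mu> algebra_simps)
    then show ?thesis using v by (simp add: field_simps)
  qed
  have "linear (\<lambda>h. nabla M g \<kappa> p [h, v, v] / g p [v, v])"
    using linear_compose_scale_right[OF multilinear3D(1)[OF tensor_field_multilinear[OF t3 p]], of "1 / g p [v, v]" v v]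
    by simp
  from pm.scalar_total_zero[OF dim tensor_field_multilinear[OF t3 p] prod this curvature_skew_metric[OF p] curv[OF p]]
  show False using nonzero by simp
qed

theorem prolongation_pair_imp_killing:
  assumes dim: "DIM('e) \<ge> 2" and pair: "(\<kappa>, C) \<in> prolongation_pairs M g"
  shows "\<kappa> \<in> nullity_killing_tensors M g" "C = C_of M g \<kappa>"
proof -
  have sf: "symmetric2_field M \<kappa>" and sC: "sym_curvature_field M C"
    and first: "first_equation \<kappa> C" and second: "second_equation \<kappa> C"
    using pair by (simp_all add: prolongation_pairs_iff)
  then have t: "tensor_field M 2 \<kappa>" and tC: "tensor_field M 4 C"
    by (auto simp: sym_curvature_field_def symmetric2_field_def)
  have "nabla M g \<kappa> p [x, x, x] = 0" if "p \<in> points M" for p x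
    using prolongation_pair_total_zero[OF dim pair that, of x x x] by simp
  then have killing: "killing2 M g \<kappa>" using sf by (simp add: killing2_def)
  have symC: "curvature_symmetries (\<lambda>x y z w. C p [x, y, z, w])" if "p \<in> points M" for p
    using sC that by (intro sym_curvature_like_symmetries) (auto simp: sym_curvature_field_def tensor_field_def)
  have "act (curvature M g p x y) (\<kappa> p) [a, b] = - act (W p x y) (\<kappa> p) [a, b]" if "p \<in> points M" for p x y a b
    using curvature_on_killing_iff[OF sf first that] curvature_symmetriesD(1)[OF symC[OF that]] by blast
  moreover have "act (curvature M g p x y) (nabla M g \<kappa> p) [a, b, c] = - act (W p x y) (nabla M g \<kappa> p) [a, b, c]"
    if p: "p \<in> points M" for p x y a b c
  proof -
    interpret pm: pointwise_metric "\<lambda>x y. g p [x, y]" by (rule pointwise_metric[OF p])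
    show ?thesis
      using pm.curv_on_killing[OF tensor_field_multilinear[OF tensor_field_nabla2[OF t] p]
          killing_hook_symmetries[OF killing p], of x y a b c]
        curvature_on_derivative[OF t first p, of x y a b c] second p
      by (simp add: second_equation_def flat_eq pm.curv_on_def)
  qed
  ultimately show "\<kappa> \<in> nullity_killing_tensors M g"
    using killing unfolding nullity_killing_tensors_iff by blast
  show "C = C_of M g \<kappa>"
  proof (intro ext)
    fix p and xs :: "'e list"
    show "C p xs = C_of M g \<kappa> p xs"
    proof (cases "p \<in> points M \<and> length xs = 4")
      case True
      then have "\<forall>a b c d. C p [a, b, c, d] = C_of M g \<kappa> p [a, b, c, d]"
        using first_equation_C_of[OF sf first _ symC] by simp
      then show ?thesis using True all_length4[of "\<lambda>xs. C p xs = C_of M g \<kappa> p xs"] by blast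
    next
      case False
      then have "C p xs = 0"
        using tC multilinear_length[OF tensor_field_multilinear[OF tC], of p xs]
        by (cases "p \<in> points M") (simp_all add: tensor_field_def)
      then show ?thesis using False C_of_degenerate[OF t, of p xs] by auto
    qed
  qed
qed

end

section \<open>Tensors on the cone\<close>

text \<open>Every symmetrized curvature tensor on \<open>V \<times> \<real>\<close> has this form; on the cone the powers of the
  radius are those of a parallel tensor.\<close>

definition cone_form :: "real \<Rightarrow> 'v tensor \<Rightarrow> 'v tensor \<Rightarrow> 'v tensor \<Rightarrow> ('v \<times> real) tensor" where
  "cone_form r \<kappa> \<beta> C Xs = (case Xs of
     [(y1, t1), (y2, t2), (y3, t3), (y4, t4)] \<Rightarrow>
       r^2 * (2 * t1 * t2 * \<kappa> [y3, y4] + 2 * t3 * t4 * \<kappa> [y1, y2] - t1 * t3 * \<kappa> [y2, y4]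
         - t1 * t4 * \<kappa> [y2, y3] - t2 * t3 * \<kappa> [y1, y4] - t2 * t4 * \<kappa> [y1, y3])
       + r^3 * (t1 * \<beta> [y2, y3, y4] + t2 * \<beta> [y1, y3, y4] + t3 * \<beta> [y4, y1, y2] + t4 * \<beta> [y3, y1, y2])
       + r^4 * C [y1, y2, y3, y4]
   | _ \<Rightarrow> 0)"

lemma cone_form_wrong_length: "length Xs \<noteq> 4 \<Longrightarrow> cone_form r \<kappa> \<beta> C Xs = 0"
  by (auto simp: cone_form_def split: list.split)

lemma cone_form_map:
  "cone_form r \<kappa> \<beta> C (map (\<lambda>X. (F (fst X), snd X)) Xs) =
    cone_form r (\<lambda>xs. \<kappa> (map F xs)) (\<lambda>xs. \<beta> (map F xs)) (\<lambda>xs. C (map F xs)) Xs"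
  by (auto simp: cone_form_def split: list.split)

lemma cone_form_cong:
  assumes "\<And>a b. \<kappa> [a, b] = \<kappa>' [a, b]" "\<And>a b c. \<beta> [a, b, c] = \<beta>' [a, b, c]"
    "\<And>a b c d. C [a, b, c, d] = C' [a, b, c, d]"
  shows "cone_form r \<kappa> \<beta> C Xs = cone_form r \<kappa>' \<beta>' C' Xs"
  by (auto simp: cone_form_def assms split: list.split)

lemma cone_form_zero:
  assumes "\<And>a b. \<kappa> [a, b] = 0" "\<And>a b c. \<beta> [a, b, c] = 0" "\<And>a b c d. C [a, b, c, d] = 0"
  shows "cone_form r \<kappa> \<beta> C Xs = 0"
  by (auto simp: cone_form_def assms split: list.split)

lemma cone_form_minus:
  "cone_form r \<kappa> \<beta> C Xs - cone_form r \<kappa>' \<beta>' C' Xs =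
    cone_form r (\<lambda>xs. \<kappa> xs - \<kappa>' xs) (\<lambda>xs. \<beta> xs - \<beta>' xs) (\<lambda>xs. C xs - C' xs) Xs"
  by (auto simp: cone_form_def algebra_simps split: list.split)

lemma cone_form_multilinear:
  assumes "multilinear 2 \<kappa>" "multilinear 3 \<beta>" "multilinear 4 C"
  shows "multilinear 4 (cone_form r \<kappa> \<beta> C)"
proof -
  note mult = multilinear_distrib2[OF assms(1)] multilinear_distrib3[OF assms(2)] multilinear_distrib4[OF assms(3)]
  have "linear (\<lambda>X. cone_form r \<kappa> \<beta> C [X, X2, X3, X4])" "linear (\<lambda>X. cone_form r \<kappa> \<beta> C [X1, X, X3, X4])"
    "linear (\<lambda>X. cone_form r \<kappa> \<beta> C [X1, X2, X, X4])" "linear (\<lambda>X. cone_form r \<kappa> \<beta> C [X1, X2, X3, X])"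
    for X1 X2 X3 X4
    by (cases X1; cases X2; cases X3; cases X4; rule linearI;
        clarsimp simp: cone_form_def mult algebra_simps)+
  then show ?thesis by (rule multilinear4I) (rule cone_form_wrong_length)
qed

lemma cone_form_symmetries:
  assumes \<kappa>: "\<And>x y. \<kappa> [x, y] = \<kappa> [y, x]" and \<beta>: "hook_symmetries (\<lambda>x y z. \<beta> [x, y, z])"
    and C: "curvature_symmetries (\<lambda>x y z w. C [x, y, z, w])"
  shows "curvature_symmetries (\<lambda>X Y Z W. cone_form r \<kappa> \<beta> C [X, Y, Z, W])"
proof (rule curvature_symmetriesI)
  note h = hook_symmetriesD[OF \<beta>] and c = curvature_symmetriesD[OF C]
  fix X1 X2 X3 X4 :: "'a \<times> real"
  obtain y1 t1 y2 t2 y3 t3 y4 t4 where X: "X1 = (y1, t1)" "X2 = (y2, t2)" "X3 = (y3, t3)" "X4 = (y4, t4)"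
    by (metis surj_pair)
  show "cone_form r \<kappa> \<beta> C [X1, X2, X3, X4] = cone_form r \<kappa> \<beta> C [X2, X1, X3, X4]"
    using \<kappa>[of y1 y2] h(1)[of y4 y1 y2] h(1)[of y3 y1 y2] c(1)[of y1 y2 y3 y4]
    by (simp add: X cone_form_def algebra_simps)
  show "cone_form r \<kappa> \<beta> C [X1, X2, X3, X4] = cone_form r \<kappa> \<beta> C [X1, X2, X4, X3]"
    using \<kappa>[of y3 y4] h(1)[of y1 y3 y4] h(1)[of y2 y3 y4] c(2)[of y1 y2 y3 y4]
    by (simp add: X cone_form_def algebra_simps)
  have b: "\<beta> [y4, y2, y3] = \<beta> [y4, y3, y2]" "\<beta> [y4, y3, y1] = \<beta> [y4, y1, y3]" "\<beta> [y2, y3, y4] = \<beta> [y2, y4, y3]"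
    "\<beta> [y1, y3, y4] = \<beta> [y1, y4, y3]" "\<beta> [y3, y2, y4] = \<beta> [y3, y4, y2]" "\<beta> [y3, y1, y4] = \<beta> [y3, y4, y1]"
    "\<beta> [y2, y1, y4] = \<beta> [y2, y4, y1]" "\<beta> [y1, y2, y4] = \<beta> [y1, y4, y2]"
    using h(1) by blast+
  have k: "\<kappa> [y3, y1] = \<kappa> [y1, y3]" "\<kappa> [y3, y2] = \<kappa> [y2, y3]" "\<kappa> [y2, y1] = \<kappa> [y1, y2]" using \<kappa> by blast+
  have "t1 * (\<beta> [y2, y3, y4] + \<beta> [y3, y4, y2] + \<beta> [y4, y2, y3]) = 0"
    "t2 * (\<beta> [y1, y3, y4] + \<beta> [y3, y4, y1] + \<beta> [y4, y1, y3]) = 0"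
    "t3 * (\<beta> [y1, y2, y4] + \<beta> [y2, y4, y1] + \<beta> [y4, y1, y2]) = 0"
    by (simp_all only: h(2) mult_zero_right)
  then have "t1 * (\<beta> [y2, y3, y4] + \<beta> [y3, y2, y4] + \<beta> [y4, y2, y3])
      + t2 * (\<beta> [y1, y3, y4] + \<beta> [y3, y1, y4] + \<beta> [y4, y3, y1])
      + t3 * (\<beta> [y4, y1, y2] + \<beta> [y1, y2, y4] + \<beta> [y2, y1, y4])
      + t4 * (\<beta> [y3, y1, y2] + \<beta> [y1, y2, y3] + \<beta> [y2, y3, y1]) = 0"
    using h(2)[of y3 y1 y2] by (simp only: b) (simp add: algebra_simps)
  moreover have "C [y1, y2, y3, y4] + C [y2, y3, y1, y4] + C [y3, y1, y2, y4] = 0" by (rule c(4))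
  moreover have "cone_form r \<kappa> \<beta> C [X1, X2, X3, X4] + cone_form r \<kappa> \<beta> C [X2, X3, X1, X4]
      + cone_form r \<kappa> \<beta> C [X3, X1, X2, X4] =
    r^3 * (t1 * (\<beta> [y2, y3, y4] + \<beta> [y3, y2, y4] + \<beta> [y4, y2, y3])
      + t2 * (\<beta> [y1, y3, y4] + \<beta> [y3, y1, y4] + \<beta> [y4, y3, y1])
      + t3 * (\<beta> [y4, y1, y2] + \<beta> [y1, y2, y4] + \<beta> [y2, y1, y4])
      + t4 * (\<beta> [y3, y1, y2] + \<beta> [y1, y2, y3] + \<beta> [y2, y3, y1]))
    + r^4 * (C [y1, y2, y3, y4] + C [y2, y3, y1, y4] + C [y3, y1, y2, y4])"
    by (simp add: X cone_form_def k algebra_simps)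
  ultimately show "cone_form r \<kappa> \<beta> C [X1, X2, X3, X4] + cone_form r \<kappa> \<beta> C [X2, X3, X1, X4]
      + cone_form r \<kappa> \<beta> C [X3, X1, X2, X4] = 0" by simp
qed

text \<open>By the symmetries, components with three radial arguments vanish and those with one or two
  are determined by the ones where the radial arguments come first.\<close>

lemma curvature_cone_form:
  fixes S :: "('v::real_vector \<times> real) tensor"
  assumes m: "multilinear 4 S" and s: "curvature_symmetries (\<lambda>X Y Z W. S [X, Y, Z, W])"
    and k: "\<And>a b. S [(0, 1), (0, 1), (a, 0), (b, 0)] = 2 * r^2 * \<kappa> [a, b]"
    and b: "\<And>a b c. S [(0, 1), (a, 0), (b, 0), (c, 0)] = r^3 * \<beta> [a, b, c]"
    and c: "\<And>a b c d. S [(a, 0), (b, 0), (c, 0), (d, 0)] = r^4 * C [a, b, c, d]"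
  shows "S Xs = cone_form r \<kappa> \<beta> C Xs"
proof (cases "length Xs = 4")
  case False
  then show ?thesis using multilinear_length[OF m] cone_form_wrong_length by metis
next
  case True
  note sy = curvature_symmetriesD[OF s]
  let ?E = "(0, 1) :: 'v \<times> real" and ?H = "\<lambda>y. (y, 0) :: 'v \<times> real"
  have EEE: "S [?E, ?E, ?E, X] = 0" for X using sy(4)[of ?E ?E ?E X] by simp
  have e1: "S [?E, ?E, X, ?E] = 0" "S [?E, X, ?E, ?E] = 0" "S [X, ?E, ?E, ?E] = 0" for X
    using EEE[of X] sy(2)[of ?E ?E X ?E] sy(3)[of ?E X ?E ?E] sy(1)[of X ?E ?E ?E] by simp_all
  have EaEb: "S [?E, ?H x, ?E, ?H y] = - (r^2 * \<kappa> [x, y])" for x y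
    using sy(4)[of ?E "?H x" ?E "?H y"] sy(1)[of "?H x" ?E ?E "?H y"] k[of x y] by simp
  have e2: "S [?H x, ?E, ?E, ?H y] = - (r^2 * \<kappa> [x, y])" "S [?E, ?H x, ?H y, ?E] = - (r^2 * \<kappa> [x, y])"
    "S [?H x, ?E, ?H y, ?E] = - (r^2 * \<kappa> [x, y])" "S [?H x, ?H y, ?E, ?E] = 2 * r^2 * \<kappa> [x, y]" for x y
    using EaEb[of x y] k[of x y] sy(1)[of "?H x" ?E ?E "?H y"] sy(2)[of ?E "?H x" "?H y" ?E]
      sy(1)[of "?H x" ?E "?H y" ?E] sy(3)[of "?H x" "?H y" ?E ?E] by simp_all
  have e3: "S [?H x, ?E, ?H y, ?H z] = r^3 * \<beta> [x, y, z]" "S [?H x, ?H y, ?E, ?H z] = r^3 * \<beta> [z, x, y]"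
    "S [?H x, ?H y, ?H z, ?E] = r^3 * \<beta> [z, x, y]" for x y z
    using b[of x y z] b[of z x y] sy(1)[of "?H x" ?E "?H y" "?H z"] sy(3)[of "?H x" "?H y" ?E "?H z"]
      sy(2)[of "?H x" "?H y" "?H z" ?E] by simp_all
  have split: "(y, t) = ?H y + t *\<^sub>R ?E" for y t by simp
  note add = multilinear4D[OF m, THEN linear_add] multilinear4D[OF m, THEN linear_scale]
  have "\<forall>Xs. length Xs = 4 \<longrightarrow> S Xs = cone_form r \<kappa> \<beta> C Xs"
    unfolding all_length4
  proof (intro allI)
    fix X1 X2 X3 X4 :: "'v \<times> real"
    obtain y1 t1 y2 t2 y3 t3 y4 t4 where X: "X1 = (y1, t1)" "X2 = (y2, t2)" "X3 = (y3, t3)" "X4 = (y4, t4)"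
      by (metis surj_pair)
    have "S [X1, X2, X3, X4] =
        S [?H y1 + t1 *\<^sub>R ?E, ?H y2 + t2 *\<^sub>R ?E, ?H y3 + t3 *\<^sub>R ?E, ?H y4 + t4 *\<^sub>R ?E]"
      unfolding X by simp
    also have "\<dots> = cone_form r \<kappa> \<beta> C [X1, X2, X3, X4]"
      unfolding add EEE e1 EaEb e2 e3 k b c
      by (simp add: X cone_form_def algebra_simps)
    finally show "S [X1, X2, X3, X4] = cone_form r \<kappa> \<beta> C [X1, X2, X3, X4]" .
  qed
  then show ?thesis using True by blast
qed

text \<open>With \<open>t\<^sub>i = r q\<^sub>i\<close> the radius factors out, so that identities between cone forms need to be
  checked at \<open>r = 1\<close> only.\<close>

lemma cone_form_scale:
  "cone_form r \<kappa> \<beta> C [(y1, r * q1), (y2, r * q2), (y3, r * q3), (y4, r * q4)] =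
    r^4 * cone_form 1 \<kappa> \<beta> C [(y1, q1), (y2, q2), (y3, q3), (y4, q4)]"
  by (simp add: cone_form_def algebra_simps power2_eq_square power3_eq_cube power4_eq_xxxx)

text \<open>The connection of the cone in a horizontal direction \<open>x\<close> consists of the Christoffel symbols \<open>\<Gamma>\<close> of the
  base and of two terms which exchange \<open>\<partial>\<^sub>r\<close> with horizontal vectors. The latter shift the
  components: \<open>\<beta>\<close> contributes to the component \<open>\<kappa>'\<close>, \<open>\<kappa>\<close> and \<open>C\<close> to \<open>\<beta>'\<close>, and \<open>\<beta>\<close> to \<open>C'\<close>.\<close>

lemma cone_form_connection_unit:
  fixes \<kappa> :: "'v::euclidean_space tensor"
  assumes m: "multilinear 2 \<kappa>" "multilinear 3 \<beta>" "multilinear 4 C"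
    and \<kappa>: "\<And>x y. \<kappa> [x, y] = \<kappa> [y, x]" and \<beta>: "hook_symmetries (\<lambda>x y z. \<beta> [x, y, z])"
    and C: "curvature_symmetries (\<lambda>x y z w. C [x, y, z, w])"
    and \<kappa>': "\<And>a b. \<kappa>' [a, b] = \<kappa> [\<Gamma> a, b] + \<kappa> [a, \<Gamma> b] + \<beta> [x, a, b]"
    and \<beta>': "\<And>a b c. \<beta>' [a, b, c] = \<beta> [\<Gamma> a, b, c] + \<beta> [a, \<Gamma> b, c] + \<beta> [a, b, \<Gamma> c]
      + C [x, a, b, c] - 2 * odot21 \<kappa> l [a, b, c]"
    and C': "\<And>a b c d. C' [a, b, c, d] = C [\<Gamma> a, b, c, d] + C [a, \<Gamma> b, c, d] + C [a, b, \<Gamma> c, d]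
      + C [a, b, c, \<Gamma> d] - odot31 \<beta> l [a, b, c, d]"
  shows "cone_form 1 \<kappa> \<beta> C [(\<Gamma> y1 + q1 *\<^sub>R x, - l y1), (y2, q2), (y3, q3), (y4, q4)]
    + cone_form 1 \<kappa> \<beta> C [(y1, q1), (\<Gamma> y2 + q2 *\<^sub>R x, - l y2), (y3, q3), (y4, q4)]
    + cone_form 1 \<kappa> \<beta> C [(y1, q1), (y2, q2), (\<Gamma> y3 + q3 *\<^sub>R x, - l y3), (y4, q4)]
    + cone_form 1 \<kappa> \<beta> C [(y1, q1), (y2, q2), (y3, q3), (\<Gamma> y4 + q4 *\<^sub>R x, - l y4)]
    = cone_form 1 \<kappa>' \<beta>' C' [(y1, q1), (y2, q2), (y3, q3), (y4, q4)]"
proof -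
  note mult = multilinear_distrib2[OF m(1)] multilinear_distrib3[OF m(2)] multilinear_distrib4[OF m(3)]
  note h = hook_symmetriesD[OF \<beta>] and c = curvature_symmetriesD[OF C]
  have hook: "\<beta> [a, x, b] + \<beta> [b, x, a] = - \<beta> [x, a, b]" for a b
    using h(2)[of x a b] h(1)[of a b x] by (simp add: add_eq_0_iff)
  have "q1 * q3 * (\<beta> [y2, x, y4] + \<beta> [y4, x, y2]) = - (q1 * q3 * \<beta> [x, y2, y4])"
    "q1 * q4 * (\<beta> [y2, x, y3] + \<beta> [y3, x, y2]) = - (q1 * q4 * \<beta> [x, y2, y3])"
    "q2 * q3 * (\<beta> [y1, x, y4] + \<beta> [y4, x, y1]) = - (q2 * q3 * \<beta> [x, y1, y4])"
    "q2 * q4 * (\<beta> [y1, x, y3] + \<beta> [y3, x, y1]) = - (q2 * q4 * \<beta> [x, y1, y3])"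
    by (simp_all only: hook mult_minus_right)
  moreover have "\<beta> [y1, y3, x] = \<beta> [y1, x, y3]" "\<beta> [y2, y3, x] = \<beta> [y2, x, y3]"
    "\<beta> [y3, y1, x] = \<beta> [y3, x, y1]" "\<beta> [y4, y1, x] = \<beta> [y4, x, y1]"
    "\<beta> [y3, y2, x] = \<beta> [y3, x, y2]" "\<beta> [y4, y2, x] = \<beta> [y4, x, y2]" using h(1) by blast+
  moreover have "C [y1, x, y3, y4] = C [x, y1, y3, y4]" by (rule c(1))
  moreover have "C [y1, y2, x, y4] = C [x, y4, y1, y2]" by (rule c(3))
  moreover have "C [y1, y2, y3, x] = C [x, y3, y1, y2]" using c(3)[of y1 y2 y3 x] c(1)[of y3 x y1 y2] by simp
  moreover have "\<kappa> [y1, x] = \<kappa> [x, y1]" "\<kappa> [y2, x] = \<kappa> [x, y2]" "\<kappa> [y3, x] = \<kappa> [x, y3]" "\<kappa> [y4, x] = \<kappa> [x, y4]"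
    "\<kappa> [y2, y1] = \<kappa> [y1, y2]" "\<kappa> [y4, y1] = \<kappa> [y1, y4]" "\<kappa> [y4, y2] = \<kappa> [y2, y4]" "\<kappa> [y3, y1] = \<kappa> [y1, y3]"
    "\<kappa> [y3, y2] = \<kappa> [y2, y3]" "\<kappa> [y4, y3] = \<kappa> [y3, y4]"
    using \<kappa> by blast+
  ultimately show ?thesis
    by (simp add: cone_form_def \<kappa>' \<beta>' C' odot21_def odot31_hook[OF \<beta>] mult algebra_simps)
qed

lemma cone_form_connection:
  fixes \<kappa> :: "'v::euclidean_space tensor"
  assumes r: "r > 0"
    and m: "multilinear 2 \<kappa>" "multilinear 3 \<beta>" "multilinear 4 C"
    and \<kappa>: "\<And>x y. \<kappa> [x, y] = \<kappa> [y, x]" and \<beta>: "hook_symmetries (\<lambda>x y z. \<beta> [x, y, z])"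
    and C: "curvature_symmetries (\<lambda>x y z w. C [x, y, z, w])"
    and \<kappa>': "\<And>a b. \<kappa>' [a, b] = \<kappa> [\<Gamma> a, b] + \<kappa> [a, \<Gamma> b] + \<beta> [x, a, b]"
    and \<beta>': "\<And>a b c. \<beta>' [a, b, c] = \<beta> [\<Gamma> a, b, c] + \<beta> [a, \<Gamma> b, c] + \<beta> [a, b, \<Gamma> c]
      + C [x, a, b, c] - 2 * odot21 \<kappa> l [a, b, c]"
    and C': "\<And>a b c d. C' [a, b, c, d] = C [\<Gamma> a, b, c, d] + C [a, \<Gamma> b, c, d] + C [a, b, \<Gamma> c, d]
      + C [a, b, c, \<Gamma> d] - odot31 \<beta> l [a, b, c, d]"
    and Ys: "length Ys = 4"
  shows "(\<Sum>i<4. cone_form r \<kappa> \<beta> C (Ys[i := (\<Gamma> (fst (Ys ! i)) + (snd (Ys ! i) / r) *\<^sub>R x, - r * l (fst (Ys ! i)))]))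
    = cone_form r \<kappa>' \<beta>' C' Ys"
proof -
  have "\<forall>Ys. length Ys = 4 \<longrightarrow>
    (\<Sum>i<4. cone_form r \<kappa> \<beta> C (Ys[i := (\<Gamma> (fst (Ys ! i)) + (snd (Ys ! i) / r) *\<^sub>R x, - r * l (fst (Ys ! i)))]))
    = cone_form r \<kappa>' \<beta>' C' Ys"
    unfolding all_length4
  proof (intro allI)
    fix X1 X2 X3 X4 :: "'v \<times> real"
    define q1 q2 q3 q4 where "q1 = snd X1 / r" "q2 = snd X2 / r" "q3 = snd X3 / r" "q4 = snd X4 / r"
    define y1 y2 y3 y4 where "y1 = fst X1" "y2 = fst X2" "y3 = fst X3" "y4 = fst X4"
    have X: "X1 = (y1, r * q1)" "X2 = (y2, r * q2)" "X3 = (y3, r * q3)" "X4 = (y4, r * q4)"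
      using r by (simp_all add: q1_q2_q3_q4_def y1_y2_y3_y4_def)

    have "cone_form r \<kappa> \<beta> C [(\<Gamma> y1 + q1 *\<^sub>R x, r * - l y1), (y2, r * q2), (y3, r * q3), (y4, r * q4)]
      + cone_form r \<kappa> \<beta> C [(y1, r * q1), (\<Gamma> y2 + q2 *\<^sub>R x, r * - l y2), (y3, r * q3), (y4, r * q4)]
      + cone_form r \<kappa> \<beta> C [(y1, r * q1), (y2, r * q2), (\<Gamma> y3 + q3 *\<^sub>R x, r * - l y3), (y4, r * q4)]
      + cone_form r \<kappa> \<beta> C [(y1, r * q1), (y2, r * q2), (y3, r * q3), (\<Gamma> y4 + q4 *\<^sub>R x, r * - l y4)]
      = cone_form r \<kappa>' \<beta>' C' [(y1, r * q1), (y2, r * q2), (y3, r * q3), (y4, r * q4)]"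
      unfolding cone_form_scale distrib_left[symmetric]
      by (simp only: cone_form_connection_unit[OF m \<kappa> \<beta> C \<kappa>' \<beta>' C'])
    then show "(\<Sum>i<4. cone_form r \<kappa> \<beta> C ([X1, X2, X3, X4][i := (\<Gamma> (fst ([X1, X2, X3, X4] ! i))
        + (snd ([X1, X2, X3, X4] ! i) / r) *\<^sub>R x, - r * l (fst ([X1, X2, X3, X4] ! i)))]))
      = cone_form r \<kappa>' \<beta>' C' [X1, X2, X3, X4]"
      using r by (simp add: X eval_nat_numeral)
  qed
  then show ?thesis using Ys by blast
qed

text \<open>The powers of \<open>r\<close> in a cone form count its horizontal arguments, just as the connection in the
  radial direction does.\<close>

lemma cone_form_radial:
  assumes r: "r > 0" and m: "multilinear 4 (cone_form r \<kappa> \<beta> C)" and Ys: "length Ys = 4"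
  shows "((\<lambda>\<rho>. cone_form \<rho> \<kappa> \<beta> C Ys) has_real_derivative
    (\<Sum>i<4. cone_form r \<kappa> \<beta> C (Ys[i := ((1 / r) *\<^sub>R fst (Ys ! i), 0)]))) (at r)"
proof -
  have "\<forall>Ys. length Ys = 4 \<longrightarrow> ((\<lambda>\<rho>. cone_form \<rho> \<kappa> \<beta> C Ys) has_real_derivative
    (\<Sum>i<4. cone_form r \<kappa> \<beta> C (Ys[i := ((1 / r) *\<^sub>R fst (Ys ! i), 0)]))) (at r)"
    unfolding all_length4
  proof (intro allI)
    fix X1 X2 X3 X4 :: "'a \<times> real"

    obtain y1 t1 y2 t2 y3 t3 y4 t4 where X: "X1 = (y1, t1)" "X2 = (y2, t2)" "X3 = (y3, t3)" "X4 = (y4, t4)"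
      by (metis surj_pair)
    define a where "a = 2 * t1 * t2 * \<kappa> [y3, y4] + 2 * t3 * t4 * \<kappa> [y1, y2] - t1 * t3 * \<kappa> [y2, y4]
         - t1 * t4 * \<kappa> [y2, y3] - t2 * t3 * \<kappa> [y1, y4] - t2 * t4 * \<kappa> [y1, y3]"
    define b where "b = t1 * \<beta> [y2, y3, y4] + t2 * \<beta> [y1, y3, y4] + t3 * \<beta> [y4, y1, y2] + t4 * \<beta> [y3, y1, y2]"
    define c where "c = C [y1, y2, y3, y4]"
    have "(\<Sum>i<4. cone_form r \<kappa> \<beta> C ([X1, X2, X3, X4][i := ((1 / r) *\<^sub>R fst ([X1, X2, X3, X4] ! i), 0)])) =
        (1 / r) * (cone_form r \<kappa> \<beta> C [(y1, 0), X2, X3, X4] + cone_form r \<kappa> \<beta> C [X1, (y2, 0), X3, X4]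
          + cone_form r \<kappa> \<beta> C [X1, X2, (y3, 0), X4] + cone_form r \<kappa> \<beta> C [X1, X2, X3, (y4, 0)])"
    proof -
      have "(\<Sum>i<4. cone_form r \<kappa> \<beta> C ([X1, X2, X3, X4][i := ((1 / r) *\<^sub>R fst ([X1, X2, X3, X4] ! i), 0)])) =
          cone_form r \<kappa> \<beta> C [(1 / r) *\<^sub>R (y1, 0), X2, X3, X4] + cone_form r \<kappa> \<beta> C [X1, (1 / r) *\<^sub>R (y2, 0), X3, X4]
          + cone_form r \<kappa> \<beta> C [X1, X2, (1 / r) *\<^sub>R (y3, 0), X4] + cone_form r \<kappa> \<beta> C [X1, X2, X3, (1 / r) *\<^sub>R (y4, 0)]"
        by (simp add: eval_nat_numeral X)
      then show ?thesis
        unfolding multilinear4D[OF m, THEN linear_scale] by (simp add: distrib_left)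
    qed
    also have "\<dots> = (1 / r) * (2 * r^2 * a + 3 * r^3 * b + 4 * r^4 * c)"
      by (simp add: X cone_form_def a_def b_def c_def algebra_simps)
    also have "\<dots> = 2 * r * a + 3 * r^2 * b + 4 * r^3 * c"
      using r by (simp add: field_simps power2_eq_square power3_eq_cube power4_eq_xxxx)
    finally have eq: "(\<Sum>i<4. cone_form r \<kappa> \<beta> C ([X1, X2, X3, X4][i := ((1 / r) *\<^sub>R fst ([X1, X2, X3, X4] ! i), 0)])) =
        2 * r * a + 3 * r^2 * b + 4 * r^3 * c" .
    have "((\<lambda>\<rho>. \<rho>^2 * a + \<rho>^3 * b + \<rho>^4 * c) has_real_derivative (2 * r * a + 3 * r^2 * b + 4 * r^3 * c)) (at r)"
      by (auto intro!: derivative_eq_intros simp: algebra_simps)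
    moreover have "(\<lambda>\<rho>. cone_form \<rho> \<kappa> \<beta> C [X1, X2, X3, X4]) = (\<lambda>\<rho>. \<rho>^2 * a + \<rho>^3 * b + \<rho>^4 * c)"
      by (simp add: X cone_form_def a_def b_def c_def)
    ultimately show "((\<lambda>\<rho>. cone_form \<rho> \<kappa> \<beta> C [X1, X2, X3, X4]) has_real_derivative
        (\<Sum>i<4. cone_form r \<kappa> \<beta> C ([X1, X2, X3, X4][i := ((1 / r) *\<^sub>R fst ([X1, X2, X3, X4] ! i), 0)]))) (at r)"
      unfolding eq by simp
  qed
  then show ?thesis using Ys by blast
qed

section \<open>The geometry of the cone\<close>

context metric_manifold
begin

abbreviation CM :: "('a \<times> real, 'e \<times> real) manifold" where "CM \<equiv> cone_manifold M"

abbreviation cg :: "'a \<times> real \<Rightarrow> ('e \<times> real) tensor" where "cg \<equiv> cone_metric M g"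

lemma points_cone: "points CM = points M \<times> {0<..}"
  by (simp add: cone_manifold_def)

lemma chart_at_cone: "chart_at CM (p, r) = cone_chart (chart_at M p)"
  by (simp add: cone_manifold_def)

lemma atlas_cone: "atlas CM = cone_chart ` atlas M"
  by (simp add: cone_manifold_def)

lemma chart_image_cone: "chart_image (cone_chart c) = chart_image c \<times> {0<..}"
  by (force simp: chart_image_def cone_chart_def)

lemma chart_inv_cone:
  assumes c: "c \<in> atlas M" and u: "u \<in> chart_image c" and r: "r > 0"
  shows "chart_inv (cone_chart c) (u, r) = (chart_inv c u, r)"
  unfolding chart_inv_def
proof (rule inv_into_f_eq)
  show "inj_on (snd (cone_chart c)) (fst (cone_chart c))"
    using chart_inj[OF c] by (auto simp: cone_chart_def inj_on_def)
  show "(inv_into (fst c) (snd c) u, r) \<in> fst (cone_chart c)"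
    using chart_inv_in[OF u] r by (simp add: cone_chart_def chart_inv_def)
  show "snd (cone_chart c) (inv_into (fst c) (snd c) u, r) = (u, r)"
    using chart_inv_right[OF u] by (simp add: cone_chart_def chart_inv_def)
qed


lemma open_cone_chart: "c \<in> atlas M \<Longrightarrow> open (chart_image c \<times> {0::real<..})"
  by (intro open_Times chart_open) auto

lemma frame_cone:
  assumes c: "c \<in> atlas M" and u: "u \<in> chart_image c" and r: "r > 0"
  shows "frame CM (cone_chart c) (u, r) = (\<lambda>X. (frame M c u (fst X), snd X))"
proof -
  let ?c' = "chart_at M (chart_inv c u)"
  have "(transition c ?c' has_derivative frame M c u) (at u)"
    using smooth_on_has_derivative[OF transition_smooth[OF c chart_at(1)[OF chart_inv_point[OF c u]]]
        transition_derivative(1)[OF c u]] by (simp only: transition_derivative(3)[OF c u])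
  then have "(transition c ?c' has_derivative frame M c u) (at (fst (u, r)))" by simp
  from diff_chain_at[OF bounded_linear_imp_has_derivative[OF bounded_linear_fst] this]
  have "((\<lambda>z. transition c ?c' (fst z)) has_derivative (\<lambda>X. frame M c u (fst X))) (at (u, r))"
    by (simp add: o_def)
  then have "((\<lambda>z. (transition c ?c' (fst z), snd z)) has_derivative (\<lambda>X. (frame M c u (fst X), snd X))) (at (u, r))"
    by (intro has_derivative_Pair bounded_linear_imp_has_derivative[OF bounded_linear_snd])
  then have "(snd (cone_chart ?c') \<circ> chart_inv (cone_chart c) has_derivative (\<lambda>X. (frame M c u (fst X), snd X))) (at (u, r))"
    by (rule has_derivative_transform_within_open[OF _ open_cone_chart[OF c]])
      (use u r in \<open>auto simp: chart_inv_cone[OF c], simp add: cone_chart_def\<close>)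
  then show ?thesis
    unfolding frame_def chart_inv_cone[OF assms] chart_at_cone by (rule frechet_derivative_at[symmetric])
qed

lemma in_chart_cone:
  assumes "c \<in> atlas M" "u \<in> chart_image c" "r > 0"
  shows "in_chart CM (cone_chart c) S (u, r) Xs = S (chart_inv c u, r) (map (\<lambda>X. (frame M c u (fst X), snd X)) Xs)"
  by (simp add: in_chart_def chart_inv_cone[OF assms] frame_cone[OF assms])

lemma in_chart_at_cone:
  assumes "p \<in> points M" "r > 0"
  shows "in_chart CM (cone_chart (chart_at M p)) S (snd (chart_at M p) p, r) Xs = S (p, r) Xs"
  using in_chart_cone[OF chart_at(1)[OF assms(1)] chart_at_image[OF assms(1)] assms(2)]
  by (simp add: chart_at_inv[OF assms(1)] frame_chart_at[OF assms(1)])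

lemma frame_cone_linear:
  "c \<in> atlas M \<Longrightarrow> u \<in> chart_image c \<Longrightarrow> linear (\<lambda>X. (frame M c u (fst X), snd X :: real))"
  using frame_linear[of c u]
  by (intro linearI) (auto simp: linear_add linear_scale)

lemma local_tensor_cone:
  assumes S: "tensor_field CM k S" and c: "c \<in> atlas M"
  shows "local_tensor (chart_image c \<times> {0<..}) k (in_chart CM (cone_chart c) S)"
proof
  show "open (chart_image c \<times> {0::real<..})" by (rule open_cone_chart[OF c])
  fix z assume "z \<in> chart_image c \<times> {0::real<..}"
  then obtain u r where z: "z = (u, r)" "u \<in> chart_image c" "r > 0" by auto
  have m: "multilinear k (S (chart_inv c u, r))"
    using S chart_inv_point[OF c z(2)] z(3) by (simp add: tensor_field_def points_cone)
  show "multilinear k (in_chart CM (cone_chart c) S z)"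
    unfolding multilinear_def z(1) in_chart_cone[OF c z(2,3)]
    using linear_compose[OF frame_cone_linear[OF c z(2)] multilinear_linear[OF m]] multilinear_length[OF m]
    by (auto simp: map_update o_def)
next
  show "smooth_on (chart_image c \<times> {0<..}) (\<lambda>z. in_chart CM (cone_chart c) S z Xs)" if "length Xs = k" for Xs
    using S c that unfolding tensor_field_def atlas_cone chart_image_cone[symmetric] by blast
qed

lemma in_chart_cone_metric:
  assumes "c \<in> atlas M" "u \<in> chart_image c" "r > 0"
  shows "in_chart CM (cone_chart c) cg (u, r) [X, Y] = r^2 * in_chart M c g u [fst X, fst Y] + snd X * snd Y"
  using chart_inv_point[OF assms(1,2)] assms(3)
  unfolding in_chart_cone[OF assms]
  by (simp add: cone_metric_def pullback_def bullet_def dr_def in_chart_def)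

lemma cone_metric_wrong_length:
  "length Xs \<noteq> 2 \<Longrightarrow> cg q Xs = 0"
  using multilinear_length[OF tensor_field_multilinear[OF tensor_field_g]]
  by (auto simp: cone_metric_def pullback_def bullet_def split: list.split)

lemma smooth_on_fst:
  fixes h :: "'e \<Rightarrow> real"
  assumes "open U" "smooth_on U h"
  shows "smooth_on (U \<times> {0::real<..}) (\<lambda>z. h (fst z))"
  by (rule smooth_on_compose[OF _ assms(1) _ smooth_on_linear[OF _ bounded_linear_fst smooth_on_ident] assms(2)])
    (auto intro: open_Times assms(1))

lemma smooth_on_snd: "open V \<Longrightarrow> smooth_on V (\<lambda>z::'e \<times> real. snd z)"
  by (rule smooth_on_linear[OF _ bounded_linear_snd smooth_on_ident])

lemma local_metric_cone:
  assumes c: "c \<in> atlas M"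
  shows "local_metric (chart_image c \<times> {0<..}) (in_chart CM (cone_chart c) cg)"
proof
  interpret G: local_metric "chart_image c" "in_chart M c g" by (rule local_metric_g[OF c])
  show op: "open (chart_image c \<times> {0::real<..})" by (rule open_cone_chart[OF c])
  note eq = in_chart_cone_metric[OF c]
  show "smooth_on (chart_image c \<times> {0<..}) (\<lambda>z. in_chart CM (cone_chart c) cg z [X, Y])" for X Y
  proof (rule smooth_on_cong[OF op])
    show "smooth_on (chart_image c \<times> {0<..}) (\<lambda>z. snd z ^ 2 * in_chart M c g (fst z) [fst X, fst Y] + snd X * snd Y)"
      by (intro smooth_on_add smooth_on_mult smooth_on_power smooth_on_const smooth_on_snd
          smooth_on_fst[OF chart_open[OF c]] G.smooth_G op)
  qed (auto simp: eq)
  fix z assume "z \<in> chart_image c \<times> {0::real<..}"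
  then obtain u r where z: "z = (u, r)" "u \<in> chart_image c" "r > 0" by auto
  note b = bilinear_formD[OF G.bilinear_G[OF z(2)]]
  show "in_chart CM (cone_chart c) cg z [X, Y] = in_chart CM (cone_chart c) cg z [Y, X]" for X Y
    by (simp add: z eq G.symmetric_G[OF z(2), of "fst X"])
  have lin: "linear (\<lambda>X. in_chart CM (cone_chart c) cg z [X, Y])" "linear (\<lambda>X. in_chart CM (cone_chart c) cg z [Y, X])" for Y
    by (rule linearI; simp add: z eq b algebra_simps)+
  show "multilinear 2 (in_chart CM (cone_chart c) cg z)"
  proof (rule multilinear2I[OF lin])
    fix xs :: "('e \<times> real) list" assume "length xs \<noteq> 2"
    then show "in_chart CM (cone_chart c) cg z xs = 0"
      unfolding z(1) in_chart_cone[OF c z(2,3)] by (intro cone_metric_wrong_length) simp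
  qed
  show "nondegenerate (\<lambda>X Y. in_chart CM (cone_chart c) cg z [X, Y])"
    unfolding nondegenerate_def
  proof (intro allI impI)
    fix X assume "\<forall>Y. in_chart CM (cone_chart c) cg z [X, Y] = 0"
    then have *: "r^2 * in_chart M c g u [fst X, fst Y] + snd X * snd Y = 0" for Y :: "'e \<times> real"
      using eq[OF z(2,3)] by (simp add: z(1))
    have "snd X = 0" using *[of "(0, 1)"] by (simp add: b)
    moreover have "in_chart M c g u [fst X, y] = 0" for y using *[of "(y, 0)"] z(3) by simp
    then have "fst X = 0" using G.nondegenerate_G[OF z(2)] by (simp add: nondegenerate_def)
    ultimately show "X = 0" by (simp add: prod_eq_iff)
  qed
qed

text \<open>Verified through the characterization of the connection; the terms besides those of the base
  come from the derivative \<open>2 r\<close> of the factor \<open>r\<^sup>2\<close> in the cone metric.\<close>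

lemma christoffel_cone:
  assumes c: "c \<in> atlas M" and u: "u \<in> chart_image c" and r: "r > 0"
  shows "christoffel (in_chart CM (cone_chart c) cg) (u, r) X Y =
    (Chr c u (fst X) (fst Y) + (snd X / r) *\<^sub>R fst Y + (snd Y / r) *\<^sub>R fst X,
     - r * in_chart M c g u [fst X, fst Y])"
proof -
  interpret G: local_metric "chart_image c" "in_chart M c g" by (rule local_metric_g[OF c])
  interpret CG: local_metric "chart_image c \<times> {0<..}" "in_chart CM (cone_chart c) cg"
    by (rule local_metric_cone[OF c])
  define \<Gamma> where "\<Gamma> X Y = (Chr c u (fst X) (fst Y) + (snd X / r) *\<^sub>R fst Y + (snd Y / r) *\<^sub>R fst X,
     - r * in_chart M c g u [fst X, fst Y])" for X Y
  have z: "(u, r) \<in> chart_image c \<times> {0<..}" using u r by simp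
  note b = bilinear_formD[OF G.bilinear_G[OF u]]
  note C1 = G.christoffel_bilinear(1)[OF u] and C2 = G.christoffel_bilinear(2)[OF u]
  have "christoffel_condition (in_chart CM (cone_chart c) cg) (u, r) \<Gamma>"
    unfolding christoffel_condition_def bilinear_def
  proof (intro conjI allI)
    show "linear (\<Gamma> X)" "linear (\<lambda>X. \<Gamma> X Y)" for X Y
      by (rule linearI; simp add: \<Gamma>_def linear_add[OF C1] linear_scale[OF C1] linear_add[OF C2] linear_scale[OF C2]
          b algebra_simps add_divide_distrib)+
    show "\<Gamma> X Y = \<Gamma> Y X" for X Y
      using G.christoffel_symmetric[OF u, of "fst X" "fst Y"] G.symmetric_G[OF u, of "fst X" "fst Y"]
      by (simp add: \<Gamma>_def)
    fix X Y Z :: "'e \<times> real"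

    have D1: "((\<lambda>z. in_chart M c g (fst z) [fst Y, fst Z]) has_derivative (\<lambda>X. G.dG u (fst X) (fst Y) (fst Z))) (at (u, r))"
    proof -
      have "((\<lambda>w. in_chart M c g w [fst Y, fst Z]) has_derivative (\<lambda>X. G.dG u X (fst Y) (fst Z))) (at (fst (u, r)))"
        using G.dG_has_derivative[OF u] by simp
      from diff_chain_at[OF bounded_linear_imp_has_derivative[OF bounded_linear_fst] this]
      show ?thesis by (simp add: o_def)
    qed
    have sq: "((\<lambda>z. snd z ^ 2) has_derivative (\<lambda>X. 2 * r * snd X)) (at (u, r))"
      by (auto intro!: derivative_eq_intros)
    have D2: "((\<lambda>z. snd z ^ 2 * in_chart M c g (fst z) [fst Y, fst Z] + snd Y * snd Z) has_derivative
        (\<lambda>X. r^2 * G.dG u (fst X) (fst Y) (fst Z) + 2 * r * snd X * in_chart M c g u [fst Y, fst Z])) (at (u, r))"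
      using has_derivative_add_const[OF has_derivative_mult[OF sq D1], of "snd Y * snd Z"] by simp
    have "snd w ^ 2 * in_chart M c g (fst w) [fst Y, fst Z] + snd Y * snd Z = in_chart CM (cone_chart c) cg w [Y, Z]"
      if "w \<in> chart_image c \<times> {0<..}" for w :: "'e \<times> real"
      using that in_chart_cone_metric[OF c, of "fst w" "snd w" Y Z] by (simp add: mem_Times_iff)
    from has_derivative_transform_within_open[OF D2 CG.open_U z this]
    have "frechet_derivative (\<lambda>z. in_chart CM (cone_chart c) cg z [Y, Z]) (at (u, r)) X =
        r^2 * G.dG u (fst X) (fst Y) (fst Z) + 2 * r * snd X * in_chart M c g u [fst Y, fst Z]"
      by (rule fun_cong[OF frechet_derivative_at[symmetric]])
    also have "\<dots> = in_chart CM (cone_chart c) cg (u, r) [\<Gamma> X Y, Z] + in_chart CM (cone_chart c) cg (u, r) [Y, \<Gamma> X Z]"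
      using r G.symmetric_G[OF u, of "fst Y" "fst X"]
      by (simp add: in_chart_cone_metric[OF assms] \<Gamma>_def b G.christoffel_metric[OF u] power2_eq_square field_simps)
    finally show "frechet_derivative (\<lambda>z. in_chart CM (cone_chart c) cg z [Y, Z]) (at (u, r)) X =
      in_chart CM (cone_chart c) cg (u, r) [\<Gamma> X Y, Z] + in_chart CM (cone_chart c) cg (u, r) [Y, \<Gamma> X Z]" .
  qed
  from CG.christoffel_eqI[OF z this] show ?thesis by (simp add: \<Gamma>_def)
qed

lemma nabla_cone:
  assumes "p \<in> points M" "r > 0"
  shows "nabla CM cg S (p, r) Xs = local_nabla (christoffel (in_chart CM (cone_chart (chart_at M p)) cg))
    (in_chart CM (cone_chart (chart_at M p)) S) (snd (chart_at M p) p, r) Xs"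
proof -
  have "snd (cone_chart (chart_at M p)) (p, r) = (snd (chart_at M p) p, r)" by (simp add: cone_chart_def)
  then show ?thesis
    using assms by (simp add: nabla_def local_nabla_def levi_civita_christoffel Let_def points_cone
        chart_at_cone split: list.split)
qed

lemma nabla_cone_split:
  assumes S: "tensor_field CM 4 S" and p: "p \<in> points M" and r: "r > 0" and Ys: "length Ys = 4"
  shows "nabla CM cg S (p, r) ((x, s) # Ys) = nabla CM cg S (p, r) ((x, 0) # Ys) + s * nabla CM cg S (p, r) ((0, 1) # Ys)"
proof -
  let ?c = "chart_at M p"
  have z: "(snd ?c p, r) \<in> chart_image ?c \<times> {0<..}" using chart_at_image[OF p] r by simp
  have "bilinear (christoffel (in_chart CM (cone_chart ?c) cg) (snd ?c p, r))"
    using local_metric.christoffel_bilinear[OF local_metric_cone[OF chart_at(1)[OF p]] z] by (simp add: bilinear_def)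
  from multilinear_linear[OF local_tensor.local_nabla_multilinear[where
        \<Gamma> = "christoffel (in_chart CM (cone_chart ?c) cg)", OF local_tensor_cone[OF S chart_at(1)[OF p]] z this],
      of "(0, 0) # Ys" 0]
  have lin: "linear (\<lambda>X. nabla CM cg S (p, r) (X # Ys))"
    using Ys by (simp add: nabla_cone[OF p r])
  have "(x, s) = (x, 0) + s *\<^sub>R (0, 1)" by simp
  then show ?thesis using linear_add[OF lin] linear_scale[OF lin] by (metis real_scaleR_def)
qed

lemma christoffel_cone_at:
  assumes p: "p \<in> points M" and r: "r > 0"
  shows "christoffel (in_chart CM (cone_chart (chart_at M p)) cg) (snd (chart_at M p) p, r) X Y =
    (christ p (fst X) (fst Y) + (snd X / r) *\<^sub>R fst Y + (snd Y / r) *\<^sub>R fst X, - r * g p [fst X, fst Y])"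
  by (simp add: christoffel_cone[OF chart_at(1)[OF p] chart_at_image[OF p] r] christ_def in_chart_at[OF p])

lemma christ_zero: "p \<in> points M \<Longrightarrow> christ p 0 y = 0"
  unfolding christ_def
  by (rule linear_0[OF local_metric.christoffel_bilinear(2)[OF local_metric_g[OF chart_at(1)] chart_at_image]])

lemma nabla_cone_horizontal:
  assumes S: "tensor_field CM 4 S" and p: "p \<in> points M" and r: "r > 0" and Ys: "length Ys = 4"
    and D: "((\<lambda>w. in_chart CM (cone_chart (chart_at M p)) S (w, r) Ys) has_derivative f') (at (snd (chart_at M p) p))"
  shows "nabla CM cg S (p, r) ((x, 0) # Ys) = f' x - (\<Sum>i<4. S (p, r) (Ys[i :=
    (christ p x (fst (Ys ! i)) + (snd (Ys ! i) / r) *\<^sub>R x, - r * flat g p x (fst (Ys ! i)))]))"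
proof -
  let ?c = "chart_at M p" and ?u = "snd (chart_at M p) p"
  let ?D = "frechet_derivative (\<lambda>z. in_chart CM (cone_chart ?c) S z Ys) (at (?u, r))"
  have z: "(?u, r) \<in> chart_image ?c \<times> {0<..}" using chart_at_image[OF p] r by simp
  have "((\<lambda>z. in_chart CM (cone_chart ?c) S z Ys) has_derivative ?D) (at (?u, r))"
    using local_tensor.has_derivative_T[OF local_tensor_cone[OF S chart_at(1)[OF p]] Ys z] .
  moreover have "((\<lambda>w. (w, r)) has_derivative (\<lambda>x. (x, 0))) (at ?u)"
    by (intro has_derivative_Pair has_derivative_ident has_derivative_const)
  ultimately have "((\<lambda>w. in_chart CM (cone_chart ?c) S (w, r) Ys) has_derivative (\<lambda>x. ?D (x, 0))) (at ?u)"
    using diff_chain_at[of "\<lambda>w. (w, r)" "\<lambda>x. (x, 0)" ?u "\<lambda>z. in_chart CM (cone_chart ?c) S z Ys" ?D] by (simp add: o_def)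
  from has_derivative_unique[OF D this] have "f' x = ?D (x, 0)" by simp
  then show ?thesis
    using Ys by (simp add: nabla_cone[OF p r] local_nabla_Cons christoffel_cone_at[OF p r] in_chart_at_cone[OF p r] flat_def)
qed

lemma nabla_cone_radial:
  assumes S: "tensor_field CM 4 S" and p: "p \<in> points M" and r: "r > 0" and Ys: "length Ys = 4"
  shows "((\<lambda>\<rho>. S (p, \<rho>) Ys) has_real_derivative (nabla CM cg S (p, r) ((0, 1) # Ys) +
    (\<Sum>i<4. S (p, r) (Ys[i := ((1 / r) *\<^sub>R fst (Ys ! i), 0)])))) (at r)"
proof -
  let ?c = "chart_at M p" and ?u = "snd (chart_at M p) p"
  let ?D = "frechet_derivative (\<lambda>z. in_chart CM (cone_chart ?c) S z Ys) (at (?u, r))"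
  have z: "(?u, r) \<in> chart_image ?c \<times> {0<..}" using chart_at_image[OF p] r by simp
  have D: "((\<lambda>z. in_chart CM (cone_chart ?c) S z Ys) has_derivative ?D) (at (?u, r))"
    using local_tensor.has_derivative_T[OF local_tensor_cone[OF S chart_at(1)[OF p]] Ys z] .
  moreover have "((\<lambda>\<rho>. (?u, \<rho>)) has_derivative (\<lambda>s. (0, s))) (at r)"
    by (intro has_derivative_Pair has_derivative_ident has_derivative_const)
  ultimately have "((\<lambda>\<rho>. in_chart CM (cone_chart ?c) S (?u, \<rho>) Ys) has_derivative (\<lambda>s. ?D (0, s))) (at r)"
    using diff_chain_at[of "\<lambda>\<rho>. (?u, \<rho>)" "\<lambda>s. (0, s)" r "\<lambda>z. in_chart CM (cone_chart ?c) S z Ys" ?D] by (simp add: o_def)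
  then have "((\<lambda>\<rho>. S (p, \<rho>) Ys) has_derivative (\<lambda>s. ?D (0, s))) (at r)"
    by (rule has_derivative_transform_within_open[OF _ open_greaterThan[of 0]]) (use r in_chart_at_cone[OF p] in auto)
  moreover have "(\<lambda>s. ?D (0, s)) = (*) (?D (0, 1))"
  proof
    fix s :: real
    have "(0, s) = s *\<^sub>R (0 :: 'e, 1 :: real)" by simp
    then show "?D (0, s) = ?D (0, 1) * s"
      using linear_scale[OF has_derivative_linear[OF D], of s "(0, 1)"] by simp
  qed
  ultimately have "((\<lambda>\<rho>. S (p, \<rho>) Ys) has_real_derivative ?D (0, 1)) (at r)"
    by (simp only: has_field_derivative_def)
  moreover have "?D (0, 1) = nabla CM cg S (p, r) ((0, 1) # Ys) +
    (\<Sum>i<4. S (p, r) (Ys[i := ((1 / r) *\<^sub>R fst (Ys ! i), 0)]))"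
    using Ys bilinear_formD(7)[OF bilinear_g[OF p]]
    by (simp add: nabla_cone[OF p r] local_nabla_Cons christoffel_cone_at[OF p r] in_chart_at_cone[OF p r] christ_zero[OF p])
  ultimately show ?thesis by simp
qed

end

section \<open>Parallel tensors on the cone\<close>

text \<open>The components are recovered in order of increasing number of radial arguments.\<close>

lemma cone_form_eq_zeroD:
  fixes \<kappa> :: "'v::zero tensor"
  assumes zero: "\<And>Xs. length Xs = 4 \<Longrightarrow> cone_form 1 \<kappa> \<beta> C Xs = 0"
  shows "\<kappa> [a, b] = 0" "\<beta> [a, b, c] = 0" "C [a, b, c, d] = 0"
proof -
  have C: "C [a, b, c, d] = 0" for a b c d
    using zero[of "[(a, 0), (b, 0), (c, 0), (d, 0)]"] by (simp add: cone_form_def)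
  have \<beta>: "\<beta> [a, b, c] = 0" for a b c
    using zero[of "[(0, 1), (a, 0), (b, 0), (c, 0)]"] by (simp add: cone_form_def C)
  have "\<kappa> [a, b] = 0" for a b
    using zero[of "[(0, 1), (0, 1), (a, 0), (b, 0)]"] by (simp add: cone_form_def C \<beta>)
  then show "\<kappa> [a, b] = 0" "\<beta> [a, b, c] = 0" "C [a, b, c, d] = 0" using C \<beta> by blast+
qed

context metric_manifold
begin

lemma local_tensor_smooth_fst:
  assumes T: "tensor_field M k T" and c: "c \<in> atlas M" and xs: "length xs = k"
  shows "smooth_on (chart_image c \<times> {0::real<..}) (\<lambda>z. in_chart M c T (fst z) xs)"
  by (rule smooth_on_fst[OF chart_open[OF c] local_tensor.smooth_T[OF tensor_field_local[OF T c] xs]])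

lemma in_chart_cone_form:
  assumes S: "\<And>p r Xs. p \<in> points M \<Longrightarrow> r > 0 \<Longrightarrow> S (p, r) Xs = cone_form r (\<kappa> p) (\<beta> p) (C p) Xs"
    and c: "c \<in> atlas M" "u \<in> chart_image c" "r > 0"
  shows "in_chart CM (cone_chart c) S (u, r) Xs =
    cone_form r (in_chart M c \<kappa> u) (in_chart M c \<beta> u) (in_chart M c C u) Xs"
  unfolding in_chart_cone[OF c] S[OF chart_inv_point[OF c(1,2)] c(3)] cone_form_map
  by (simp add: in_chart_def[abs_def])

lemma cone_form_tensor_field:
  assumes \<kappa>: "tensor_field M 2 \<kappa>" and \<beta>: "tensor_field M 3 \<beta>" and C: "tensor_field M 4 C"
    and S: "\<And>p r Xs. p \<in> points M \<Longrightarrow> r > 0 \<Longrightarrow> S (p, r) Xs = cone_form r (\<kappa> p) (\<beta> p) (C p) Xs"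
    and zero: "\<And>q Xs. q \<notin> points M \<times> {0<..} \<Longrightarrow> S q Xs = 0"
  shows "tensor_field CM 4 S"
  unfolding tensor_field_def points_cone atlas_cone
proof (intro conjI ballI allI impI)
  fix q assume "q \<in> points M \<times> {0::real<..}"
  then obtain p r where q: "q = (p, r)" "p \<in> points M" "r > 0" by auto
  have "S q = cone_form r (\<kappa> p) (\<beta> p) (C p)" by (rule ext) (simp add: q S)
  then show "multilinear 4 (S q)"
    using cone_form_multilinear[OF tensor_field_multilinear[OF \<kappa> q(2)] tensor_field_multilinear[OF \<beta> q(2)]
        tensor_field_multilinear[OF C q(2)]] by simp
next
  fix q Xs assume "q \<notin> points M \<times> {0::real<..}" then show "S q Xs = 0" by (rule zero)
next
  fix cc and Xs :: "('e \<times> real) list" assume "cc \<in> cone_chart ` atlas M" and "length Xs = 4"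
  then obtain c X1 X2 X3 X4 where c: "c \<in> atlas M" "cc = cone_chart c" and Xs: "Xs = [X1, X2, X3, X4]"
    using all_length4[of "\<lambda>Xs. \<exists>X1 X2 X3 X4. Xs = [X1, X2, X3, X4]"] by blast
  obtain y1 t1 y2 t2 y3 t3 y4 t4 where X: "X1 = (y1, t1)" "X2 = (y2, t2)" "X3 = (y3, t3)" "X4 = (y4, t4)"
    by (metis surj_pair)
  note op = open_cone_chart[OF c(1)]
  have "smooth_on (chart_image c \<times> {0<..}) (\<lambda>z. cone_form (snd z) (in_chart M c \<kappa> (fst z))
      (in_chart M c \<beta> (fst z)) (in_chart M c C (fst z)) Xs)"
    unfolding Xs X cone_form_def list.case prod.case
    by (intro smooth_on_add smooth_on_diff smooth_on_mult smooth_on_power smooth_on_const smooth_on_snd op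
        local_tensor_smooth_fst[OF \<kappa> c(1)] local_tensor_smooth_fst[OF \<beta> c(1)] local_tensor_smooth_fst[OF C c(1)])
      simp_all
  then show "smooth_on (chart_image cc) (\<lambda>z. in_chart CM cc S z Xs)"
    unfolding c(2) chart_image_cone
    by (rule smooth_on_cong[OF op, rotated]) (auto simp: in_chart_cone_form[OF S c(1)])
qed

text \<open>The horizontal derivative of a cone form is again a cone form. Its components are the defects
  in \<open>\<nabla>\<kappa> = \<beta>\<close> and in the two equations of (b).\<close>

lemma nabla_cone_form_horizontal:
  assumes \<kappa>: "symmetric2_field M \<kappa>" and \<beta>: "tensor_field M 3 \<beta>" and C: "tensor_field M 4 C"
    and hook: "\<And>p. p \<in> points M \<Longrightarrow> hook_symmetries (\<lambda>x y z. \<beta> p [x, y, z])"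
    and curv: "\<And>p. p \<in> points M \<Longrightarrow> curvature_symmetries (\<lambda>x y z w. C p [x, y, z, w])"
    and S: "\<And>p r Xs. p \<in> points M \<Longrightarrow> r > 0 \<Longrightarrow> S (p, r) Xs = cone_form r (\<kappa> p) (\<beta> p) (C p) Xs"
    and tS: "tensor_field CM 4 S" and p: "p \<in> points M" and r: "r > 0" and Ys: "length Ys = 4"
  shows "nabla CM cg S (p, r) ((x, 0) # Ys) = cone_form r
    (\<lambda>xs. nabla M g \<kappa> p (x # xs) - \<beta> p (x # xs))
    (\<lambda>xs. nabla M g \<beta> p (x # xs) - C p (x # xs) + 2 * odot21 (\<kappa> p) (flat g p x) xs)
    (\<lambda>xs. nabla M g C p (x # xs) + odot31 (\<beta> p) (flat g p x) xs) Ys"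
proof -
  have t: "tensor_field M 2 \<kappa>" and s: "\<And>x y. \<kappa> p [x, y] = \<kappa> p [y, x]"
    using \<kappa> p by (auto simp: symmetric2_field_def symmetric2_def)
  let ?c = "chart_at M p" and ?u = "snd (chart_at M p) p"
  obtain y1 t1 y2 t2 y3 t3 y4 t4 where Y: "Ys = [(y1, t1), (y2, t2), (y3, t3), (y4, t4)]"
    using Ys all_length4[of "\<lambda>Ys. \<exists>y1 t1 y2 t2 y3 t3 y4 t4. Ys = [(y1, t1), (y2, t2), (y3, t3), (y4, t4)]"]
    by auto
  note D = dT_has_derivative[OF t p] dT_has_derivative[OF \<beta> p] dT_has_derivative[OF C p]
  have "((\<lambda>w. cone_form r (in_chart M ?c \<kappa> w) (in_chart M ?c \<beta> w) (in_chart M ?c C w) Ys) has_derivative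
      (\<lambda>x. cone_form r (dT \<kappa> p x) (dT \<beta> p x) (dT C p x) Ys)) (at ?u)"
    unfolding Y cone_form_def list.case prod.case
    by (intro has_derivative_add has_derivative_diff has_derivative_mult_right D) simp_all
  then have "((\<lambda>w. in_chart CM (cone_chart ?c) S (w, r) Ys) has_derivative
      (\<lambda>x. cone_form r (dT \<kappa> p x) (dT \<beta> p x) (dT C p x) Ys)) (at ?u)"
    by (rule has_derivative_transform_within_open[OF _ chart_open[OF chart_at(1)[OF p]] chart_at_image[OF p]])
      (rule in_chart_cone_form[OF S chart_at(1)[OF p] _ r, symmetric])
  note h = nabla_cone_horizontal[OF tS p r Ys this, of x]
  define \<kappa>' where "\<kappa>' xs = (\<Sum>i<length xs. \<kappa> p (xs[i := christ p x (xs ! i)])) + \<beta> p (x # xs)" for xs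
  define \<beta>' where "\<beta>' xs = (\<Sum>i<length xs. \<beta> p (xs[i := christ p x (xs ! i)])) + C p (x # xs)
    - 2 * odot21 (\<kappa> p) (flat g p x) xs" for xs
  define C' where "C' xs = (\<Sum>i<length xs. C p (xs[i := christ p x (xs ! i)])) - odot31 (\<beta> p) (flat g p x) xs" for xs
  have conn: "(\<Sum>i<4. S (p, r) (Ys[i := (christ p x (fst (Ys ! i)) + (snd (Ys ! i) / r) *\<^sub>R x, - r * flat g p x (fst (Ys ! i)))]))
    = cone_form r \<kappa>' \<beta>' C' Ys"
    unfolding S[OF p r]
    by (rule cone_form_connection[OF r tensor_field_multilinear[OF t p] tensor_field_multilinear[OF \<beta> p]
        tensor_field_multilinear[OF C p] s hook[OF p] curv[OF p] _ _ _ Ys])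
      (simp_all add: \<kappa>'_def \<beta>'_def C'_def)
  show ?thesis
    unfolding h conn cone_form_minus
    by (rule cone_form_cong; simp add: nabla2[OF p] nabla3[OF p] nabla4[OF p] \<kappa>'_def \<beta>'_def C'_def)
qed

lemma nabla_cone_form_radial:
  assumes m: "multilinear 2 \<kappa>" "multilinear 3 \<beta>" "multilinear 4 C"
    and S: "\<And>r Xs. r > 0 \<Longrightarrow> S (p, r) Xs = cone_form r \<kappa> \<beta> C Xs"
    and tS: "tensor_field CM 4 S" and p: "p \<in> points M" and r: "r > 0" and Ys: "length Ys = 4"
  shows "nabla CM cg S (p, r) ((0, 1) # Ys) = 0"
proof -
  have "((\<lambda>\<rho>. cone_form \<rho> \<kappa> \<beta> C Ys) has_real_derivative
      (\<Sum>i<4. S (p, r) (Ys[i := ((1 / r) *\<^sub>R fst (Ys ! i), 0)]))) (at r)"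
    using cone_form_radial[OF r cone_form_multilinear[OF m] Ys] by (simp only: S[OF r])
  then have "((\<lambda>\<rho>. S (p, \<rho>) Ys) has_real_derivative
      (\<Sum>i<4. S (p, r) (Ys[i := ((1 / r) *\<^sub>R fst (Ys ! i), 0)]))) (at r)"
    by (rule has_field_derivative_transform_within_open[OF _ open_greaterThan[of 0]]) (use r S in auto)
  from DERIV_unique[OF this nabla_cone_radial[OF tS p r Ys]] show ?thesis by simp
qed

text \<open>On Killing tensors \<open>\<kappa>\<^sup>1 = \<nabla>\<kappa>\<close>, so that \<open>S\<^sup>\<kappa>\<close> takes this simple shape.\<close>

lemma S_of_cone_form:
  assumes \<kappa>: "symmetric2_field M \<kappa>" and hook: "hook_symmetries (\<lambda>x y z. nabla M g \<kappa> p [x, y, z])"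
    and p: "p \<in> points M" and r: "r > 0"
  shows "S_of M g \<kappa> (p, r) Xs = cone_form r (\<kappa> p) (nabla M g \<kappa> p) (C_of M g \<kappa> p) Xs"
proof (cases "length Xs = 4")
  case False
  then show ?thesis
    using C_of_degenerate[of \<kappa> p "map fst Xs"] \<kappa>
    by (auto simp: S_of_def cone_form_def odot22_def odot31_def S22_def pullback_def symmetric2_field_def split: list.split)
next
  case True
  have s: "\<kappa> p [x, y] = \<kappa> p [y, x]" for x y
    using \<kappa> p by (auto simp: symmetric2_field_def symmetric2_def)
  have "\<forall>Xs. length Xs = 4 \<longrightarrow> S_of M g \<kappa> (p, r) Xs = cone_form r (\<kappa> p) (nabla M g \<kappa> p) (C_of M g \<kappa> p) Xs"
    unfolding all_length4
  proof (intro allI)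
    fix X1 X2 X3 X4 :: "'e \<times> real"
    obtain y1 t1 y2 t2 y3 t3 y4 t4 where X: "X1 = (y1, t1)" "X2 = (y2, t2)" "X3 = (y3, t3)" "X4 = (y4, t4)"
      by (metis surj_pair)
    have b: "pullback (prolong1 M g \<kappa>) (p, r) [Y1, Y2, Y3] = nabla M g \<kappa> p [fst Y1, fst Y2, fst Y3]"
      for Y1 Y2 Y3 :: "'e \<times> real"
      using P21_hook[OF hook] by (simp add: pullback_def prolong1_def)
    have "hook_symmetries (\<lambda>Y1 Y2 Y3. pullback (prolong1 M g \<kappa>) (p, r) [Y1, Y2, Y3])"
      using hook unfolding b hook_symmetries_def by blast
    note o31 = odot31_hook[OF this, of dr]
    have o22: "odot22 (pullback \<kappa> (p, r)) (bullet dr dr) [X1, X2, X3, X4] =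
        2 * t1 * t2 * \<kappa> p [y3, y4] + 2 * t3 * t4 * \<kappa> p [y1, y2] - t1 * t3 * \<kappa> p [y2, y4]
         - t1 * t4 * \<kappa> p [y2, y3] - t2 * t3 * \<kappa> p [y1, y4] - t2 * t4 * \<kappa> p [y1, y3]"
      using s[of y2 y1] s[of y3 y1] s[of y4 y1] s[of y3 y2] s[of y4 y2] s[of y4 y3]
      by (simp add: odot22_def S22_def alternate_odd_even_def pullback_def bullet_def dr_def X algebra_simps)
    show "S_of M g \<kappa> (p, r) [X1, X2, X3, X4] = cone_form r (\<kappa> p) (nabla M g \<kappa> p) (C_of M g \<kappa> p) [X1, X2, X3, X4]"
      using p r by (simp add: S_of_def o22 o31 b) (simp add: pullback_def dr_def X cone_form_def)
  qed
  then show ?thesis using True by blast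
qed

lemma S_of_zero: "q \<notin> points M \<times> {0<..} \<Longrightarrow> S_of M g \<kappa> q Xs = 0"
  by (auto simp: S_of_def)

lemma parallel_iff:
  "S \<in> parallel_sym_curvature_tensors CM cg \<longleftrightarrow> sym_curvature_field CM S \<and>
    (\<forall>p\<in>points M. \<forall>r>0. \<forall>X Ys. length Ys = 4 \<longrightarrow> nabla CM cg S (p, r) (X # Ys) = 0)"
  unfolding parallel_sym_curvature_tensors_def points_cone by auto

text \<open>From (a) to (c): the horizontal derivative of \<open>S\<^sup>\<kappa>\<close> vanishes by the prolonged system, the
  radial one by homogeneity.\<close>

theorem killing_imp_parallel:
  assumes \<kappa>: "\<kappa> \<in> nullity_killing_tensors M g"
  shows "S_of M g \<kappa> \<in> parallel_sym_curvature_tensors CM cg"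
proof -
  have killing: "killing2 M g \<kappa>" using \<kappa> by (simp add: nullity_killing_tensors_iff)
  then have sf: "symmetric2_field M \<kappa>" and t: "tensor_field M 2 \<kappa>"
    by (auto simp: killing2_def symmetric2_field_def)
  note hook = killing_hook_symmetries[OF killing] and t3 = tensor_field_nabla2[OF t]
  have sC: "sym_curvature_field M (C_of M g \<kappa>)" and first: "first_equation \<kappa> (C_of M g \<kappa>)"
    and second: "second_equation \<kappa> (C_of M g \<kappa>)"
    using killing_imp_prolongation_pair[OF \<kappa>] by (simp_all add: prolongation_pairs_iff)
  then have t4: "tensor_field M 4 (C_of M g \<kappa>)" by (simp add: sym_curvature_field_def)
  have symC: "curvature_symmetries (\<lambda>x y z w. C_of M g \<kappa> p [x, y, z, w])" if "p \<in> points M" for p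
    using sC that by (intro sym_curvature_like_symmetries) (auto simp: sym_curvature_field_def tensor_field_def)
  have s: "\<kappa> p [x, y] = \<kappa> p [y, x]" if "p \<in> points M" for p x y
    using sf that by (auto simp: symmetric2_field_def symmetric2_def)
  note S = S_of_cone_form[OF sf hook]
  have tS: "tensor_field CM 4 (S_of M g \<kappa>)"
    by (rule cone_form_tensor_field[OF t t3 t4 S S_of_zero])
  have "sym_curvature_like (S_of M g \<kappa> q)" if "q \<in> points CM" for q
  proof -
    obtain p r where q: "q = (p, r)" "p \<in> points M" "r > 0" using \<open>q \<in> points CM\<close> unfolding points_cone by auto
    have "S_of M g \<kappa> q = cone_form r (\<kappa> p) (nabla M g \<kappa> p) (C_of M g \<kappa> p)"
      by (rule ext) (simp add: q S)
    then show ?thesis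
      using symmetries_sym_curvature_like[OF cone_form_symmetries[where \<kappa> = "\<kappa> p",
            OF s[OF q(2)] hook[OF q(2)] symC[OF q(2)]]] by simp
  qed
  then have "sym_curvature_field CM (S_of M g \<kappa>)" using tS by (simp add: sym_curvature_field_def)
  moreover have "nabla CM cg (S_of M g \<kappa>) (p, r) (X # Ys) = 0"
    if p: "p \<in> points M" and r: "r > 0" and Ys: "length Ys = 4" for p r X Ys
  proof -
    have "nabla CM cg (S_of M g \<kappa>) (p, r) ((fst X, 0) # Ys) = cone_form r
      (\<lambda>xs. nabla M g \<kappa> p (fst X # xs) - nabla M g \<kappa> p (fst X # xs))
      (\<lambda>xs. nabla M g (nabla M g \<kappa>) p (fst X # xs) - C_of M g \<kappa> p (fst X # xs)
        + 2 * odot21 (\<kappa> p) (flat g p (fst X)) xs)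
      (\<lambda>xs. nabla M g (C_of M g \<kappa>) p (fst X # xs) + odot31 (nabla M g \<kappa> p) (flat g p (fst X)) xs) Ys"
      by (rule nabla_cone_form_horizontal[OF sf t3 t4 hook symC S tS p r Ys])
    also have "\<dots> = 0"
      by (rule cone_form_zero) (use first second p in \<open>simp_all add: first_equation_def second_equation_def\<close>)
    finally have h: "nabla CM cg (S_of M g \<kappa>) (p, r) ((fst X, 0) # Ys) = 0" .
    have v: "nabla CM cg (S_of M g \<kappa>) (p, r) ((0, 1) # Ys) = 0"
      by (rule nabla_cone_form_radial[OF tensor_field_multilinear[OF t p] tensor_field_multilinear[OF t3 p]
          tensor_field_multilinear[OF t4 p] S[OF p] tS p r Ys]) (rule p)
    show ?thesis using nabla_cone_split[OF tS p r Ys, of "fst X" "snd X"] h v by simp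
  qed
  ultimately show ?thesis unfolding parallel_iff by blast
qed

text \<open>The restriction to \<open>r = 1\<close> of the components of a tensor on the cone with \<open>j\<close> radial
  arguments.\<close>

definition slice :: "nat \<Rightarrow> real \<Rightarrow> ('a \<times> real \<Rightarrow> ('e \<times> real) tensor) \<Rightarrow> 'a \<Rightarrow> 'e tensor" where
  "slice j a S p xs = (if length xs + j = 4 then a * S (p, 1) (replicate j (0, 1) @ map (\<lambda>x. (x, 0)) xs) else 0)"

lemma slice_tensor_field:
  assumes S: "tensor_field CM 4 S" and j: "k + j = 4"
  shows "tensor_field M k (slice j a S)"
  unfolding tensor_field_def
proof (intro conjI ballI allI impI)
  fix p assume p: "p \<in> points M"
  have m: "multilinear 4 (S (p, 1))" using S p by (simp add: tensor_field_def points_cone)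
  have emb: "linear (\<lambda>x::'e. (x, 0::real))" by (intro linearI) auto
  show "multilinear k (slice j a S p)"
    unfolding multilinear_def
  proof (intro conjI allI impI)
    fix xs :: "'e list" and i assume xs: "length xs = k" "i < k"
    have "replicate j (0, 1) @ map (\<lambda>x. (x, 0)) (xs[i := x]) =
        (replicate j (0, 1) @ map (\<lambda>x. (x, 0)) xs)[j + i := (x, 0::real)]" for x :: 'e
      by (simp add: list_update_append map_update)
    then have "slice j a S p (xs[i := x]) =
        a * S (p, 1) ((replicate j (0, 1) @ map (\<lambda>x. (x, 0)) xs)[j + i := (x, 0)])" for x
      using xs j by (simp add: slice_def)
    moreover have "linear (\<lambda>x. a *\<^sub>R S (p, 1) ((replicate j (0, 1) @ map (\<lambda>x. (x, 0)) xs)[j + i := (x, 0)]))"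
      using linear_compose[OF emb multilinear_linear[OF m, of "replicate j (0, 1) @ map (\<lambda>x. (x, 0)) xs" "j + i"]] xs j
      by (intro linear_compose_scale_right) (simp add: o_def)
    ultimately show "linear (\<lambda>x. slice j a S p (xs[i := x]))" by simp
  qed (use j in \<open>auto simp: slice_def\<close>)
next
  fix p xs assume "p \<notin> points M"
  then show "slice j a S p xs = 0" using S by (simp add: slice_def tensor_field_def points_cone)
next
  fix c and xs :: "'e list" assume c: "c \<in> atlas M" and xs: "length xs = k"
  let ?Xs = "replicate j (0, 1) @ map (\<lambda>x. (x, 0)) xs :: ('e \<times> real) list"
  have "smooth_on (chart_image c \<times> {0<..}) (\<lambda>z. in_chart CM (cone_chart c) S z ?Xs)"
    by (rule local_tensor.smooth_T[OF local_tensor_cone[OF S c]]) (use xs j in simp)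
  then have "smooth_on (chart_image c) (\<lambda>u. in_chart CM (cone_chart c) S (u, 1) ?Xs)"
  proof (rule smooth_on_compose[OF chart_open[OF c] open_cone_chart[OF c], rotated 2])
    have "smooth_on (chart_image c) (\<lambda>u. (u, 0::real) + (0, 1))"
      by (rule smooth_on_add[OF chart_open[OF c] smooth_on_linear[OF chart_open[OF c] _ smooth_on_ident[OF chart_open[OF c]]]
            smooth_on_const]) (auto intro!: bounded_linear_Pair bounded_linear_ident bounded_linear_zero)
    then show "smooth_on (chart_image c) (\<lambda>u. (u, 1::real))" by simp
  qed auto
  then have "smooth_on (chart_image c) (\<lambda>u. a * in_chart CM (cone_chart c) S (u, 1) ?Xs)"
    by (intro smooth_on_mult smooth_on_const chart_open[OF c])
  moreover have "a * in_chart CM (cone_chart c) S (u, 1) ?Xs = in_chart M c (slice j a S) u xs"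
    if u: "u \<in> chart_image c" for u
    unfolding in_chart_cone[OF c u zero_less_one]
    using xs j linear_0[OF frame_linear[OF c u]] by (simp add: in_chart_def slice_def o_def)
  ultimately show "smooth_on (chart_image c) (\<lambda>u. in_chart M c (slice j a S) u xs)"
    by (rule smooth_on_cong[OF chart_open[OF c], rotated])
qed

text \<open>The differential equation is the one which parallelism imposes along a ray on a component with
  \<open>m\<close> horizontal arguments.\<close>

lemma power_law:
  fixes f :: "real \<Rightarrow> real"
  assumes "\<And>r. r > 0 \<Longrightarrow> (f has_real_derivative (real m / r) * f r) (at r)" and r: "r > 0"
  shows "f r = r ^ m * f 1"
proof -
  have "((\<lambda>r. f r / r ^ m) has_real_derivative 0) (at r)" if r: "r > 0" for r
  proof -
    have "((\<lambda>r. f r / r ^ m) has_real_derivative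
        ((real m / r) * f r * r ^ m - f r * (real m * r ^ (m - 1))) / (r ^ m * r ^ m)) (at r)"
      using assms(1)[OF r] r by (intro DERIV_divide) (auto intro!: derivative_eq_intros)
    moreover have "(real m / r) * f r * r ^ m = f r * (real m * r ^ (m - 1))"
      using r by (cases m) simp_all
    ultimately show ?thesis by simp
  qed
  then have "\<exists>c. \<forall>r\<in>{0<..}. f r / r ^ m = c"
    by (intro has_field_derivative_zero_constant) (auto intro: has_field_derivative_at_within)
  then obtain c where c: "\<And>r. r > 0 \<Longrightarrow> f r / r ^ m = c" by auto
  show ?thesis using c[OF r] c[of 1] r by (simp add: field_simps)
qed

lemma parallel_power_law:
  assumes S: "S \<in> parallel_sym_curvature_tensors CM cg" and p: "p \<in> points M" and r: "r > 0"
    and xs: "length xs + j = 4"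
  shows "S (p, r) (replicate j (0, 1) @ map (\<lambda>x. (x, 0)) xs) =
    r ^ length xs * S (p, 1) (replicate j (0, 1) @ map (\<lambda>x. (x, 0)) xs)"
proof -
  let ?Xs = "replicate j (0, 1) @ map (\<lambda>x. (x, 0)) xs :: ('e \<times> real) list"
  have tS: "tensor_field CM 4 S" using S by (simp add: parallel_iff sym_curvature_field_def)
  have len: "length ?Xs = 4" using xs by simp
  show ?thesis
  proof (rule power_law[OF _ r])
    fix r :: real assume r: "r > 0"
    have m: "multilinear 4 (S (p, r))" using tS p r by (simp add: tensor_field_def points_cone)
    have "S (p, r) (?Xs[i := ((1 / r) *\<^sub>R fst (?Xs ! i), 0)]) = (if i < j then 0 else (1 / r) * S (p, r) ?Xs)"
      if i: "i < 4" for i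
    proof (cases "i < j")
      case True
      then have "((1 / r) *\<^sub>R fst (?Xs ! i), 0) = (0 :: 'e \<times> real)" by (simp add: nth_append zero_prod_def)
      then show ?thesis using multilinear_update_zero[OF m len i] True by simp
    next
      case False
      then have X: "((1 / r) *\<^sub>R fst (?Xs ! i), 0) = (1 / r) *\<^sub>R (?Xs ! i)"
        using i xs by (simp add: nth_append)
      show ?thesis
        unfolding X using False linear_scale[OF multilinear_linear[OF m len i], of "1 / r" "?Xs ! i"] by simp
    qed
    then have "(\<Sum>i<4. S (p, r) (?Xs[i := ((1 / r) *\<^sub>R fst (?Xs ! i), 0)])) =
        (\<Sum>i<4. if i < j then 0 else (1 / r) * S (p, r) ?Xs)" by (intro sum.cong) auto
    also have "\<dots> = (\<Sum>i\<in>{j..<4}. (1 / r) * S (p, r) ?Xs)"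
      by (rule sum.mono_neutral_cong_right) auto
    also have "\<dots> = (real (length xs) / r) * S (p, r) ?Xs" using xs by simp
    finally show "((\<lambda>r. S (p, r) ?Xs) has_real_derivative (real (length xs) / r) * S (p, r) ?Xs) (at r)"
      using nabla_cone_radial[OF tS p r len] S p r len by (simp add: parallel_iff)
  qed
qed

text \<open>From (c) to (b): a parallel tensor is determined by its three slices at \<open>r = 1\<close>, and the
  vanishing of its horizontal derivative is the prolonged system for them.\<close>

theorem parallel_imp_prolongation_pair:
  assumes S: "S \<in> parallel_sym_curvature_tensors CM cg"
  shows "(kappa_of S, slice 0 1 S) \<in> prolongation_pairs M g"
    and "\<And>p r Xs. p \<in> points M \<Longrightarrow> r > 0 \<Longrightarrow>
      S (p, r) Xs = cone_form r (kappa_of S p) (nabla M g (kappa_of S) p) (slice 0 1 S p) Xs"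
proof -
  define \<kappa> where "\<kappa> = slice 2 (1/2) S"
  define \<beta> where "\<beta> = slice 1 1 S"
  define C where "C = slice 0 1 S"
  have \<kappa>_eq: "\<kappa> p [x, y] = 1/2 * S (p, 1) [(0, 1), (0, 1), (x, 0), (y, 0)]"
    and \<beta>_eq: "\<beta> p [x, y, z] = S (p, 1) [(0, 1), (x, 0), (y, 0), (z, 0)]"
    and C_eq: "C p [x, y, z, w] = S (p, 1) [(x, 0), (y, 0), (z, 0), (w, 0)]" for p x y z w
    by (simp_all add: \<kappa>_def \<beta>_def C_def slice_def numeral_2_eq_2)
  have kappa: "kappa_of S = \<kappa>"
  proof (intro ext)
    fix p and xs :: "'e list"
    show "kappa_of S p xs = \<kappa> p xs"
    proof (cases "length xs = 2")
      case True
      then obtain x y where "xs = [x, y]" using all_length2[of "\<lambda>xs. \<exists>x y. xs = [x, y]"] by blast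
      then show ?thesis by (simp add: kappa_of_def \<kappa>_eq)
    next
      case False
      then show ?thesis by (auto simp: kappa_of_def \<kappa>_def slice_def split: list.split)
    qed
  qed
  have sS: "sym_curvature_field CM S"
    and parallel: "\<And>p r X Ys. p \<in> points M \<Longrightarrow> r > 0 \<Longrightarrow> length Ys = 4 \<Longrightarrow> nabla CM cg S (p, r) (X # Ys) = 0"
    using S unfolding parallel_iff by blast+
  have tS: "tensor_field CM 4 S" using sS by (simp add: sym_curvature_field_def)
  have t\<kappa>: "tensor_field M 2 \<kappa>" and t\<beta>: "tensor_field M 3 \<beta>" and tC: "tensor_field M 4 C"
    unfolding \<kappa>_def \<beta>_def C_def by (rule slice_tensor_field[OF tS]; simp)+
  have m: "multilinear 4 (S (p, r))" and sy: "curvature_symmetries (\<lambda>X Y Z W. S (p, r) [X, Y, Z, W])"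
    if "p \<in> points M" "r > 0" for p r
    using sS that by (auto simp: sym_curvature_field_def tensor_field_def points_cone intro: sym_curvature_like_symmetries)
  note sy1 = curvature_symmetriesD[OF sy[OF _ zero_less_one]]
  have s: "\<kappa> p [x, y] = \<kappa> p [y, x]" if "p \<in> points M" for p x y
    using sy1(2)[OF that] by (simp add: \<kappa>_eq)
  have sf: "symmetric2_field M \<kappa>" using t\<kappa> s by (simp add: symmetric2_field_def symmetric2_def)
  have hook: "hook_symmetries (\<lambda>x y z. \<beta> p [x, y, z])" if p: "p \<in> points M" for p
    unfolding hook_symmetries_def
  proof (intro allI conjI)
    fix x y z
    let ?E = "(0, 1) :: 'e \<times> real" and ?x = "(x, 0) :: 'e \<times> real" and ?y = "(y, 0) :: 'e \<times> real" and ?z = "(z, 0) :: 'e \<times> real"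
    show "\<beta> p [x, y, z] = \<beta> p [x, z, y]" unfolding \<beta>_eq by (rule sy1(2)[OF p])
    have "S (p, 1) [?E, ?x, ?y, ?z] = S (p, 1) [?y, ?z, ?x, ?E]" "S (p, 1) [?E, ?y, ?z, ?x] = S (p, 1) [?z, ?x, ?y, ?E]"
      "S (p, 1) [?E, ?z, ?x, ?y] = S (p, 1) [?x, ?y, ?z, ?E]"
      using sy1(3)[OF p, of ?E ?x ?y ?z] sy1(2)[OF p, of ?y ?z ?E ?x] sy1(3)[OF p, of ?E ?y ?z ?x]
        sy1(2)[OF p, of ?z ?x ?E ?y] sy1(3)[OF p, of ?E ?z ?x ?y] sy1(2)[OF p, of ?x ?y ?E ?z] by simp_all
    then show "\<beta> p [x, y, z] + \<beta> p [y, z, x] + \<beta> p [z, x, y] = 0"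
      unfolding \<beta>_eq using sy1(4)[OF p, of ?x ?y ?z ?E] by simp
  qed
  have curv: "curvature_symmetries (\<lambda>x y z w. C p [x, y, z, w])" if p: "p \<in> points M" for p
    unfolding C_eq curvature_symmetries_def using sy1[OF p] by blast
  have form: "S (p, r) Xs = cone_form r (\<kappa> p) (\<beta> p) (C p) Xs" if p: "p \<in> points M" and r: "r > 0" for p r Xs
  proof (rule curvature_cone_form[OF m[OF p r] sy[OF p r]])
    note pl = parallel_power_law[OF S p r]
    show "S (p, r) [(0, 1), (0, 1), (a, 0), (b, 0)] = 2 * r\<^sup>2 * \<kappa> p [a, b]" for a b
      using pl[of "[a, b]" 2] by (simp add: \<kappa>_eq numeral_2_eq_2)
    show "S (p, r) [(0, 1), (a, 0), (b, 0), (c, 0)] = r ^ 3 * \<beta> p [a, b, c]" for a b c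
      using pl[of "[a, b, c]" 1] by (simp add: \<beta>_eq numeral_3_eq_3)
    show "S (p, r) [(a, 0), (b, 0), (c, 0), (d, 0)] = r ^ 4 * C p [a, b, c, d]" for a b c d
      using pl[of "[a, b, c, d]" 0] by (simp add: C_eq eval_nat_numeral)
  qed
  have hor: "cone_form 1 (\<lambda>xs. nabla M g \<kappa> p (x # xs) - \<beta> p (x # xs))
    (\<lambda>xs. nabla M g \<beta> p (x # xs) - C p (x # xs) + 2 * odot21 (\<kappa> p) (flat g p x) xs)
    (\<lambda>xs. nabla M g C p (x # xs) + odot31 (\<beta> p) (flat g p x) xs) Ys = 0"
    if p: "p \<in> points M" and Ys: "length Ys = 4" for p x Ys
  proof -
    have "nabla CM cg S (p, 1) ((x, 0) # Ys) = cone_form 1 (\<lambda>xs. nabla M g \<kappa> p (x # xs) - \<beta> p (x # xs))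
      (\<lambda>xs. nabla M g \<beta> p (x # xs) - C p (x # xs) + 2 * odot21 (\<kappa> p) (flat g p x) xs)
      (\<lambda>xs. nabla M g C p (x # xs) + odot31 (\<beta> p) (flat g p x) xs) Ys"
      by (rule nabla_cone_form_horizontal[OF sf t\<beta> tC hook curv form tS p zero_less_one Ys])
    then show ?thesis using parallel[OF p zero_less_one Ys, of "(x, 0)"] by simp
  qed
  note zero = cone_form_eq_zeroD[OF hor]
  have K: "nabla M g \<kappa> p [x, a, b] = \<beta> p [x, a, b]" if p: "p \<in> points M" for p x a b
    using zero(1)[OF p, of x a b] by simp
  have nabla: "nabla M g \<kappa> = \<beta>"
  proof (intro ext)
    fix p and xs :: "'e list"
    show "nabla M g \<kappa> p xs = \<beta> p xs"
    proof (cases "p \<in> points M \<and> length xs = 3")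
      case True
      then show ?thesis using K all_length3[of "\<lambda>xs. nabla M g \<kappa> p xs = \<beta> p xs"] by blast
    next
      case False
      then show ?thesis
        using multilinear_length[OF tensor_field_multilinear[OF t\<beta>], of p xs] t\<beta>
          multilinear_length[OF tensor_field_multilinear[OF tensor_field_nabla2[OF t\<kappa>]], of p xs]
        by (cases "p \<in> points M") (simp_all add: tensor_field_def nabla_def)
    qed
  qed
  have "first_equation \<kappa> C"
    unfolding first_equation_def nabla
  proof (intro ballI allI)
    fix p x a b c assume p: "p \<in> points M"
    show "C p [x, a, b, c] = nabla M g \<beta> p [x, a, b, c] + 2 * odot21 (\<kappa> p) (flat g p x) [a, b, c]"
      using zero(2)[OF p, of x a b c] by simp
  qed
  moreover have "second_equation \<kappa> C"
    unfolding second_equation_def nabla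
  proof (intro ballI allI)
    fix p x a b c d assume p: "p \<in> points M"
    show "nabla M g C p [x, a, b, c, d] = - odot31 (\<beta> p) (flat g p x) [a, b, c, d]"
      using zero(3)[OF p, of x a b c d] by (simp add: eq_neg_iff_add_eq_0)
  qed
  moreover have "sym_curvature_field M C"
    using tC symmetries_sym_curvature_like[OF curv] by (simp add: sym_curvature_field_def)
  ultimately show "(kappa_of S, slice 0 1 S) \<in> prolongation_pairs M g"
    using sf by (simp add: prolongation_pairs_iff kappa C_def)
  show "S (p, r) Xs = cone_form r (kappa_of S p) (nabla M g (kappa_of S) p) (slice 0 1 S p) Xs"
    if "p \<in> points M" "r > 0" for p r Xs
    using form[OF that] by (simp add: kappa nabla C_def)
qed

text \<open>Since \<open>S\<close> and \<open>S\<^sup>\<kappa>\<close> for \<open>\<kappa> = \<kappa>\<^sub>S\<close> are both cone forms, they agree as soon as the slice without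
  radial arguments is \<open>C\<^sup>\<kappa>\<close>.\<close>

theorem parallel_imp_killing:
  assumes dim: "DIM('e) \<ge> 2" and S: "S \<in> parallel_sym_curvature_tensors CM cg"
  shows "kappa_of S \<in> nullity_killing_tensors M g" "S_of M g (kappa_of S) = S"
proof -
  note pair = parallel_imp_prolongation_pair[OF S]
  note killing = prolongation_pair_imp_killing[OF dim pair(1)]
  show "kappa_of S \<in> nullity_killing_tensors M g" by (rule killing(1))
  then have k: "killing2 M g (kappa_of S)" by (simp add: nullity_killing_tensors_iff)
  then have sf: "symmetric2_field M (kappa_of S)" by (simp add: killing2_def)
  show "S_of M g (kappa_of S) = S"
  proof (intro ext)
    fix q Xs
    show "S_of M g (kappa_of S) q Xs = S q Xs"
    proof (cases "q \<in> points M \<times> {0<..}")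
      case True
      then obtain p r where q: "q = (p, r)" "p \<in> points M" "r > 0" by auto
      then show ?thesis
        using S_of_cone_form[OF sf killing_hook_symmetries[OF k q(2)] q(2,3)] pair(2)[OF q(2,3)] killing(2) by simp
    next
      case False
      have "tensor_field CM 4 S" using S by (simp add: parallel_iff sym_curvature_field_def)
      then have "S q Xs = 0" using False unfolding tensor_field_def points_cone by blast
      then show ?thesis using S_of_zero[OF False] by simp
    qed
  qed
qed

theorem kappa_of_S_of:
  assumes \<kappa>: "\<kappa> \<in> nullity_killing_tensors M g"
  shows "kappa_of (S_of M g \<kappa>) = \<kappa>"
proof (intro ext)
  fix p and xs :: "'e list"
  have k: "killing2 M g \<kappa>" using \<kappa> by (simp add: nullity_killing_tensors_iff)
  then have sf: "symmetric2_field M \<kappa>" and t: "tensor_field M 2 \<kappa>" by (auto simp: killing2_def symmetric2_field_def)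
  show "kappa_of (S_of M g \<kappa>) p xs = \<kappa> p xs"
  proof (cases "p \<in> points M \<and> length xs = 2")
    case True
    then obtain x y where "xs = [x, y]" using all_length2[of "\<lambda>xs. \<exists>x y. xs = [x, y]"] by blast
    have "tensor_field M 4 (C_of M g \<kappa>)"
      using killing_imp_prolongation_pair[OF \<kappa>] by (simp add: prolongation_pairs_iff sym_curvature_field_def)
    note zero = multilinear3D(1)[OF tensor_field_multilinear[OF tensor_field_nabla2[OF t]], THEN linear_0]
      multilinear4D(1)[OF tensor_field_multilinear[OF this], THEN linear_0]
    have p: "p \<in> points M" using True by simp
    show ?thesis
      unfolding \<open>xs = [x, y]\<close> kappa_of_def list.case
        S_of_cone_form[OF sf killing_hook_symmetries[OF k p] p zero_less_one]
      by (simp add: cone_form_def zero[OF p])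
  next
    case False
    then show ?thesis
      using multilinear_length[OF tensor_field_multilinear[OF t], of p xs] t
      by (cases "p \<in> points M") (auto simp: kappa_of_def S_of_zero tensor_field_def split: list.split)
  qed
qed

end

section \<open>The correspondence\<close>

theorem theorem1:
  fixes M :: "('a, 'e::euclidean_space) manifold"
    and g :: "'a \<Rightarrow> 'e tensor"
  assumes "pseudo_riemannian M g"
    and "DIM('e) \<ge> 2"
  shows "bij_betw (\<lambda>\<kappa>. (\<kappa>, C_of M g \<kappa>)) (nullity_killing_tensors M g) (prolongation_pairs M g)
    \<and> bij_betw (S_of M g) (nullity_killing_tensors M g)
        (parallel_sym_curvature_tensors (cone_manifold M) (cone_metric M g))
    \<and> bij_betw kappa_of (parallel_sym_curvature_tensors (cone_manifold M) (cone_metric M g))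
        (nullity_killing_tensors M g)
    \<and> (\<forall>\<kappa>\<in>nullity_killing_tensors M g. kappa_of (S_of M g \<kappa>) = \<kappa>)
    \<and> (\<forall>S\<in>parallel_sym_curvature_tensors (cone_manifold M) (cone_metric M g).
        S_of M g (kappa_of S) = S)"
proof -
  interpret metric_manifold M g
    using assms(1) by unfold_locales (simp_all add: pseudo_riemannian_def)
  let ?A = "nullity_killing_tensors M g" and ?B = "prolongation_pairs M g"
    and ?P = "parallel_sym_curvature_tensors (cone_manifold M) (cone_metric M g)"
  have SP: "S_of M g ` ?A \<subseteq> ?P" using killing_imp_parallel by blast
  have PA: "kappa_of ` ?P \<subseteq> ?A" using parallel_imp_killing(1)[OF assms(2)] by blast
  have id1: "\<forall>\<kappa>\<in>?A. kappa_of (S_of M g \<kappa>) = \<kappa>" using kappa_of_S_of by blast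
  have id2: "\<forall>S\<in>?P. S_of M g (kappa_of S) = S" using parallel_imp_killing(2)[OF assms(2)] by blast
  have "bij_betw (\<lambda>\<kappa>. (\<kappa>, C_of M g \<kappa>)) ?A ?B"
  proof (rule bij_betw_byWitness[where f' = fst])
    show "\<forall>b\<in>?B. (fst b, C_of M g (fst b)) = b"
      using prolongation_pair_imp_killing(2)[OF assms(2)] by auto
    show "(\<lambda>\<kappa>. (\<kappa>, C_of M g \<kappa>)) ` ?A \<subseteq> ?B" using killing_imp_prolongation_pair by blast
    show "fst ` ?B \<subseteq> ?A" using prolongation_pair_imp_killing(1)[OF assms(2)] by auto
  qed simp
  moreover have "bij_betw (S_of M g) ?A ?P" by (rule bij_betw_byWitness[OF id1 id2 SP PA])
  moreover have "bij_betw kappa_of ?P ?A" by (rule bij_betw_byWitness[OF id2 id1 PA SP])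
  ultimately show ?thesis using id1 id2 by blast
qed

end
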